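(* Fix a constant $1<p\leq\infty$ and an ordinal $1\leq\xi\leq\omega_1$. There exists a Banach space $X$ for which $\mathcal{WD}_{\ell_p}^{(\infty,\xi)}(X)$ is not norm-closed in $\mathcal{L}(X)$. If $p\neq\infty$, then $X$ can be chosen to be reflexive.
   Context: All Banach spaces are over a fixed scalar field ($\mathbb{R}$ or $\mathbb{C}$); $\mathcal{L}(X,Y)$ is the space of continuous linear operators $X\to Y$ with the operator norm, and $\mathcal{L}(X):=\mathcal{L}(X,X)$; $c_{00}$ is the space of finitely supported scalar sequences; $\omega_1$ is the first uncountable ordinal. For finite $E,F\subset\mathbb{N}$, $E<F$ means $\max E<\min F$, and $n\leq F$ means $n\leq\min F$. Schreier families: $\mathcal{S}_0:=\{\{n\}:n\in\mathbb{N}\}\cup\{\emptyset\}$ and $\mathcal{S}_1:=\{F\subset\mathbb{N}:\#F\leq\min F\}\cup\{\emptyset\}$. If $\xi=\zeta+1$ with $1\leq\zeta<\omega_1$, $\mathcal{S}_\xi$ consists of $\emptyset$ and all $F\subset\mathbb{N}$ for which there are $n\in\mathbb{N}$ and $F_1<\cdots<F_n$ in $\mathcal{S}_\zeta$ with $\{\min F_k\}_{k=1}^n\in\mathcal{S}_1$ and $F=\bigcup_{k=1}^nF_k$. If $\xi<\omega_1$ is a limit ordinal, fix a strictly increasing sequence $(\zeta_n)$ of non-limit ordinals with $\sup_n\zeta_n=\xi$ and set $\mathcal{S}_\xi:=\bigcup_{n=1}^\infty\{F\in\mathcal{S}_{\zeta_n}:n\leq F\}$. Finally $\mathcal{S}_{\omega_1}:=\{F\subset\mathbb{N}:\#F<\infty\}$.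 For $1\leq\xi\leq\omega_1$ put $\mathcal{A}_\xi:=\{(\alpha_k)\in c_{00}:\mathrm{supp}(\alpha_k)\in\mathcal{S}_\xi\}$. For $1\leq p\leq\infty$ and $0\leq C<\infty$, $\mathcal{WD}_{\ell_p}^{(C,\xi)}(X,Y)$ is the set of all $T\in\mathcal{L}(X,Y)$ such that for every $\epsilon>0$, each normalized weakly null sequence $(x_n)\subset X$ admits a subsequence $(x_{n_k})$ with $\|\sum\alpha_kTx_{n_k}\|\leq(C+\epsilon)\|(\alpha_k)\|_{\ell_p}$ for all $(\alpha_k)\in\mathcal{A}_\xi$. Set $\mathcal{WD}_{\ell_p}^{(\infty,\xi)}(X,Y):=\bigcup_{0\leq C<\infty}\mathcal{WD}_{\ell_p}^{(C,\xi)}(X,Y)$ and $\mathcal{WD}_{\ell_p}^{(\infty,\xi)}(X):=\mathcal{WD}_{\ell_p}^{(\infty,\xi)}(X,X)$. *)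

theory Defs
  imports
    "HOL-Analysis.Analysis"
    "HOL-Library.Function_Algebras"
    "HOL-Library.Countable_Set_Type"
begin

section \<open>Countable ordinals and ordinals up to \<open>\<omega>\<^sub>1\<close>\<close>

typedef countable_ordinal = "Field (cardSuc natLeq)"
  morphisms Rep_cord Abs_cord
proof -
  have "\<not> finite (Field (cardSuc natLeq))"
    using cardSuc_finite[OF natLeq_Card_order] Field_natLeq by simp
  then show "\<exists>x. x \<in> Field (cardSuc natLeq)"
    by (metis all_not_in_conv finite.emptyI)
qed

instantiation countable_ordinal :: wellorder
begin

definition "x \<le> y \<longleftrightarrow> (Rep_cord x, Rep_cord y) \<in> cardSuc natLeq"
definition "(x :: countable_ordinal) < y \<longleftrightarrow> x \<le> y \<and> \<not> y \<le> x"

instance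
proof -
  have wo: "Well_order (cardSuc natLeq)"
    using cardSuc_Well_order natLeq_Card_order by blast
  interpret wo_rel "cardSuc natLeq"
    by (simp add: wo_rel_def wo)
  have refl: "x \<le> x" for x :: countable_ordinal
    unfolding less_eq_countable_ordinal_def by (rule refl_onD[OF REFL Rep_cord])
  have antisym: "x \<le> y \<Longrightarrow> y \<le> x \<Longrightarrow> x = y" for x y :: countable_ordinal
    unfolding less_eq_countable_ordinal_def using antisymD[OF ANTISYM] Rep_cord_inject by metis
  have trans: "x \<le> y \<Longrightarrow> y \<le> z \<Longrightarrow> x \<le> z" for x y z :: countable_ordinal
    unfolding less_eq_countable_ordinal_def by (rule transD[OF TRANS])
  have total: "x \<le> y \<or> y \<le> x" for x y :: countable_ordinal
    using TOTALS Rep_cord[of x] Rep_cord[of y] by (simp add: less_eq_countable_ordinal_def)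
  have induct: "P a" if step: "\<And>x. (\<And>y. y < x \<Longrightarrow> P y) \<Longrightarrow> P x"
    for P :: "countable_ordinal \<Rightarrow> bool" and a
  proof -
    have "wf (inv_image (cardSuc natLeq - Id) Rep_cord)"
      using WF by (rule wf_inv_image)
    then show "P a"
    proof (induction a rule: wf_induct_rule)
      case (less x)
      show ?case
      proof (rule step)
        fix y assume "y < x"
        then have "(y, x) \<in> inv_image (cardSuc natLeq - Id) Rep_cord"
          using refl[of y] Rep_cord_inject[of y x]
          by (auto simp: less_countable_ordinal_def less_eq_countable_ordinal_def)
        then show "P y"
          by (rule less)
      qed
    qed
  qed
  show "OFCLASS(countable_ordinal, wellorder_class)"
    by (intro_classes; (fact refl trans antisym total induct less_countable_ordinal_def)?)
qed

end

lemma uncountable_countable_ordinal: "uncountable (UNIV :: countable_ordinal set)"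
proof
  include cardinal_syntax
  assume "countable (UNIV :: countable_ordinal set)"
  then have "countable (Rep_cord ` UNIV)"
    by blast
  then have "countable (Field (cardSuc natLeq))"
    using type_definition.Rep_range[OF type_definition_countable_ordinal] by simp
  then have "|Field (cardSuc natLeq)| \<le>o natLeq"
    by (simp add: countable_card_le_natLeq)
  moreover have "|Field (cardSuc natLeq)| =o cardSuc natLeq"
    using card_of_Field_ordIso cardSuc_Card_order natLeq_Card_order by blast
  moreover have "natLeq <o cardSuc natLeq"
    by (simp add: cardSuc_greater natLeq_Card_order)
  ultimately show False
    by (meson not_ordLess_ordLeq ordIso_ordLeq_trans ordIso_symmetric)
qed

lemma countable_below_countable_ordinal: "countable {..< x :: countable_ordinal}"
proof -
  include cardinal_syntax
  have "|underS (cardSuc natLeq) (Rep_cord x)| <o cardSuc natLeq"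
    by (rule card_of_underS[OF cardSuc_Card_order[OF natLeq_Card_order] Rep_cord])
  then have "countable (underS (cardSuc natLeq) (Rep_cord x))"
    using cardSuc_ordLeq_ordLess[OF natLeq_Card_order card_of_Card_order] countable_card_le_natLeq
    by metis
  moreover have "Rep_cord y \<in> underS (cardSuc natLeq) (Rep_cord x)" if "y < x" for y
    using that Rep_cord_inject[of y x]
    by (auto simp: underS_def less_countable_ordinal_def less_eq_countable_ordinal_def)
  then have "Rep_cord ` {..<x} \<subseteq> underS (cardSuc natLeq) (Rep_cord x)"
    by blast
  ultimately have "countable (Rep_cord ` {..<x})"
    using countable_subset by blast
  then show ?thesis
    by (rule countable_image_inj_on) (simp add: inj_on_def Rep_cord_inject)
qed

definition ord_succ :: "countable_ordinal \<Rightarrow> countable_ordinal"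
  where "ord_succ x = (LEAST y. x < y)"

instantiation countable_ordinal :: "{zero, one}"
begin
definition "0 = (LEAST x :: countable_ordinal. True)"
definition "1 = ord_succ (0 :: countable_ordinal)"
instance ..
end

definition limit_ordinal :: "countable_ordinal \<Rightarrow> bool"
  where "limit_ordinal x \<longleftrightarrow> x \<noteq> 0 \<and> (\<nexists>y. x = ord_succ y)"

lemma countable_ordinal_zero_le [simp]: "(0 :: countable_ordinal) \<le> x"
  unfolding zero_countable_ordinal_def by (simp add: Least_le)

lemma countable_ordinal_ex_greater: "\<exists>y :: countable_ordinal. x < y"
proof (rule ccontr)
  assume "\<not> ?thesis"
  then have "(UNIV :: countable_ordinal set) \<subseteq> insert x {..<x}"
    by (auto simp: not_less le_less)
  then have "countable (UNIV :: countable_ordinal set)"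
    using countable_below_countable_ordinal[of x] by (meson countable_insert countable_subset)
  then show False
    using uncountable_countable_ordinal by blast
qed

lemma less_ord_succ [simp]: "x < ord_succ x"
  unfolding ord_succ_def using countable_ordinal_ex_greater by (rule LeastI_ex)

lemma ord_succ_le_iff: "ord_succ x \<le> y \<longleftrightarrow> x < y"
  using less_ord_succ[of x] by (auto simp: ord_succ_def intro: Least_le)

lemma less_ord_succ_iff: "x < ord_succ y \<longleftrightarrow> x \<le> y"
  using ord_succ_le_iff[of y x] by (auto simp: not_less[symmetric])

lemma ord_succ_eq_iff [simp]: "ord_succ x = ord_succ y \<longleftrightarrow> x = y"
  by (metis less_ord_succ less_ord_succ_iff order_antisym)

lemma ord_succ_neq_zero [simp]: "ord_succ x \<noteq> 0" "0 \<noteq> ord_succ x"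
  by (metis countable_ordinal_zero_le less_ord_succ not_less)+

lemma not_limit_ordinal_simps [simp]:
  "\<not> limit_ordinal 0" "\<not> limit_ordinal 1" "\<not> limit_ordinal (ord_succ x)"
  by (auto simp: limit_ordinal_def one_countable_ordinal_def)

lemma countable_ordinal_one_neq_zero [simp]:
  "(1 :: countable_ordinal) \<noteq> 0" "(0 :: countable_ordinal) \<noteq> 1"
  by (simp_all add: one_countable_ordinal_def)

lemma countable_ordinal_one_le_iff: "1 \<le> (x :: countable_ordinal) \<longleftrightarrow> x \<noteq> 0"
  using countable_ordinal_zero_le[of x]
  by (auto simp: one_countable_ordinal_def ord_succ_le_iff less_le simp del: countable_ordinal_zero_le)

datatype ordinal_upto_omega1 = Ctbl countable_ordinal | Omega1

instantiation ordinal_upto_omega1 :: "{linorder, order_top, one}"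
begin
definition "top = Omega1"
definition "1 = Ctbl 1"
fun less_eq_ordinal_upto_omega1 :: "ordinal_upto_omega1 \<Rightarrow> ordinal_upto_omega1 \<Rightarrow> bool" where
  "Ctbl x \<le> Ctbl y \<longleftrightarrow> x \<le> y"
| "x \<le> Omega1 \<longleftrightarrow> True"
| "Omega1 \<le> Ctbl y \<longleftrightarrow> False"
definition "(x :: ordinal_upto_omega1) < y \<longleftrightarrow> x \<le> y \<and> \<not> y \<le> x"
instance
proof
  fix x y z :: ordinal_upto_omega1
  show "x < y \<longleftrightarrow> x \<le> y \<and> \<not> y \<le> x"
    by (rule less_ordinal_upto_omega1_def)
  show "x \<le> x"
    by (cases x) auto
  show "x \<le> y \<Longrightarrow> y \<le> z \<Longrightarrow> x \<le> z"
    by (cases x; cases y; cases z) auto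
  show "x \<le> y \<Longrightarrow> y \<le> x \<Longrightarrow> x = y"
    by (cases x; cases y) auto
  show "x \<le> y \<or> y \<le> x"
    by (cases x; cases y) auto
  show "x \<le> top"
    by (cases x) (auto simp: top_ordinal_upto_omega1_def)
qed
end

section \<open>Schreier families\<close>

text \<open>
  The natural numbers of the paper are \<open>{1, 2, \<dots>}\<close>. A choice of the sequences
  \<open>(\<zeta>\<^sub>n)\<close> used at limit stages is a function \<open>z\<close>, where \<open>z \<xi> n\<close> is the \<open>n\<close>-th
  member of the sequence fixed for \<open>\<xi>\<close>; \<open>z \<xi> 0\<close> and the values at non-limit \<open>\<xi>\<close> are irrelevant.
\<close>

definition fundamental_sequences :: "(countable_ordinal \<Rightarrow> nat \<Rightarrow> countable_ordinal) \<Rightarrow> bool"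
  where "fundamental_sequences z \<longleftrightarrow>
    (\<forall>\<xi>. limit_ordinal \<xi> \<longrightarrow>
      strict_mono_on {1..} (z \<xi>) \<and>
      (\<forall>n\<ge>1. \<not> limit_ordinal (z \<xi> n)) \<and>
      (\<forall>n\<ge>1. z \<xi> n \<le> \<xi>) \<and> (\<forall>\<eta>. (\<forall>n\<ge>1. z \<xi> n \<le> \<eta>) \<longrightarrow> \<xi> \<le> \<eta>))"

lemma fundamental_sequences_exist: "\<exists>z. fundamental_sequences z"
proof -
  have "\<exists>s :: nat \<Rightarrow> countable_ordinal. strict_mono s \<and> (\<forall>n. \<not> limit_ordinal (s n)) \<and>
      (\<forall>n. s n \<le> \<xi>) \<and> (\<forall>\<eta>. (\<forall>n\<ge>1. s n \<le> \<eta>) \<longrightarrow> \<xi> \<le> \<eta>)"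
    if lim: "limit_ordinal \<xi>" for \<xi>
  proof -
    have succ: "ord_succ x < \<xi>" if "x < \<xi>" for x
      using lim that by (metis limit_ordinal_def le_less ord_succ_le_iff)
    have pos: "0 < \<xi>"
      using lim by (metis countable_ordinal_zero_le le_less limit_ordinal_def)
    then have ne: "{..<\<xi>} \<noteq> {}"
      by blast
    define e where "e = from_nat_into {..<\<xi>}"
    have range_e: "range e = {..<\<xi>}"
      unfolding e_def using ne countable_below_countable_ordinal by (rule range_from_nat_into)
    define s where "s = rec_nat (ord_succ 0) (\<lambda>n y. ord_succ (max y (e n)))"
    have s_simps: "s 0 = ord_succ 0" "s (Suc n) = ord_succ (max (s n) (e n))" for n
      by (simp_all add: s_def)
    have e_less: "e n < \<xi>" for n
      using range_e by blast
    have s_less: "s n < \<xi>" for n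
      by (induction n) (simp_all add: s_simps succ pos e_less)
    have "strict_mono s"
      unfolding strict_mono_Suc_iff s_simps by (simp add: less_ord_succ_iff)
    moreover have "\<not> limit_ordinal (s n)" for n
      by (cases n) (simp_all add: s_simps)
    moreover have "\<xi> \<le> \<eta>" if ub: "\<forall>n\<ge>1. s n \<le> \<eta>" for \<eta>
    proof (rule ccontr)
      assume "\<not> \<xi> \<le> \<eta>"
      then obtain n where n: "e n = \<eta>"
        using range_e by (metis UNIV_I imageE lessThan_iff not_less)
      have "\<eta> < s (Suc n)"
        by (simp add: s_simps n less_ord_succ_iff)
      with ub show False
        by (metis One_nat_def Suc_le_mono le0 not_less)
    qed
    ultimately show ?thesis
      using s_less less_imp_le by blast
  qed
  then have "\<forall>\<xi>. \<exists>s :: nat \<Rightarrow> countable_ordinal. limit_ordinal \<xi> \<longrightarrow>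
      strict_mono s \<and> (\<forall>n. \<not> limit_ordinal (s n)) \<and>
      (\<forall>n. s n \<le> \<xi>) \<and> (\<forall>\<eta>. (\<forall>n\<ge>1. s n \<le> \<eta>) \<longrightarrow> \<xi> \<le> \<eta>)"
    by blast
  from choice[OF this] obtain z :: "countable_ordinal \<Rightarrow> nat \<Rightarrow> countable_ordinal" where "\<forall>\<xi>. limit_ordinal \<xi> \<longrightarrow> strict_mono (z \<xi>) \<and>
      (\<forall>n. \<not> limit_ordinal (z \<xi> n)) \<and>
      (\<forall>n. z \<xi> n \<le> \<xi>) \<and> (\<forall>\<eta>. (\<forall>n\<ge>1. z \<xi> n \<le> \<eta>) \<longrightarrow> \<xi> \<le> \<eta>)" ..
  then have "fundamental_sequences z"
    unfolding fundamental_sequences_def by (simp add: strict_mono_def strict_mono_on_def)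
  then show ?thesis
    by blast
qed

definition schreier_one :: "nat set set"
  where "schreier_one = {F. finite F \<and> F \<noteq> {} \<and> 0 \<notin> F \<and> card F \<le> Min F} \<union> {{}}"

text \<open>The defining equations of the recursion are the lemmas \<open>schreier_zero\<close>, \<open>schreier_1\<close>,
  \<open>schreier_succ\<close> and \<open>schreier_limit\<close> below.\<close>

inductive in_schreier :: "(countable_ordinal \<Rightarrow> nat \<Rightarrow> countable_ordinal) \<Rightarrow>
    countable_ordinal \<Rightarrow> nat set \<Rightarrow> bool"
  for z where
  zero_empty: "in_schreier z 0 {}"
| zero_singleton: "1 \<le> n \<Longrightarrow> in_schreier z 0 {n}"
| one: "F \<in> schreier_one \<Longrightarrow> in_schreier z 1 F"
| succ_empty: "1 \<le> \<zeta> \<Longrightarrow> in_schreier z (ord_succ \<zeta>) {}"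
| succ_union: "\<lbrakk>1 \<le> \<zeta>; 1 \<le> n; \<forall>k\<in>{1..n}. F k \<noteq> {} \<and> in_schreier z \<zeta> (F k);
    \<forall>k\<in>{1..<n}. Max (F k) < Min (F (Suc k)); (\<lambda>k. Min (F k)) ` {1..n} \<in> schreier_one\<rbrakk>
    \<Longrightarrow> in_schreier z (ord_succ \<zeta>) (\<Union>k\<in>{1..n}. F k)"
| limit: "\<lbrakk>limit_ordinal \<xi>; 1 \<le> n; in_schreier z (z \<xi> n) F; \<forall>m\<in>F. n \<le> m\<rbrakk>
    \<Longrightarrow> in_schreier z \<xi> F"

definition schreier :: "(countable_ordinal \<Rightarrow> nat \<Rightarrow> countable_ordinal) \<Rightarrow>
    ordinal_upto_omega1 \<Rightarrow> nat set set"
  where "schreier z \<xi> = (case \<xi> of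
      Ctbl \<zeta> \<Rightarrow> {F. in_schreier z \<zeta> F}
    | Omega1 \<Rightarrow> {F. finite F \<and> 0 \<notin> F})"

lemma schreier_zero: "schreier z (Ctbl 0) = {{n} | n. 1 \<le> n} \<union> {{}}"
proof -
  have "in_schreier z 0 G \<longleftrightarrow> G = {} \<or> (\<exists>n\<ge>1. G = {n})" for G
  proof
    assume "in_schreier z 0 G"
    then show "G = {} \<or> (\<exists>n\<ge>1. G = {n})"
      by cases auto
  qed (auto intro: in_schreier.zero_empty in_schreier.zero_singleton)
  then show ?thesis
    by (auto simp: schreier_def)
qed

lemma schreier_1: "schreier z (Ctbl 1) = schreier_one"
proof -
  have "in_schreier z 1 G \<longleftrightarrow> G \<in> schreier_one" for G
  proof
    assume "in_schreier z 1 G"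
    then show "G \<in> schreier_one"
    proof cases
      case (succ_empty \<zeta>)
      then show ?thesis
        by (simp add: one_countable_ordinal_def ord_succ_le_iff)
    next
      case (succ_union \<zeta>)
      then show ?thesis
        by (simp add: one_countable_ordinal_def ord_succ_le_iff)
    qed simp_all
  qed (rule in_schreier.one)
  then show ?thesis
    by (auto simp: schreier_def)
qed

lemma schreier_succ:
  assumes "1 \<le> \<zeta>"
  shows "schreier z (Ctbl (ord_succ \<zeta>)) = {{}} \<union> {(\<Union>k\<in>{1..n}. F k) | n F.
    1 \<le> n \<and> (\<forall>k\<in>{1..n}. F k \<noteq> {} \<and> F k \<in> schreier z (Ctbl \<zeta>)) \<and>
    (\<forall>k\<in>{1..<n}. Max (F k) < Min (F (Suc k))) \<and> (\<lambda>k. Min (F k)) ` {1..n} \<in> schreier_one}"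
    (is "?L = ?R")
proof
  show "?R \<subseteq> ?L"
  proof
    fix G assume "G \<in> ?R"
    then consider "G = {}"
      | n F where "G = (\<Union>k\<in>{1..n}. F k)" "1 \<le> n"
          "\<forall>k\<in>{1..n}. F k \<noteq> {} \<and> in_schreier z \<zeta> (F k)"
          "\<forall>k\<in>{1..<n}. Max (F k) < Min (F (Suc k))"
          "(\<lambda>k. Min (F k)) ` {1..n} \<in> schreier_one"
      by (auto simp: schreier_def)
    then have "in_schreier z (ord_succ \<zeta>) G"
    proof cases
      case 1
      then show ?thesis
        using in_schreier.succ_empty[OF assms] by simp
    next
      case 2
      then show ?thesis
        using in_schreier.succ_union[OF assms 2(2-5)] by simp
    qed
    then show "G \<in> ?L"
      by (simp add: schreier_def)
  qed
  show "?L \<subseteq> ?R"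
  proof
    fix G assume "G \<in> ?L"
    then have "in_schreier z (ord_succ \<zeta>) G"
      by (simp add: schreier_def)
    then show "G \<in> ?R"
    proof cases
      case one
      then have "\<zeta> = 0"
        by (simp add: one_countable_ordinal_def)
      then show ?thesis
        using assms by (simp add: countable_ordinal_one_le_iff)
    next
      case (succ_union \<zeta>' n F)
      then have "1 \<le> n \<and> (\<forall>k\<in>{1..n}. F k \<noteq> {} \<and> F k \<in> schreier z (Ctbl \<zeta>)) \<and>
        (\<forall>k\<in>{1..<n}. Max (F k) < Min (F (Suc k))) \<and> (\<lambda>k. Min (F k)) ` {1..n} \<in> schreier_one"
        by (simp add: schreier_def)
      then show ?thesis
        using succ_union(2) by blast
    qed simp_all
  qed
qed

lemma schreier_limit:
  assumes "limit_ordinal \<xi>"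
  shows "schreier z (Ctbl \<xi>) =
    (\<Union>n\<in>{1..}. {F \<in> schreier z (Ctbl (z \<xi> n)). \<forall>m\<in>F. n \<le> m})"
proof -
  have "in_schreier z \<xi> G \<longleftrightarrow> (\<exists>n\<ge>1. in_schreier z (z \<xi> n) G \<and> (\<forall>m\<in>G. n \<le> m))" for G
  proof
    assume "in_schreier z \<xi> G"
    then show "\<exists>n\<ge>1. in_schreier z (z \<xi> n) G \<and> (\<forall>m\<in>G. n \<le> m)"
      by cases (use assms in auto)
  qed (use in_schreier.limit[OF assms] in blast)
  then show ?thesis
    by (auto simp: schreier_def)
qed

section \<open>Banach spaces with explicit carrier\<close>

text \<open>
  A normed space over \<open>'k\<close> is carried by a linear subspace of an ambient \<open>'k\<close>-vector space \<open>'v\<close>,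
  so that one can quantify over spaces inside a formula. The scalar field is any type of
  class \<open>{real_normed_field, banach}\<close>: by the Gelfand--Mazur theorem such a field is
  isometrically isomorphic to the real or to the complex numbers, and both are instances.
\<close>

record ('k, 'v) nspace =
  vscale :: "'k \<Rightarrow> 'v \<Rightarrow> 'v"
  vcarrier :: "'v set"
  vnorm :: "'v \<Rightarrow> real"

definition normed_space :: "('k :: {real_normed_field, banach}, 'v :: ab_group_add) nspace \<Rightarrow> bool"
  where "normed_space X \<longleftrightarrow>
    vector_space (vscale X) \<and> module.subspace (vscale X) (vcarrier X) \<and>
    (\<forall>x\<in>vcarrier X. 0 \<le> vnorm X x) \<and>
    (\<forall>x\<in>vcarrier X. vnorm X x = 0 \<longleftrightarrow> x = 0) \<and>
    (\<forall>c. \<forall>x\<in>vcarrier X. vnorm X (vscale X c x) = norm c * vnorm X x) \<and>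
    (\<forall>x\<in>vcarrier X. \<forall>y\<in>vcarrier X. vnorm X (x + y) \<le> vnorm X x + vnorm X y)"

text \<open>The value off the carrier is only there because the locale \<open>Metric_space\<close>
  requires symmetry and nonnegativity on the whole type.\<close>

definition vdist :: "('k, 'v :: ab_group_add) nspace \<Rightarrow> 'v \<Rightarrow> 'v \<Rightarrow> real"
  where "vdist X x y = (if x \<in> vcarrier X \<and> y \<in> vcarrier X then vnorm X (x - y) else 0)"

definition norm_topology :: "('k, 'v :: ab_group_add) nspace \<Rightarrow> 'v topology"
  where "norm_topology X = Metric_space.mtopology (vcarrier X) (vdist X)"

definition banach_space :: "('k :: {real_normed_field, banach}, 'v :: ab_group_add) nspace \<Rightarrow> bool"
  where "banach_space X \<longleftrightarrow>
    normed_space X \<and> Metric_space.mcomplete (vcarrier X) (vdist X)"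

definition scalar_space :: "('k :: {real_normed_field, banach}, 'k) nspace"
  where "scalar_space = \<lparr>vscale = (*), vcarrier = UNIV, vnorm = norm\<rparr>"

text \<open>Operators are functions on the ambient type; they are set to \<open>0\<close> off the carrier, so that
  equality of functions is equality of operators.\<close>

definition operators :: "('k, 'v :: ab_group_add) nspace \<Rightarrow> ('k, 'w :: ab_group_add) nspace \<Rightarrow>
    ('v \<Rightarrow> 'w) set"
  where "operators X Y = {T.
    (\<forall>x\<in>vcarrier X. T x \<in> vcarrier Y) \<and> (\<forall>x. x \<notin> vcarrier X \<longrightarrow> T x = 0) \<and>
    (\<forall>x\<in>vcarrier X. \<forall>y\<in>vcarrier X. T (x + y) = T x + T y) \<and>
    (\<forall>c. \<forall>x\<in>vcarrier X. T (vscale X c x) = vscale Y c (T x)) \<and>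
    (\<exists>K. \<forall>x\<in>vcarrier X. vnorm Y (T x) \<le> K * vnorm X x)}"

definition operator_norm :: "('k, 'v :: ab_group_add) nspace \<Rightarrow> ('k, 'w :: ab_group_add) nspace \<Rightarrow>
    ('v \<Rightarrow> 'w) \<Rightarrow> real"
  where "operator_norm X Y T = (SUP x \<in> {x \<in> vcarrier X. vnorm X x \<le> 1}. vnorm Y (T x))"

definition operator_space :: "('k, 'v :: ab_group_add) nspace \<Rightarrow> ('k, 'w :: ab_group_add) nspace \<Rightarrow>
    ('k, 'v \<Rightarrow> 'w) nspace"
  where "operator_space X Y = \<lparr>vscale = (\<lambda>c T x. vscale Y c (T x)), vcarrier = operators X Y,
    vnorm = operator_norm X Y\<rparr>"

definition dual_space :: "('k :: {real_normed_field, banach}, 'v :: ab_group_add) nspace \<Rightarrow>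
    ('k, 'v \<Rightarrow> 'k) nspace"
  where "dual_space X = operator_space X scalar_space"

definition canonical_embedding :: "('k :: {real_normed_field, banach}, 'v :: ab_group_add) nspace \<Rightarrow>
    'v \<Rightarrow> ('v \<Rightarrow> 'k) \<Rightarrow> 'k"
  where "canonical_embedding X x = (\<lambda>f. if f \<in> vcarrier (dual_space X) then f x else 0)"

definition reflexive_space :: "('k :: {real_normed_field, banach}, 'v :: ab_group_add) nspace \<Rightarrow> bool"
  where "reflexive_space X \<longleftrightarrow>
    canonical_embedding X ` vcarrier X = vcarrier (dual_space (dual_space X))"

lemma normed_spaceD:
  assumes "normed_space X"
  shows "vector_space (vscale X)"
    and "0 \<in> vcarrier X"
    and "\<And>x y. x \<in> vcarrier X \<Longrightarrow> y \<in> vcarrier X \<Longrightarrow> x + y \<in> vcarrier X"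
    and "\<And>x y. x \<in> vcarrier X \<Longrightarrow> y \<in> vcarrier X \<Longrightarrow> x - y \<in> vcarrier X"
    and "\<And>c x. x \<in> vcarrier X \<Longrightarrow> vscale X c x \<in> vcarrier X"
    and "\<And>x. x \<in> vcarrier X \<Longrightarrow> 0 \<le> vnorm X x"
    and "\<And>x. x \<in> vcarrier X \<Longrightarrow> vnorm X x = 0 \<longleftrightarrow> x = 0"
    and "\<And>c x. x \<in> vcarrier X \<Longrightarrow> vnorm X (vscale X c x) = norm c * vnorm X x"
    and "\<And>x y. x \<in> vcarrier X \<Longrightarrow> y \<in> vcarrier X \<Longrightarrow> vnorm X (x + y) \<le> vnorm X x + vnorm X y"
    and "vnorm X 0 = 0"
    and "\<And>x y. x \<in> vcarrier X \<Longrightarrow> y \<in> vcarrier X \<Longrightarrow> vnorm X (x - y) = vnorm X (y - x)"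
proof -
  show vs: "vector_space (vscale X)"
    using assms by (simp add: normed_space_def)
  interpret vector_space "vscale X"
    by (rule vs)
  have sub: "subspace (vcarrier X)"
    using assms by (simp add: normed_space_def)
  show "0 \<in> vcarrier X"
    and add: "\<And>x y. x \<in> vcarrier X \<Longrightarrow> y \<in> vcarrier X \<Longrightarrow> x + y \<in> vcarrier X"
    and diff: "\<And>x y. x \<in> vcarrier X \<Longrightarrow> y \<in> vcarrier X \<Longrightarrow> x - y \<in> vcarrier X"
    and "\<And>c x. x \<in> vcarrier X \<Longrightarrow> vscale X c x \<in> vcarrier X"
    using sub subspace_0 subspace_add subspace_diff subspace_scale by blast+
  show "\<And>x. x \<in> vcarrier X \<Longrightarrow> 0 \<le> vnorm X x"
    and "\<And>x. x \<in> vcarrier X \<Longrightarrow> vnorm X x = 0 \<longleftrightarrow> x = 0"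
    and hom: "\<And>c x. x \<in> vcarrier X \<Longrightarrow> vnorm X (vscale X c x) = norm c * vnorm X x"
    and "\<And>x y. x \<in> vcarrier X \<Longrightarrow> y \<in> vcarrier X \<Longrightarrow> vnorm X (x + y) \<le> vnorm X x + vnorm X y"
    using assms by (auto simp: normed_space_def)
  show "vnorm X 0 = 0"
    using \<open>0 \<in> vcarrier X\<close> assms by (auto simp: normed_space_def)
  show "vnorm X (x - y) = vnorm X (y - x)" if "x \<in> vcarrier X" "y \<in> vcarrier X" for x y
    using hom[of "x - y" "- 1"] diff that by (simp add: scale_minus_left)
qed

lemma Metric_space_vdist:
  assumes "normed_space X"
  shows "Metric_space (vcarrier X) (vdist X)"
proof
  note D = normed_spaceD[OF assms]
  fix x y z
  show "0 \<le> vdist X x y"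
    by (simp add: vdist_def D)
  show "vdist X x y = vdist X y x"
    by (simp add: vdist_def D(11))
  show "x \<in> vcarrier X \<Longrightarrow> y \<in> vcarrier X \<Longrightarrow> vdist X x y = 0 \<longleftrightarrow> x = y"
    by (simp add: vdist_def D)
  show "vdist X x z \<le> vdist X x y + vdist X y z"
    if "x \<in> vcarrier X" "y \<in> vcarrier X" "z \<in> vcarrier X"
    using that D(9)[of "x - y" "y - z"] by (simp add: vdist_def D(4))
qed

lemma normed_space_scalar: "normed_space scalar_space"
proof -
  have vs: "vector_space ((*) :: 'a \<Rightarrow> 'a \<Rightarrow> 'a)"
    by unfold_locales (auto simp: algebra_simps)
  then interpret vector_space "(*) :: 'a \<Rightarrow> 'a \<Rightarrow> 'a" .
  show ?thesis
    using vs by (simp add: normed_space_def scalar_space_def norm_mult norm_triangle_ineq)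
qed

lemma operator_norm_bound:
  assumes X: "normed_space X" and Y: "normed_space Y" and T: "T \<in> operators X Y"
  shows "bdd_above ((\<lambda>x. vnorm Y (T x)) ` {x \<in> vcarrier X. vnorm X x \<le> 1})"
    and "x \<in> vcarrier X \<Longrightarrow> vnorm Y (T x) \<le> operator_norm X Y T * vnorm X x"
proof -
  note DX = normed_spaceD[OF X]
  note DY = normed_spaceD[OF Y]
  obtain K where K: "\<And>x. x \<in> vcarrier X \<Longrightarrow> vnorm Y (T x) \<le> K * vnorm X x"
    using T unfolding operators_def by blast
  show bdd: "bdd_above ((\<lambda>x. vnorm Y (T x)) ` {x \<in> vcarrier X. vnorm X x \<le> 1})"
  proof (rule bdd_aboveI2)
    fix x assume x: "x \<in> {x \<in> vcarrier X. vnorm X x \<le> 1}"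
    have "vnorm Y (T x) \<le> K * vnorm X x"
      using K x by blast
    also have "\<dots> \<le> \<bar>K\<bar> * 1"
      using x DX(6)[of x] by (intro mult_mono) auto
    finally show "vnorm Y (T x) \<le> \<bar>K\<bar>"
      by simp
  qed
  show "vnorm Y (T x) \<le> operator_norm X Y T * vnorm X x" if x: "x \<in> vcarrier X"
  proof (cases "vnorm X x = 0")
    case True
    then show ?thesis
      using K[OF x] by simp
  next
    case False
    then have pos: "0 < vnorm X x"
      using DX(6)[OF x] by simp
    let ?c = "of_real (inverse (vnorm X x)) :: 'a"
    have nc: "norm ?c = inverse (vnorm X x)"
      using pos by (simp add: norm_of_real del: of_real_inverse)
    have u: "vscale X ?c x \<in> {x \<in> vcarrier X. vnorm X x \<le> 1}"
      using pos nc DX(5)[OF x, of ?c] DX(8)[OF x, of ?c] by simp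
    have "vnorm Y (T (vscale X ?c x)) \<le> operator_norm X Y T"
      unfolding operator_norm_def by (rule cSUP_upper[OF u bdd])
    moreover have "vnorm Y (T (vscale X ?c x)) = inverse (vnorm X x) * vnorm Y (T x)"
      using T x nc DY(8)[of "T x" ?c] by (auto simp: operators_def)
    ultimately have "inverse (vnorm X x) * vnorm Y (T x) \<le> operator_norm X Y T"
      by simp
    with pos show ?thesis
      by (simp add: field_simps)
  qed
qed

lemma normed_space_operator_space:
  assumes X: "normed_space X" and Y: "normed_space Y"
  shows "normed_space (operator_space X Y)"
proof -
  note DX = normed_spaceD[OF X]
  note DY = normed_spaceD[OF Y]
  interpret Yv: vector_space "vscale Y"
    by (rule DY(1))
  interpret V: vector_space "\<lambda>c T x. vscale Y c (T x)"
    by unfold_locales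
      (auto simp: fun_eq_iff Yv.scale_right_distrib Yv.scale_left_distrib)
  have ball0: "0 \<in> {x \<in> vcarrier X. vnorm X x \<le> 1}"
    using DX(2,10) by simp
  have in_Y: "T x \<in> vcarrier Y" if "T \<in> operators X Y" "x \<in> vcarrier X" for T x
    using that by (auto simp: operators_def)
  have bound: "\<exists>K\<ge>0. \<forall>x\<in>vcarrier X. vnorm Y (T x) \<le> K * vnorm X x" if T: "T \<in> operators X Y" for T
  proof -
    obtain K where K: "\<forall>x\<in>vcarrier X. vnorm Y (T x) \<le> K * vnorm X x"
      using T by (auto simp: operators_def)
    then have "\<forall>x\<in>vcarrier X. vnorm Y (T x) \<le> \<bar>K\<bar> * vnorm X x"
      by (meson DX(6) abs_ge_self mult_right_mono order_trans)
    then show ?thesis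
      by (metis abs_ge_zero)
  qed
  have sub: "V.subspace (operators X Y)"
    unfolding V.subspace_def
  proof (intro conjI allI ballI)
    show "0 \<in> operators X Y"
      using DY(2,10) by (auto simp: operators_def intro!: exI[of _ 0])
  next
    fix S T assume S: "S \<in> operators X Y" and T: "T \<in> operators X Y"
    obtain K where K: "\<forall>x\<in>vcarrier X. vnorm Y (S x) \<le> K * vnorm X x"
      using S by (auto simp: operators_def)
    obtain L where L: "\<forall>x\<in>vcarrier X. vnorm Y (T x) \<le> L * vnorm X x"
      using T by (auto simp: operators_def)
    have "vnorm Y (S x + T x) \<le> (K + L) * vnorm X x" if x: "x \<in> vcarrier X" for x
    proof -
      have "vnorm Y (S x + T x) \<le> vnorm Y (S x) + vnorm Y (T x)"
        using DY(9) in_Y S T x by blast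
      also have "\<dots> \<le> K * vnorm X x + L * vnorm X x"
        using K L x by (intro add_mono) auto
      finally show ?thesis
        by (simp add: distrib_right)
    qed
    then have "\<exists>K. \<forall>x\<in>vcarrier X. vnorm Y (S x + T x) \<le> K * vnorm X x"
      by blast
    then show "S + T \<in> operators X Y"
      using S T DY(3) by (auto simp: operators_def Yv.scale_right_distrib)
  next
    fix c T assume T: "T \<in> operators X Y"
    obtain K where K: "\<forall>x\<in>vcarrier X. vnorm Y (T x) \<le> K * vnorm X x"
      using T by (auto simp: operators_def)
    have "vnorm Y (vscale Y c (T x)) \<le> (norm c * K) * vnorm X x" if x: "x \<in> vcarrier X" for x
      using K x DY(8)[OF in_Y[OF T x], of c] by (simp add: mult.assoc mult_left_mono)
    then have "\<exists>K. \<forall>x\<in>vcarrier X. vnorm Y (vscale Y c (T x)) \<le> K * vnorm X x"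
      by blast
    then show "(\<lambda>x. vscale Y c (T x)) \<in> operators X Y"
      using T DY(5) by (auto simp: operators_def Yv.scale_right_distrib mult.commute)
  qed
  have nonneg: "0 \<le> operator_norm X Y T" if T: "T \<in> operators X Y" for T
  proof -
    have "0 \<le> vnorm Y (T 0)"
      using in_Y[OF T DX(2)] DY(6) by blast
    also have "\<dots> \<le> operator_norm X Y T"
      unfolding operator_norm_def by (rule cSUP_upper[OF ball0 operator_norm_bound(1)[OF X Y T]])
    finally show ?thesis .
  qed
  have zero: "operator_norm X Y T = 0 \<longleftrightarrow> T = 0" if T: "T \<in> operators X Y" for T
  proof
    assume 0: "operator_norm X Y T = 0"
    show "T = 0"
    proof
      fix x
      show "T x = 0 x"
      proof (cases "x \<in> vcarrier X")
        case True
        then have "vnorm Y (T x) \<le> 0"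
          using operator_norm_bound(2)[OF X Y T True] 0 by simp
        then show ?thesis
          using DY(6,7) in_Y[OF T True] by (metis order_antisym zero_fun_apply)
      qed (use T in \<open>auto simp: operators_def\<close>)
    qed
  next
    assume "T = 0"
    then have "(\<lambda>x. vnorm Y (T x)) ` {x \<in> vcarrier X. vnorm X x \<le> 1} = {0}"
      using ball0 DY(10) by auto
    then show "operator_norm X Y T = 0"
      by (simp add: operator_norm_def)
  qed
  have least: "operator_norm X Y T \<le> M"
    if "\<And>x. x \<in> vcarrier X \<Longrightarrow> vnorm X x \<le> 1 \<Longrightarrow> vnorm Y (T x) \<le> M" for T M
    unfolding operator_norm_def using ball0 that by (intro cSUP_least) auto
  have upper: "vnorm Y (T x) \<le> operator_norm X Y T"
    if "T \<in> operators X Y" "x \<in> vcarrier X" "vnorm X x \<le> 1" for T x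
    unfolding operator_norm_def using that
    by (intro cSUP_upper operator_norm_bound(1)[OF X Y]) auto
  have hom_le: "operator_norm X Y (\<lambda>x. vscale Y c (T x)) \<le> norm c * operator_norm X Y T"
    if T: "T \<in> operators X Y" for c T
    using DY(8) in_Y[OF T] upper[OF T] by (intro least) (auto intro: mult_left_mono)
  have hom: "operator_norm X Y (\<lambda>x. vscale Y c (T x)) = norm c * operator_norm X Y T"
    if T: "T \<in> operators X Y" for c T
  proof (cases "c = 0")
    case True
    have "(\<lambda>x. vscale Y c (T x)) = 0"
      using True by (auto simp: fun_eq_iff)
    then show ?thesis
      using True zero[OF V.subspace_0[OF sub]] V.subspace_0[OF sub] by (metis mult_zero_left norm_zero)
  next
    case False
    let ?S = "\<lambda>x. vscale Y c (T x)"
    have S: "?S \<in> operators X Y"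
      using V.subspace_scale[OF sub T] .
    have "operator_norm X Y (\<lambda>x. vscale Y (inverse c) (?S x)) \<le> norm (inverse c) * operator_norm X Y ?S"
      by (rule hom_le[OF S])
    then have "operator_norm X Y T \<le> inverse (norm c) * operator_norm X Y ?S"
      using False by (simp add: norm_inverse)
    then have "norm c * operator_norm X Y T \<le> operator_norm X Y ?S"
      using False by (simp add: field_simps)
    then show ?thesis
      using hom_le[OF T, of c] by simp
  qed
  have tri: "operator_norm X Y (S + T) \<le> operator_norm X Y S + operator_norm X Y T"
    if S: "S \<in> operators X Y" and T: "T \<in> operators X Y" for S T
  proof (rule least)
    fix x assume x: "x \<in> vcarrier X" "vnorm X x \<le> 1"
    have "vnorm Y (S x + T x) \<le> vnorm Y (S x) + vnorm Y (T x)"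
      using DY(9) in_Y S T x by blast
    then show "vnorm Y ((S + T) x) \<le> operator_norm X Y S + operator_norm X Y T"
      using upper[OF S x] upper[OF T x] by simp
  qed
  show ?thesis
    unfolding normed_space_def operator_space_def
    using V.vector_space_axioms sub nonneg zero hom tri by simp
qed

section \<open>The classes \<open>WD\<close>\<close>

definition supp :: "(nat \<Rightarrow> 'k :: zero) \<Rightarrow> nat set"
  where "supp \<alpha> = {k. \<alpha> k \<noteq> 0}"

text \<open>Scalar sequences are indexed by \<open>{1, 2, \<dots>}\<close>; as members of a Schreier family never
  contain \<open>0\<close>, the condition on the support forces \<open>\<alpha> 0 = 0\<close>.\<close>

definition schreier_coeffs :: "(countable_ordinal \<Rightarrow> nat \<Rightarrow> countable_ordinal) \<Rightarrow>
    ordinal_upto_omega1 \<Rightarrow> (nat \<Rightarrow> 'k :: zero) set"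
  where "schreier_coeffs z \<xi> = {\<alpha>. finite (supp \<alpha>) \<and> supp \<alpha> \<in> schreier z \<xi>}"

text \<open>Only meant for finitely supported \<open>\<alpha>\<close>.\<close>

definition lp_norm :: "ereal \<Rightarrow> (nat \<Rightarrow> 'k :: real_normed_vector) \<Rightarrow> real"
  where "lp_norm p \<alpha> = (if p = \<infinity> then (SUP k. norm (\<alpha> k))
    else (\<Sum>k\<in>supp \<alpha>. norm (\<alpha> k) powr real_of_ereal p) powr (1 / real_of_ereal p))"

definition weakly_null :: "('k :: {real_normed_field, banach}, 'v :: ab_group_add) nspace \<Rightarrow>
    (nat \<Rightarrow> 'v) \<Rightarrow> bool"
  where "weakly_null X x \<longleftrightarrow>
    (\<forall>n\<ge>1. x n \<in> vcarrier X) \<and> (\<forall>f\<in>vcarrier (dual_space X). (\<lambda>n. f (x n)) \<longlonglongrightarrow> 0)"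

definition normalized :: "('k, 'v) nspace \<Rightarrow> (nat \<Rightarrow> 'v) \<Rightarrow> bool"
  where "normalized X x \<longleftrightarrow> (\<forall>n\<ge>1. x n \<in> vcarrier X \<and> vnorm X (x n) = 1)"

text \<open>Sequences \<open>x\<close> are indexed by \<open>{1, 2, \<dots>}\<close> (the value \<open>x 0\<close> is ignored), and \<open>r\<close> is the
  strictly increasing map \<open>k \<mapsto> n\<^sub>k\<close> of \<open>{1, 2, \<dots>}\<close> into itself.\<close>

definition WD :: "(countable_ordinal \<Rightarrow> nat \<Rightarrow> countable_ordinal) \<Rightarrow> ereal \<Rightarrow> real \<Rightarrow>
    ordinal_upto_omega1 \<Rightarrow> ('k :: {real_normed_field, banach}, 'v :: ab_group_add) nspace \<Rightarrow>
    ('k, 'w :: ab_group_add) nspace \<Rightarrow> ('v \<Rightarrow> 'w) set"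
  where "WD z p C \<xi> X Y = {T \<in> operators X Y.
    \<forall>\<epsilon>>0. \<forall>x. normalized X x \<and> weakly_null X x \<longrightarrow>
      (\<exists>r. strict_mono_on {1..} r \<and> r ` {1..} \<subseteq> {1 :: nat..} \<and>
        (\<forall>\<alpha> \<in> schreier_coeffs z \<xi>.
          vnorm Y (\<Sum>k\<in>supp \<alpha>. vscale Y (\<alpha> k) (T (x (r k)))) \<le> (C + \<epsilon>) * lp_norm p \<alpha>))}"

definition WD_infinity :: "(countable_ordinal \<Rightarrow> nat \<Rightarrow> countable_ordinal) \<Rightarrow> ereal \<Rightarrow>
    ordinal_upto_omega1 \<Rightarrow> ('k :: {real_normed_field, banach}, 'v :: ab_group_add) nspace \<Rightarrow>
    ('k, 'w :: ab_group_add) nspace \<Rightarrow> ('v \<Rightarrow> 'w) set"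
  where "WD_infinity z p \<xi> X Y = (\<Union>C\<in>{0..}. WD z p C \<xi> X Y)"

end

theory Submission
  imports Defs
begin

text \<open>
  The space is an \<open>\<ell>\<^sub>p\<close> sum (a \<open>c\<^sub>0\<close> sum for \<open>p = \<infinity>\<close>) of renormings \<open>X\<^sub>1, X\<^sub>2, \<dots>\<close> of
  \<open>\<ell>\<^sub>p\<close> (of \<open>c\<^sub>0\<close>), realised on scalar sequences with the help of a coloring of the indices. In
  \<open>X\<^sub>n\<close>, whose unit vectors are those of color \<open>n\<close>, any \<open>n\<close> unit vectors span \<open>\<ell>\<^sub>1\<close>: an
  admissible set consists of at most \<open>n\<close> indices of color \<open>n\<close>, and the norm of \<open>x\<close> is the supremum,
  over all packings of disjoint admissible sets, of the \<open>\<ell>\<^sub>p\<close> norm of the sums of \<open>\<bar>x i\<bar>\<close> over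
  these sets.

  The identity of \<open>X\<^sub>n\<close> has upper \<open>\<ell>\<^sub>p\<close> estimates on weakly null sequences, but the best constant is
  at least \<open>n powr (1 - 1/p)\<close>, the ratio of the \<open>\<ell>\<^sub>1\<close> and the \<open>\<ell>\<^sub>p\<close> norm of \<open>n\<close> unit vectors. Let
  \<open>T\<close> be the diagonal operator that multiplies \<open>X\<^sub>n\<close> by \<open>n powr - ((1 - 1/p) / 2)\<close>. These factors tend
  to \<open>0\<close>, so \<open>T\<close> is the norm limit of its truncations to finitely many colors. A truncation acts on
  a space isomorphic to \<open>\<ell>\<^sub>p\<close> or \<open>c\<^sub>0\<close>, and a gliding hump shows that it belongs to the class
  (\<open>truncated_diag_WD\<close>). For \<open>T\<close> itself, however, the constants grow at least like
  \<open>n powr ((1 - 1/p) / 2)\<close>, so that it is not in the class (\<open>diag_weight_not_WD\<close>). The ordinal does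
  not enter: the upper estimates hold for all finite sets of indices, and the lower ones are
  attained on the intervals \<open>{n..<2 * n}\<close>, which belong to every Schreier family of order at
  least \<open>1\<close> once \<open>n \<ge> 2\<close> (\<open>schreier_interval\<close>).

  For \<open>p < \<infinity>\<close>, reflexivity is James' criterion made explicit. The unit vectors are a boundedly
  complete basis (\<open>bounded_imp_finitary\<close>), since the \<open>p\<close>-th power of the norm is
  superadditive on consecutive vectors; and they are a shrinking one (\<open>functional_small_on_tails\<close>), since
  disjoint vectors satisfy an upper \<open>p\<close>-estimate both between different colors and within
  finitely many colors. Hence a functional \<open>\<phi>\<close> on the dual is the evaluation at the sequence of its
  values on the coordinate functionals: by a norming functional this sequence is bounded
  (\<open>packing_norm_bidual_le\<close>), so it lies in the space, and \<open>\<phi>\<close> is determined by these values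
  (\<open>bidual_eq_evaluation\<close>).
\<close>

section \<open>The \<open>\<ell>\<^sub>p\<close> norm of finitely supported sequences\<close>

lemma supp_subset_of_norm_le:
  assumes "finite (supp \<beta>)" "\<And>k. norm (\<alpha> k) \<le> norm (\<beta> k)"
  shows "supp \<alpha> \<subseteq> supp \<beta>"
  using assms(2) unfolding supp_def by (auto, metis norm_le_zero_iff norm_zero)

lemma convex_on_powr_nonneg:
  assumes "1 \<le> (r :: real)"
  shows "convex_on {0..} (\<lambda>t. t powr r)"
proof (rule convex_onI)
  have small: "s powr r \<le> s" if "0 < s" "s < 1" for s :: real
    using powr_mono'[of 1 r s] that assms by simp
  fix t x y :: real
  assume t: "0 < t" "t < 1" and "x \<in> {0..}" "y \<in> {0..}"
  then consider "x = 0" "0 \<le> y" | "y = 0" "0 \<le> x" | "0 < x" "0 < y"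
    by force
  then show "((1 - t) *\<^sub>R x + t *\<^sub>R y) powr r \<le> (1 - t) * x powr r + t * y powr r"
  proof cases
    case 1
    then show ?thesis
      using mult_right_mono[OF small[OF t], of "y powr r"] t by (simp add: powr_mult)
  next
    case 2
    then show ?thesis
      using mult_right_mono[OF small[of "1 - t"], of "x powr r"] t by (simp add: powr_mult)
  next
    case 3
    then show ?thesis
      using convex_onD[OF powr_convex[OF assms], of t x y] t by simp
  qed
qed simp

locale exponent =
  fixes p :: ereal
  assumes p_gt_1: "1 < p"
begin

abbreviation q :: real where "q \<equiv> real_of_ereal p"

lemma q_gt_1: "p \<noteq> \<infinity> \<Longrightarrow> 1 < q"
  using p_gt_1 by (cases p) auto

text \<open>With \<open>1/\<infinity> = 0\<close> this is \<open>1 - 1/p\<close>: the \<open>\<ell>\<^sub>p\<close> norm of a sum of \<open>n\<close> unit vectors falls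
  short of their \<open>\<ell>\<^sub>1\<close> norm \<open>n\<close> by the factor \<open>n powr rate\<close>. The whole argument lives off this gap.\<close>

definition rate :: real
  where "rate = (if p = \<infinity> then 1 else 1 - 1 / q)"

lemma rate_pos: "0 < rate"
  using q_gt_1 by (auto simp: rate_def)

lemma lp_norm_finite:
  assumes "p \<noteq> \<infinity>" "finite A" "supp \<alpha> \<subseteq> A"
  shows "lp_norm p \<alpha> = (\<Sum>k\<in>A. norm (\<alpha> k) powr q) powr (1 / q)"
proof -
  have "(\<Sum>k\<in>supp \<alpha>. norm (\<alpha> k) powr q) = (\<Sum>k\<in>A. norm (\<alpha> k) powr q)"
    by (rule sum.mono_neutral_left) (use assms in \<open>auto simp: supp_def\<close>)
  then show ?thesis
    using assms by (simp add: lp_norm_def)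
qed

lemma lp_norm_powr:
  assumes "p \<noteq> \<infinity>" "finite A" "supp \<alpha> \<subseteq> A"
  shows "lp_norm p \<alpha> powr q = (\<Sum>k\<in>A. norm (\<alpha> k) powr q)"
  using q_gt_1[OF assms(1)] sum_nonneg[of A "\<lambda>k. norm (\<alpha> k) powr q"]
  by (simp add: lp_norm_finite[OF assms] powr_powr)

lemma lp_norm_le_powrI:
  assumes "p \<noteq> \<infinity>" "finite A" "supp \<alpha> \<subseteq> A" "0 \<le> B"
    and "(\<Sum>k\<in>A. norm (\<alpha> k) powr q) \<le> B powr q"
  shows "lp_norm p \<alpha> \<le> B"
proof -
  have "lp_norm p \<alpha> \<le> (B powr q) powr (1 / q)"
    unfolding lp_norm_finite[OF assms(1-3)]
    using assms q_gt_1 by (intro powr_mono2 sum_nonneg) auto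
  then show ?thesis
    using assms q_gt_1[OF assms(1)] by (simp add: powr_powr)
qed

lemma bdd_above_norm_finite_supp:
  assumes "finite (supp \<alpha>)"
  shows "bdd_above (range (\<lambda>k. norm (\<alpha> k)))"
proof (rule bdd_aboveI2)
  fix k
  show "norm (\<alpha> k) \<le> (\<Sum>k\<in>supp \<alpha>. norm (\<alpha> k))"
    using assms by (cases "k \<in> supp \<alpha>") (auto simp: supp_def intro: member_le_sum sum_nonneg)
qed

lemma lp_norm_nonneg [simp]:
  assumes "finite (supp \<alpha>)"
  shows "0 \<le> lp_norm p \<alpha>"
  using cSUP_upper2[OF bdd_above_norm_finite_supp[OF assms] UNIV_I, of 0 0] by (auto simp: lp_norm_def)

lemma lp_norm_coord:
  assumes "finite (supp \<alpha>)"
  shows "norm (\<alpha> k) \<le> lp_norm p \<alpha>"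
proof (cases "p = \<infinity>")
  case True
  then show ?thesis
    using cSUP_upper[OF _ bdd_above_norm_finite_supp[OF assms]] by (simp add: lp_norm_def)
next
  case False
  note q = q_gt_1[OF False]
  have "norm (\<alpha> k) powr q \<le> (\<Sum>k\<in>insert k (supp \<alpha>). norm (\<alpha> k) powr q)"
    using assms by (intro member_le_sum) auto
  then have "norm (\<alpha> k) powr q \<le> lp_norm p \<alpha> powr q"
    using lp_norm_powr[OF False, of "insert k (supp \<alpha>)" \<alpha>] assms by (simp add: subset_insertI)
  then show ?thesis
    using q assms by (meson powr_less_mono2 lp_norm_nonneg norm_ge_zero not_le le_less_trans zero_less_one less_trans)
qed

lemma lp_norm_infinityI:
  assumes "p = \<infinity>" "\<And>k. norm (\<alpha> k) \<le> B"
  shows "lp_norm p \<alpha> \<le> B"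
  using assms by (auto simp: lp_norm_def intro!: cSUP_least)

text \<open>Besides monotonicity, this serves to replace a sum over a block by a multiple of its largest
  entry, \<open>g j\<close> being the position of that entry in block \<open>j\<close>.\<close>

lemma lp_norm_inject:
  assumes "finite J" "inj_on g J" "supp \<alpha> \<subseteq> J" "finite (supp \<beta>)"
    and le: "\<And>j. j \<in> J \<Longrightarrow> norm (\<alpha> j) \<le> norm (\<beta> (g j))"
  shows "lp_norm p \<alpha> \<le> lp_norm p \<beta>"
proof (cases "p = \<infinity>")
  case True
  have "norm (\<alpha> k) \<le> lp_norm p \<beta>" for k
  proof (cases "k \<in> J")
    case True
    then show ?thesis
      using le lp_norm_coord[OF assms(4)] order_trans by blast
  next
    case False
    then have "\<alpha> k = 0"
      using assms(3) by (auto simp: supp_def)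
    then show ?thesis
      using lp_norm_nonneg[OF assms(4)] by simp
  qed
  then show ?thesis
    by (rule lp_norm_infinityI[OF True])
next
  case False
  have "(\<Sum>k\<in>J. norm (\<alpha> k) powr q) \<le> (\<Sum>k\<in>J. norm (\<beta> (g k)) powr q)"
    using le q_gt_1[OF False] by (intro sum_mono powr_mono2) auto
  also have "\<dots> = (\<Sum>k\<in>g ` J. norm (\<beta> k) powr q)"
    using assms(2) by (simp add: sum.reindex)
  also have "\<dots> \<le> (\<Sum>k\<in>g ` J \<union> supp \<beta>. norm (\<beta> k) powr q)"
    using assms(1,4) by (intro sum_mono2) auto
  also have "\<dots> = lp_norm p \<beta> powr q"
    using assms by (subst lp_norm_powr[OF False]) auto
  finally show ?thesis
    using lp_norm_le_powrI[OF False assms(1,3)] lp_norm_nonneg[OF assms(4)] by blast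
qed

lemma lp_norm_mono:
  assumes "finite (supp \<beta>)" "\<And>k. norm (\<alpha> k) \<le> norm (\<beta> k)"
  shows "lp_norm p \<alpha> \<le> lp_norm p \<beta>"
  using lp_norm_inject[OF assms(1) inj_on_id supp_subset_of_norm_le[OF assms] assms(1)] assms(2) by simp

lemma lp_norm_scale:
  fixes \<alpha> :: "nat \<Rightarrow> real"
  assumes fin: "finite (supp \<alpha>)"
  shows "lp_norm p (\<lambda>k. c * \<alpha> k) = \<bar>c\<bar> * lp_norm p \<alpha>"
proof (cases "c = 0 \<or> p = \<infinity>")
  case False
  then have p: "p \<noteq> \<infinity>" and c: "c \<noteq> 0" by auto
  have "supp (\<lambda>k. c * \<alpha> k) \<subseteq> supp \<alpha>"
    by (auto simp: supp_def)
  then have "lp_norm p (\<lambda>k. c * \<alpha> k) = (\<Sum>k\<in>supp \<alpha>. norm (c * \<alpha> k) powr q) powr (1 / q)"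
    by (rule lp_norm_finite[OF p fin])
  also have "\<dots> = (\<bar>c\<bar> powr q * (\<Sum>k\<in>supp \<alpha>. norm (\<alpha> k) powr q)) powr (1 / q)"
    by (simp add: sum_distrib_left abs_mult powr_mult)
  also have "\<dots> = \<bar>c\<bar> * lp_norm p \<alpha>"
    using q_gt_1[OF p] c
    by (simp add: lp_norm_finite[OF p fin order_refl] powr_mult sum_nonneg powr_powr)
  finally show ?thesis .
next
  case True
  have zero: "lp_norm p (\<lambda>k. 0::real) = 0"
    by (simp add: lp_norm_def supp_def)
  have "lp_norm p (\<lambda>k. c * \<alpha> k) = \<bar>c\<bar> * lp_norm p \<alpha>" if p: "p = \<infinity>" and c: "c \<noteq> 0"
  proof -
    have le: "lp_norm p (\<lambda>k. c * \<alpha> k) \<le> \<bar>c\<bar> * lp_norm p \<alpha>" if "finite (supp \<alpha>)" for c and \<alpha> :: "nat \<Rightarrow> real"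
      using lp_norm_coord[OF that] by (intro lp_norm_infinityI[OF p]) (auto simp: abs_mult intro: mult_left_mono)
    have "supp (\<lambda>k. c * \<alpha> k) = supp \<alpha>"
      using c by (auto simp: supp_def)
    then have "lp_norm p (\<lambda>k. inverse c * (c * \<alpha> k)) \<le> \<bar>inverse c\<bar> * lp_norm p (\<lambda>k. c * \<alpha> k)"
      using fin by (intro le) simp
    then have "lp_norm p \<alpha> \<le> inverse \<bar>c\<bar> * lp_norm p (\<lambda>k. c * \<alpha> k)"
      using c by (simp add: mult.assoc[symmetric])
    then have "\<bar>c\<bar> * lp_norm p \<alpha> \<le> lp_norm p (\<lambda>k. c * \<alpha> k)"
      using c by (simp add: field_simps)
    then show ?thesis
      using le[OF fin, of c] by simp
  qed
  then show ?thesis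
    using True zero by (cases "c = 0") auto
qed

text \<open>The inequality of Minkowski: after normalising, it is the convexity of \<open>t \<mapsto> t\<^sup>p\<close>.\<close>

lemma lp_norm_triangle:
  fixes \<alpha> \<beta> :: "nat \<Rightarrow> real"
  assumes fin: "finite (supp \<alpha>)" "finite (supp \<beta>)"
  shows "lp_norm p (\<lambda>k. \<alpha> k + \<beta> k) \<le> lp_norm p \<alpha> + lp_norm p \<beta>"
proof (cases "p = \<infinity>")
  case True
  show ?thesis
    using lp_norm_coord[OF fin(1)] lp_norm_coord[OF fin(2)]
    by (intro lp_norm_infinityI[OF True]) (meson add_mono norm_triangle_ineq order_trans)
next
  case False
  note q = q_gt_1[OF False]
  let ?A = "lp_norm p \<alpha>" and ?B = "lp_norm p \<beta>"
  have nonneg: "0 \<le> ?A" "0 \<le> ?B"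
    using fin by auto
  show ?thesis
  proof (cases "?A = 0 \<or> ?B = 0")
    case True
    then have "(\<forall>k. \<alpha> k = 0) \<or> (\<forall>k. \<beta> k = 0)"
      using lp_norm_coord[OF fin(1)] lp_norm_coord[OF fin(2)] by force
    then show ?thesis
      using nonneg by auto
  next
    case F: False
    then have pos: "0 < ?A" "0 < ?B"
      using nonneg by auto
    let ?S = "supp \<alpha> \<union> supp \<beta>" and ?C = "?A + ?B"
    have S: "finite ?S"
      using fin by simp
    have unit: "(\<Sum>k\<in>?S. (\<bar>\<alpha> k\<bar> / ?A) powr q) = 1" "(\<Sum>k\<in>?S. (\<bar>\<beta> k\<bar> / ?B) powr q) = 1"
      using lp_norm_powr[OF False S, of \<alpha>] lp_norm_powr[OF False S, of \<beta>] pos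
      by (auto simp: powr_divide sum_divide_distrib[symmetric])
    have conv: "convex_on {0..} (\<lambda>t::real. t powr q)"
      using q by (intro convex_on_powr_nonneg) simp
    have "(\<Sum>k\<in>?S. norm (\<alpha> k + \<beta> k) powr q) \<le> (\<Sum>k\<in>?S. ?C powr q *
        (?A / ?C * (\<bar>\<alpha> k\<bar> / ?A) powr q + ?B / ?C * (\<bar>\<beta> k\<bar> / ?B) powr q))"
    proof (rule sum_mono)
      fix k
      have eq: "?A / ?C * (\<bar>\<alpha> k\<bar> / ?A) + ?B / ?C * (\<bar>\<beta> k\<bar> / ?B) = (\<bar>\<alpha> k\<bar> + \<bar>\<beta> k\<bar>) / ?C"
        using pos by (simp add: add_divide_distrib)
      have weight: "1 - ?B / ?C = ?A / ?C"
        using pos by (simp add: field_simps)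
      have "((\<bar>\<alpha> k\<bar> + \<bar>\<beta> k\<bar>) / ?C) powr q \<le>
          ?A / ?C * (\<bar>\<alpha> k\<bar> / ?A) powr q + ?B / ?C * (\<bar>\<beta> k\<bar> / ?B) powr q"
        using convex_onD[OF conv, of "?B / ?C" "\<bar>\<alpha> k\<bar> / ?A" "\<bar>\<beta> k\<bar> / ?B"] pos
        unfolding eq[symmetric] weight by simp
      then have "?C powr q * ((\<bar>\<alpha> k\<bar> + \<bar>\<beta> k\<bar>) / ?C) powr q \<le> ?C powr q *
          (?A / ?C * (\<bar>\<alpha> k\<bar> / ?A) powr q + ?B / ?C * (\<bar>\<beta> k\<bar> / ?B) powr q)"
        by (intro mult_left_mono) auto
      moreover have "?C powr q * ((\<bar>\<alpha> k\<bar> + \<bar>\<beta> k\<bar>) / ?C) powr q = (\<bar>\<alpha> k\<bar> + \<bar>\<beta> k\<bar>) powr q"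
        using pos by (simp add: powr_divide)
      moreover have "norm (\<alpha> k + \<beta> k) powr q \<le> (\<bar>\<alpha> k\<bar> + \<bar>\<beta> k\<bar>) powr q"
        using q by (intro powr_mono2) auto
      ultimately show "norm (\<alpha> k + \<beta> k) powr q \<le> ?C powr q *
          (?A / ?C * (\<bar>\<alpha> k\<bar> / ?A) powr q + ?B / ?C * (\<bar>\<beta> k\<bar> / ?B) powr q)"
        by linarith
    qed
    also have "\<dots> = ?C powr q * (?A / ?C * (\<Sum>k\<in>?S. (\<bar>\<alpha> k\<bar> / ?A) powr q)
        + ?B / ?C * (\<Sum>k\<in>?S. (\<bar>\<beta> k\<bar> / ?B) powr q))"
      by (simp only: sum_distrib_left[symmetric] sum.distrib)
    also have "\<dots> = ?C powr q"
      unfolding unit using pos by (simp add: add_divide_distrib[symmetric])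
    finally show ?thesis
      using nonneg by (intro lp_norm_le_powrI[OF False S]) (auto simp: supp_def)
  qed
qed

text \<open>The upper \<open>p\<close>-estimate of \<open>\<ell>\<^sub>p\<close>. Both upper estimates in the space constructed below are
  reduced to it.\<close>

lemma lp_norm_disjoint:
  fixes v :: "nat \<Rightarrow> nat \<Rightarrow> real" and \<alpha> :: "nat \<Rightarrow> real"
  assumes S: "finite (supp \<alpha>)"
    and fin: "\<And>k. k \<in> supp \<alpha> \<Longrightarrow> finite (supp (v k))"
    and unit: "\<And>k. k \<in> supp \<alpha> \<Longrightarrow> lp_norm p (v k) \<le> 1"
    and disj: "\<And>j k l. k \<in> supp \<alpha> \<Longrightarrow> l \<in> supp \<alpha> \<Longrightarrow> v k j \<noteq> 0 \<Longrightarrow> v l j \<noteq> 0 \<Longrightarrow> k = l"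
  shows "lp_norm p (\<lambda>j. \<Sum>k\<in>supp \<alpha>. \<alpha> k * v k j) \<le> lp_norm p \<alpha>"
proof -
  let ?w = "\<lambda>j. \<Sum>k\<in>supp \<alpha>. \<alpha> k * v k j"
  let ?J = "\<Union>k\<in>supp \<alpha>. supp (v k)"
  have J: "finite ?J"
    using S fin by blast
  have supp: "supp ?w \<subseteq> ?J"
  proof
    fix j assume "j \<in> supp ?w"
    then obtain k where "k \<in> supp \<alpha>" "\<alpha> k * v k j \<noteq> 0"
      unfolding supp_def[of ?w] by (metis (mono_tags, lifting) mem_Collect_eq sum.neutral)
    then show "j \<in> ?J"
      by (auto simp: supp_def)
  qed
  have single: "?w j = \<alpha> k * v k j" if "k \<in> supp \<alpha>" "v k j \<noteq> 0" for k j
  proof -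
    have "?w j = (\<Sum>l\<in>supp \<alpha>. if l = k then \<alpha> k * v k j else 0)"
      using disj that by (intro sum.cong) auto
    then show ?thesis
      using S that by simp
  qed
  show ?thesis
  proof (cases "p = \<infinity>")
    case True
    show ?thesis
    proof (rule lp_norm_infinityI[OF True])
      fix j
      show "norm (?w j) \<le> lp_norm p \<alpha>"
      proof (cases "j \<in> ?J")
        case True
        then obtain k where k: "k \<in> supp \<alpha>" "v k j \<noteq> 0"
          by (auto simp: supp_def)
        have "norm (v k j) \<le> 1"
          using unit[OF k(1)] lp_norm_coord[OF fin[OF k(1)]] order_trans by blast
        then have "norm (?w j) \<le> norm (\<alpha> k) * 1"
          unfolding single[OF k] real_norm_def abs_mult by (intro mult_left_mono) auto
        then show ?thesis
          using lp_norm_coord[OF S, of k] by simp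
      next
        case False
        then have "?w j = 0"
          using supp by (auto simp: supp_def)
        then show ?thesis
          using S by simp
      qed
    qed
  next
    case False
    have pw: "norm (?w j) powr q = (\<Sum>k\<in>supp \<alpha>. norm (\<alpha> k) powr q * norm (v k j) powr q)" for j
    proof (cases "\<exists>k\<in>supp \<alpha>. v k j \<noteq> 0")
      case True
      then obtain k where k: "k \<in> supp \<alpha>" "v k j \<noteq> 0"
        by blast
      have "(\<Sum>l\<in>supp \<alpha>. norm (\<alpha> l) powr q * norm (v l j) powr q)
          = (\<Sum>l\<in>supp \<alpha>. if l = k then norm (\<alpha> k) powr q * norm (v k j) powr q else 0)"
        using disj k by (intro sum.cong) auto
      then show ?thesis
        unfolding single[OF k] using S k by (simp add: abs_mult powr_mult)
    qed simp
    have "(\<Sum>j\<in>?J. norm (?w j) powr q) =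
        (\<Sum>k\<in>supp \<alpha>. norm (\<alpha> k) powr q * (\<Sum>j\<in>?J. norm (v k j) powr q))"
      unfolding pw sum_distrib_left by (rule sum.swap)
    also have "\<dots> \<le> (\<Sum>k\<in>supp \<alpha>. norm (\<alpha> k) powr q * 1)"
    proof (intro sum_mono mult_left_mono)
      fix k assume k: "k \<in> supp \<alpha>"
      have "lp_norm p (v k) powr q \<le> 1 powr q"
        using unit[OF k] fin[OF k] q_gt_1[OF False] by (intro powr_mono2) auto
      then show "(\<Sum>j\<in>?J. norm (v k j) powr q) \<le> 1"
        using lp_norm_powr[OF False J, of "v k"] k UN_upper[OF k, of "\<lambda>k. supp (v k)"] by simp
    qed auto
    also have "\<dots> = lp_norm p \<alpha> powr q"
      using lp_norm_powr[OF False S order_refl] by simp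
    finally show ?thesis
      using S by (intro lp_norm_le_powrI[OF False J supp]) auto
  qed
qed

lemma lp_norm_ones:
  assumes "finite S"
  shows "lp_norm p (\<lambda>k. if k \<in> S then 1 else 0 :: real) \<le> real (card S) powr (1 - rate)"
    (is "lp_norm p ?\<alpha> \<le> _")
proof (cases "p = \<infinity>")
  case True
  show ?thesis
  proof (cases "S = {}")
    case False
    have "rate = 1"
      unfolding rate_def using \<open>p = \<infinity>\<close> by simp
    then have "real (card S) powr (1 - rate) = 1"
      using False assms by simp
    then show ?thesis
      by (intro lp_norm_infinityI[OF \<open>p = \<infinity>\<close>]) simp
  qed (simp add: lp_norm_def)
next
  case False
  have "lp_norm p ?\<alpha> = (\<Sum>k\<in>S. norm (?\<alpha> k) powr q) powr (1 / q)"
    using assms by (intro lp_norm_finite[OF False]) (auto simp: supp_def)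
  then show ?thesis
    using False by (simp add: rate_def)
qed

lemma lp_norm_norm: "lp_norm p (\<lambda>k. norm (\<alpha> k)) = lp_norm p \<alpha>"
  by (simp add: lp_norm_def supp_def)

end

section \<open>The space\<close>

text \<open>The color splits the indices into infinitely many infinite classes; class \<open>n\<close> carries the
  \<open>n\<close>-th renorming of \<open>\<ell>\<^sub>p\<close>. Colors start at \<open>1\<close>, so that singletons are admissible.\<close>

definition color :: "nat \<Rightarrow> nat"
  where "color i = Suc (fst (prod_decode i))"

definition admissible :: "nat set \<Rightarrow> bool"
  where "admissible A \<longleftrightarrow> finite A \<and> (\<exists>n. card A \<le> n \<and> (\<forall>i\<in>A. color i = n))"

text \<open>Sequences of blocks, all but finitely many of them empty, are used instead of finite
  families: they make the block sums a scalar sequence to which the \<open>\<ell>\<^sub>p\<close> norm applies as it stands, for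
  \<open>p = \<infinity>\<close> as well as for finite \<open>p\<close>.\<close>

definition packing :: "(nat \<Rightarrow> nat set) \<Rightarrow> bool"
  where "packing F \<longleftrightarrow> (\<forall>j. admissible (F j)) \<and> disjoint_family F \<and> finite {j. F j \<noteq> {}}"

definition block_sums :: "(nat \<Rightarrow> nat set) \<Rightarrow> (nat \<Rightarrow> 'k :: real_normed_field) \<Rightarrow> nat \<Rightarrow> real"
  where "block_sums F x j = (\<Sum>i\<in>F j. norm (x i))"

definition restr :: "nat set \<Rightarrow> (nat \<Rightarrow> 'k :: zero) \<Rightarrow> nat \<Rightarrow> 'k"
  where "restr A x = (\<lambda>i. if i \<in> A then x i else 0)"

lemma supp_restr [simp]: "supp (restr A x) = A \<inter> supp x"
  by (auto simp: restr_def supp_def)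

lemma restr_restr [simp]: "restr A (restr B x) = restr (A \<inter> B) x"
  by (auto simp: restr_def)

lemma restr_add: "restr A (x + y) = restr A x + restr A (y :: nat \<Rightarrow> 'k :: real_normed_field)"
  by (auto simp: restr_def fun_eq_iff)

lemma restr_id: "supp x \<subseteq> A \<Longrightarrow> restr A x = x"
  by (auto simp: restr_def supp_def fun_eq_iff)

lemma norm_restr_le: "norm (restr A x i) \<le> norm (x i :: 'k :: real_normed_field)"
  by (simp add: restr_def)

lemma norm_restr_mono: "A \<subseteq> B \<Longrightarrow> norm (restr A x i) \<le> norm (restr B x i :: 'k :: real_normed_field)"
  by (auto simp: restr_def)

lemma color_pos: "0 < color i"
  by (simp add: color_def)

lemma color_prod_encode [simp]: "color (prod_encode (n, j)) = Suc n"
  by (simp add: color_def)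

lemma admissible_subset: "admissible A \<Longrightarrow> B \<subseteq> A \<Longrightarrow> admissible B"
  unfolding admissible_def by (meson card_mono finite_subset order_trans subsetD)

lemma admissible_empty [simp]: "admissible {}"
  by (simp add: admissible_def)

lemma admissible_singleton [simp]: "admissible {i}"
  using color_pos[of i] by (auto simp: admissible_def)

lemma packing_one: "admissible A \<Longrightarrow> packing (\<lambda>j. if j = 0 then A else {})"
  by (auto simp: packing_def disjoint_family_on_def)

lemma packingD:
  assumes "packing F"
  shows "finite (F j)" "i \<in> F j \<Longrightarrow> i \<in> F l \<Longrightarrow> j = l" "finite {j. F j \<noteq> {}}"
  using assms unfolding packing_def admissible_def disjoint_family_on_def by blast+

lemma supp_block_sums: "supp (block_sums F x) \<subseteq> {j. F j \<noteq> {}}"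
  by (auto simp: supp_def block_sums_def)

lemma finite_supp_block_sums [simp]: "packing F \<Longrightarrow> finite (supp (block_sums F x))"
  using supp_block_sums finite_subset packingD(3) by metis

lemma block_sums_nonneg [simp]: "0 \<le> block_sums F x j"
  by (simp add: block_sums_def sum_nonneg)

lemma abs_block_sums [simp]: "\<bar>block_sums F x j\<bar> = block_sums F x j"
  by (rule abs_of_nonneg) simp

context exponent
begin

definition packing_norm :: "(nat \<Rightarrow> nat set) \<Rightarrow> (nat \<Rightarrow> 'k :: real_normed_field) \<Rightarrow> real"
  where "packing_norm F x = lp_norm p (block_sums F x)"

lemma packing_norm_nonneg [simp]: "packing F \<Longrightarrow> 0 \<le> packing_norm F x"
  by (simp add: packing_norm_def)

lemma packing_norm_mono:
  assumes "packing F" "\<And>j i. i \<in> F j \<Longrightarrow> norm (x i) \<le> norm (y i)"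
  shows "packing_norm F x \<le> packing_norm F y"
proof -
  have "block_sums F x j \<le> block_sums F y j" for j
    unfolding block_sums_def using assms(2) by (intro sum_mono) blast
  then show ?thesis
    unfolding packing_norm_def using assms(1) by (intro lp_norm_mono) auto
qed

lemma packing_norm_scale:
  assumes "packing F"
  shows "packing_norm F (\<lambda>i. c * x i) = norm c * packing_norm F x"
proof -
  have "block_sums F (\<lambda>i. c * x i) = (\<lambda>j. norm c * block_sums F x j)"
    by (simp add: block_sums_def norm_mult sum_distrib_left fun_eq_iff)
  then show ?thesis
    using assms by (simp add: packing_norm_def lp_norm_scale)
qed

lemma packing_norm_triangle:
  assumes "packing F"
  shows "packing_norm F (x + y) \<le> packing_norm F x + packing_norm F y"
proof -
  have le: "block_sums F (x + y) j \<le> block_sums F x j + block_sums F y j" for j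
    by (simp add: block_sums_def sum.distrib[symmetric] sum_mono norm_triangle_ineq)
  have "packing_norm F (x + y) \<le> lp_norm p (\<lambda>j. block_sums F x j + block_sums F y j)"
    unfolding packing_norm_def
  proof (intro lp_norm_mono)
    show "finite (supp (\<lambda>j. block_sums F x j + block_sums F y j))"
      by (rule finite_subset[OF _ packingD(3)[OF assms]]) (auto simp: supp_def block_sums_def)
    fix j
    show "norm (block_sums F (x + y) j) \<le> norm (block_sums F x j + block_sums F y j)"
      using le[of j] by simp
  qed
  also have "\<dots> \<le> packing_norm F x + packing_norm F y"
    unfolding packing_norm_def using assms by (intro lp_norm_triangle) auto
  finally show ?thesis .
qed

lemma packing_norm_zero [simp]: "packing F \<Longrightarrow> packing_norm F 0 = 0"
  using packing_norm_scale[of F 0 0] by (simp add: zero_fun_def)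

lemma packing_norm_single:
  assumes F: "packing F" and x: "supp x \<subseteq> {i}"
  shows "packing_norm F x \<le> norm (x i)"
proof -
  have "\<exists>j. \<forall>l. l \<noteq> j \<longrightarrow> i \<notin> F l"
    using packingD(2)[OF F] by metis
  then obtain j where j: "\<And>l. l \<noteq> j \<Longrightarrow> i \<notin> F l"
    by blast
  have x0: "x k = 0" if "k \<noteq> i" for k
    using x that by (auto simp: supp_def)
  have "block_sums F x l \<le> norm (x i) * (if l \<in> {j} then 1 else 0)" for l
  proof (cases "i \<in> F l")
    case True
    have "block_sums F x l = (\<Sum>k\<in>F l. if k = i then norm (x i) else 0)"
      unfolding block_sums_def by (intro sum.cong) (auto simp: x0)
    also have "\<dots> = norm (x i)"
      using True packingD(1)[OF F] by simp
    finally show ?thesis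
      using True j by (cases "l = j") auto
  next
    case False
    then have "block_sums F x l = 0"
      unfolding block_sums_def by (intro sum.neutral) (metis x0 norm_zero)
    then show ?thesis
      by simp
  qed
  moreover have "finite (supp (\<lambda>l. norm (x i) * (if l \<in> {j} then 1 else 0 :: real)))"
    by (rule finite_subset[of _ "{j}"]) (auto simp: supp_def)
  ultimately have "packing_norm F x \<le> lp_norm p (\<lambda>l. norm (x i) * (if l \<in> {j} then 1 else 0))"
    unfolding packing_norm_def by (intro lp_norm_mono) auto
  also have "\<dots> = norm (x i) * lp_norm p (\<lambda>l. if l \<in> {j} then 1 else 0 :: real)"
    using lp_norm_scale[of "\<lambda>l. if l \<in> {j} then 1 else 0" "norm (x i)"] by (simp add: supp_def)
  also have "\<dots> \<le> norm (x i) * 1"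
    using lp_norm_ones[of "{j}"] by (intro mult_left_mono) auto
  finally show ?thesis
    by simp
qed

lemma packing_norm_le_sum:
  assumes F: "packing F" and "finite S" "supp x \<subseteq> S"
  shows "packing_norm F x \<le> (\<Sum>i\<in>S. norm (x i))"
  using assms(2,3)
proof (induction S arbitrary: x rule: finite_induct)
  case empty
  then have "x = 0"
    by (auto simp: supp_def fun_eq_iff)
  then show ?case
    by (simp only: packing_norm_zero[OF F] sum.empty order_refl)
next
  case (insert i S)
  have x: "restr {i} x + restr S x = x"
    using insert(2,4) by (auto simp: restr_def supp_def fun_eq_iff)
  have "packing_norm F x \<le> packing_norm F (restr {i} x) + packing_norm F (restr S x)"
    using packing_norm_triangle[OF F, of "restr {i} x" "restr S x"] unfolding x .
  moreover have "packing_norm F (restr {i} x) \<le> norm (x i)"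
    using packing_norm_single[OF F, of "restr {i} x" i] norm_restr_le[of "{i}" x i] by simp
  moreover have "packing_norm F (restr S x) \<le> (\<Sum>k\<in>S. norm (restr S x k))"
    by (rule insert.IH) simp
  ultimately show ?case
    using insert(1,2) by (simp add: restr_def)
qed

definition nrm :: "(nat \<Rightarrow> 'k :: real_normed_field) \<Rightarrow> real"
  where "nrm x = (SUP F \<in> Collect packing. packing_norm F x)"

definition bounded_seq :: "(nat \<Rightarrow> 'k :: real_normed_field) \<Rightarrow> bool"
  where "bounded_seq x \<longleftrightarrow> (\<exists>K. \<forall>F. packing F \<longrightarrow> packing_norm F x \<le> K)"

lemma nrm_le:
  assumes "\<And>F. packing F \<Longrightarrow> packing_norm F x \<le> K"
  shows "nrm x \<le> K"
  unfolding nrm_def using packing_one[OF admissible_empty] assms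
  by (intro cSUP_least) auto

lemma packing_norm_le_nrm: "bounded_seq x \<Longrightarrow> packing F \<Longrightarrow> packing_norm F x \<le> nrm x"
  unfolding nrm_def bounded_seq_def by (intro cSUP_upper) (auto intro: bdd_aboveI2)

lemma bounded_seq_finite:
  assumes "finite (supp x)"
  shows "bounded_seq x"
  unfolding bounded_seq_def using packing_norm_le_sum[OF _ assms order_refl] by blast

lemma nrm_nonneg: "bounded_seq x \<Longrightarrow> 0 \<le> nrm x"
  using packing_norm_le_nrm[of x] packing_norm_nonneg packing_one[OF admissible_empty] order_trans by metis

lemma nrm_zero: "nrm 0 = 0"
proof (rule antisym)
  show "nrm 0 \<le> 0"
    by (rule nrm_le) (simp only: packing_norm_zero order_refl)
  show "0 \<le> nrm 0"
    by (rule nrm_nonneg[OF bounded_seq_finite]) (simp add: supp_def)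
qed

lemma admissible_sum_le_nrm:
  assumes "bounded_seq x" "admissible A"
  shows "(\<Sum>i\<in>A. norm (x i)) \<le> nrm x"
proof -
  let ?F = "\<lambda>j::nat. if j = 0 then A else {}"
  have F: "packing ?F"
    using assms by (intro packing_one)
  have "(\<Sum>i\<in>A. norm (x i)) \<le> packing_norm ?F x"
    unfolding packing_norm_def
    using lp_norm_coord[of "block_sums ?F x" 0] F by (simp add: block_sums_def sum_nonneg)
  then show ?thesis
    using packing_norm_le_nrm[OF assms(1) F] by simp
qed

lemma coord_le_nrm: "bounded_seq x \<Longrightarrow> norm (x i) \<le> nrm x"
  using admissible_sum_le_nrm[of x "{i}"] by simp

text \<open>The closed span of the unit vectors among the sequences of finite norm. For \<open>p = \<infinity>\<close> it is a
  proper subspace, in which the unit vectors of a color are weakly null; for finite \<open>p\<close> it is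
  everything (\<open>bounded_imp_finitary\<close>), which is half of reflexivity.\<close>

definition finitary :: "(nat \<Rightarrow> 'k :: real_normed_field) set"
  where "finitary = {x. \<forall>\<epsilon>>0. \<exists>m. \<forall>F. packing F \<longrightarrow> packing_norm F (restr {m..} x) \<le> \<epsilon>}"

lemma finitaryD:
  "x \<in> finitary \<Longrightarrow> 0 < \<epsilon> \<Longrightarrow> \<exists>m. \<forall>F. packing F \<longrightarrow> packing_norm F (restr {m..} x) \<le> \<epsilon>"
  by (simp add: finitary_def)

lemma finitary_bounded:
  assumes "x \<in> finitary"
  shows "bounded_seq x"
proof -
  obtain m where m: "\<And>F. packing F \<Longrightarrow> packing_norm F (restr {m..} x) \<le> 1"
    using finitaryD[OF assms zero_less_one] by blast
  have "packing_norm F x \<le> 1 + (\<Sum>i<m. norm (restr {..<m} x i))" if F: "packing F" for F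
  proof -
    have x: "restr {m..} x + restr {..<m} x = x"
      by (auto simp: restr_def fun_eq_iff)
    have "packing_norm F x \<le> packing_norm F (restr {m..} x) + packing_norm F (restr {..<m} x)"
      using packing_norm_triangle[OF F, of "restr {m..} x" "restr {..<m} x"] unfolding x .
    also have "\<dots> \<le> 1 + (\<Sum>i<m. norm (restr {..<m} x i))"
      using m[OF F] packing_norm_le_sum[OF F, of "{..<m}" "restr {..<m} x"] by simp
    finally show ?thesis .
  qed
  then show ?thesis
    unfolding bounded_seq_def by blast
qed

lemma finitary_finite: "finite (supp x) \<Longrightarrow> x \<in> finitary"
proof -
  assume "finite (supp x)"
  then obtain m where m: "supp x \<subseteq> {..<m}"
    using finite_nat_iff_bounded by blast
  have "restr {m..} x = 0"
    using m by (auto simp: restr_def supp_def fun_eq_iff)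
  then show ?thesis
    by (auto simp: finitary_def intro!: exI[of _ m])
qed

text \<open>Solidity, through which restrictions, scalar multiples and diagonal operators are all
  controlled.\<close>

lemma finitary_dominated:
  assumes x: "x \<in> finitary" and le: "\<And>i. norm (y i) \<le> K * norm (x i)"
  shows "y \<in> finitary" "nrm y \<le> K * nrm x"
proof -
  have K: "0 \<le> K \<or> x = 0"
    using le by (metis (no_types, opaque_lifting) ext linorder_not_le mult_neg_pos norm_ge_zero
        order_trans zero_fun_apply zero_less_norm_iff)
  have *: "packing_norm F (restr A y) \<le> \<bar>K\<bar> * packing_norm F (restr A x)" if F: "packing F" for F A
  proof -
    have "packing_norm F (restr A y) \<le> packing_norm F (\<lambda>i. of_real \<bar>K\<bar> * restr A x i)"
    proof (intro packing_norm_mono F)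
      fix i
      have "norm (y i) \<le> \<bar>K\<bar> * norm (x i)"
        using le[of i] by (meson abs_ge_self mult_right_mono norm_ge_zero order_trans)
      then show "norm (restr A y i) \<le> norm (of_real \<bar>K\<bar> * restr A x i)"
        by (simp add: restr_def norm_mult)
    qed
    also have "\<dots> = \<bar>K\<bar> * packing_norm F (restr A x)"
      unfolding packing_norm_scale[OF F] by simp
    finally show ?thesis .
  qed
  show "y \<in> finitary"
    unfolding finitary_def
  proof (clarify)
    fix \<epsilon> :: real assume "0 < \<epsilon>"
    then have "0 < \<epsilon> / (\<bar>K\<bar> + 1)"
      by simp
    then obtain m where m: "\<And>F. packing F \<Longrightarrow> packing_norm F (restr {m..} x) \<le> \<epsilon> / (\<bar>K\<bar> + 1)"
      using finitaryD[OF x] by blast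
    have "packing_norm F (restr {m..} y) \<le> \<epsilon>" if F: "packing F" for F
    proof -
      have "packing_norm F (restr {m..} y) \<le> \<bar>K\<bar> * (\<epsilon> / (\<bar>K\<bar> + 1))"
        using *[OF F] m[OF F] by (meson abs_ge_zero mult_left_mono order_trans)
      also have "\<dots> \<le> \<epsilon>"
        using \<open>0 < \<epsilon>\<close> by (simp add: field_simps)
      finally show ?thesis .
    qed
    then show "\<exists>m. \<forall>F. packing F \<longrightarrow> packing_norm F (restr {m..} y) \<le> \<epsilon>"
      by blast
  qed
  show "nrm y \<le> K * nrm x"
  proof (rule nrm_le)
    fix F assume F: "packing F"
    have "packing_norm F y \<le> \<bar>K\<bar> * packing_norm F x"
      using *[OF F, of UNIV] by (simp add: restr_def)
    also have "\<dots> \<le> K * nrm x"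
    proof (cases "x = 0")
      case True
      then show ?thesis
        by (simp only: packing_norm_zero[OF F] nrm_zero mult_zero_right order_refl)
    next
      case False
      then show ?thesis
        using K packing_norm_le_nrm[OF finitary_bounded[OF x] F] by (simp add: mult_left_mono)
    qed
    finally show "packing_norm F y \<le> K * nrm x" .
  qed
qed

lemma finitary_restr:
  assumes "x \<in> finitary"
  shows "restr A x \<in> finitary" "nrm (restr A x) \<le> nrm x"
  using finitary_dominated[OF assms, of "restr A x" 1] by (simp_all add: norm_restr_le)

lemma nrm_restr_mono:
  assumes "x \<in> finitary" "A \<subseteq> B"
  shows "nrm (restr A x) \<le> nrm (restr B x)"
  using finitary_restr(2)[OF finitary_restr(1)[OF assms(1)], of A B] assms(2) by (simp add: Int_absorb2)

lemma finitary_scale: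
  assumes "x \<in> finitary"
  shows "(\<lambda>i. c * x i) \<in> finitary" "nrm (\<lambda>i. c * x i) = norm c * nrm x"
proof -
  show fin: "(\<lambda>i. c * x i) \<in> finitary"
    using finitary_dominated(1)[OF assms, of "\<lambda>i. c * x i" "norm c"] by (simp add: norm_mult)
  have le: "nrm (\<lambda>i. c * x i) \<le> norm c * nrm x"
    using finitary_dominated(2)[OF assms, of "\<lambda>i. c * x i" "norm c"] by (simp add: norm_mult)
  show "nrm (\<lambda>i. c * x i) = norm c * nrm x"
  proof (cases "c = 0")
    case True
    then show ?thesis
      using le nrm_nonneg[OF finitary_bounded[OF fin]] by simp
  next
    case False
    then have "nrm x \<le> inverse (norm c) * nrm (\<lambda>i. c * x i)"
      using finitary_dominated(2)[OF fin, of x "inverse (norm c)"] by (simp add: norm_mult flip: mult.assoc)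
    then show ?thesis
      using le False by (simp add: field_simps)
  qed
qed

lemma finitary_add:
  assumes x: "x \<in> finitary" and y: "y \<in> finitary"
  shows "x + y \<in> finitary" "nrm (x + y) \<le> nrm x + nrm y"
proof -
  show "nrm (x + y) \<le> nrm x + nrm y"
    using packing_norm_triangle packing_norm_le_nrm finitary_bounded x y
    by (meson add_mono nrm_le order_trans)
  show "x + y \<in> finitary"
    unfolding finitary_def
  proof (clarify)
    fix \<epsilon> :: real assume "0 < \<epsilon>"
    then have e: "0 < \<epsilon> / 2"
      by simp
    obtain m where m: "\<And>F. packing F \<Longrightarrow> packing_norm F (restr {m..} x) \<le> \<epsilon> / 2"
      using finitaryD[OF x e] by blast
    obtain l where l: "\<And>F. packing F \<Longrightarrow> packing_norm F (restr {l..} y) \<le> \<epsilon> / 2"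
      using finitaryD[OF y e] by blast
    let ?n = "max m l"
    have "packing_norm F (restr {?n..} (x + y)) \<le> \<epsilon>" if F: "packing F" for F
    proof -
      have "packing_norm F (restr {?n..} (x + y))
          \<le> packing_norm F (restr {?n..} x) + packing_norm F (restr {?n..} y)"
        unfolding restr_add by (rule packing_norm_triangle[OF F])
      also have "\<dots> \<le> packing_norm F (restr {m..} x) + packing_norm F (restr {l..} y)"
        by (intro add_mono packing_norm_mono F norm_restr_mono) auto
      also have "\<dots> \<le> \<epsilon>"
        using m[OF F] l[OF F] by simp
      finally show ?thesis .
    qed
    then show "\<exists>m. \<forall>F. packing F \<longrightarrow> packing_norm F (restr {m..} (x + y)) \<le> \<epsilon>"
      by blast
  qed
qed

lemma tail_tendsto_0:
  assumes x: "x \<in> finitary"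
  shows "(\<lambda>m. nrm (restr {m..} x)) \<longlonglongrightarrow> 0"
proof (rule LIMSEQ_I)
  fix r :: real assume "0 < r"
  then have "0 < r / 2" by simp
  then obtain m where m: "\<And>F. packing F \<Longrightarrow> packing_norm F (restr {m..} x) \<le> r / 2"
    using finitaryD[OF x] by blast
  have "norm (nrm (restr {l..} x) - 0) < r" if "m \<le> l" for l
    using nrm_restr_mono[OF x, of "{l..}" "{m..}"] nrm_le[of "restr {m..} x", OF m] that \<open>0 < r\<close>
      nrm_nonneg[OF finitary_bounded[OF finitary_restr(1)[OF x]], of "{l..}"] by simp
  then show "\<exists>m. \<forall>l\<ge>m. norm (nrm (restr {l..} x) - 0) < r"
    by blast
qed

definition packing_space :: "('k :: {real_normed_field, banach}, nat \<Rightarrow> 'k) nspace"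
  where "packing_space = \<lparr>vscale = (\<lambda>c x i. c * x i), vcarrier = finitary, vnorm = nrm\<rparr>"

lemma packing_space_simps [simp]:
  "vscale packing_space = (\<lambda>c x i. c * x i)" "vcarrier packing_space = finitary" "vnorm packing_space = nrm"
  by (simp_all add: packing_space_def)

lemma normed_packing_space: "normed_space (packing_space :: ('k :: {real_normed_field, banach}, _) nspace)"
proof -
  interpret V: vector_space "\<lambda>(c :: 'k) x i. c * x i"
    by unfold_locales (auto simp: fun_eq_iff algebra_simps)
  have zero: "nrm x = 0 \<longleftrightarrow> x = 0" if "x \<in> finitary" for x :: "nat \<Rightarrow> 'k"
  proof
    assume "nrm x = 0"
    then have "norm (x i) \<le> 0" for i
      using coord_le_nrm[OF finitary_bounded[OF that], of i] by simp
    then show "x = 0"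
      by (simp add: fun_eq_iff)
  next
    assume "x = 0"
    then show "nrm x = 0"
      using finitary_scale(2)[OF that, of 0] by (simp add: zero_fun_def)
  qed
  have "V.subspace finitary"
    unfolding V.subspace_def using finitary_add finitary_scale finitary_finite[of 0]
    by (auto simp: supp_def)
  then show ?thesis
    unfolding normed_space_def
    using V.vector_space_axioms zero finitary_scale finitary_add nrm_nonneg[OF finitary_bounded]
    by auto
qed

lemma finitary_diff: "x \<in> finitary \<Longrightarrow> y \<in> finitary \<Longrightarrow> x - y \<in> finitary"
  for x y :: "nat \<Rightarrow> 'k :: {real_normed_field, banach}"
  using normed_spaceD(4)[OF normed_packing_space, of x y] by simp

lemma banach_packing_space: "banach_space (packing_space :: ('k :: {real_normed_field, banach}, _) nspace)"
proof -
  let ?X = "packing_space :: ('k, _) nspace"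
  interpret M: Metric_space "vcarrier ?X" "vdist ?X"
    by (rule Metric_space_vdist[OF normed_packing_space])
  have dist: "vdist ?X x y = nrm (x - y)" if "x \<in> finitary" "y \<in> finitary" for x y
    using that by (simp add: vdist_def)
  have "\<exists>x. limitin M.mtopology \<sigma> x sequentially" if cau: "M.MCauchy \<sigma>" for \<sigma>
  proof -
    have fin: "\<sigma> n \<in> finitary" for n
      using cau[unfolded M.MCauchy_def] by auto
    have C: "\<exists>N. \<forall>n\<ge>N. \<forall>k\<ge>N. nrm (\<sigma> n - \<sigma> k) < \<epsilon>" if "0 < \<epsilon>" for \<epsilon>
      using cau that unfolding M.MCauchy_def dist[OF fin fin] by meson
    have "Cauchy (\<lambda>n. \<sigma> n i)" for i
    proof (rule CauchyI)
      fix \<epsilon> :: real assume "0 < \<epsilon>"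
      then obtain N where N: "\<And>n k. N \<le> n \<Longrightarrow> N \<le> k \<Longrightarrow> nrm (\<sigma> n - \<sigma> k) < \<epsilon>"
        using C by blast
      have "norm (\<sigma> n i - \<sigma> k i) \<le> nrm (\<sigma> n - \<sigma> k)" for n k
        using coord_le_nrm[OF finitary_bounded[OF finitary_diff[OF fin fin]], of n k i] by simp
      then show "\<exists>M. \<forall>m\<ge>M. \<forall>n\<ge>M. norm (\<sigma> m i - \<sigma> n i) < \<epsilon>"
        using N le_less_trans by blast
    qed
    then have "\<forall>i. \<exists>l. (\<lambda>n. \<sigma> n i) \<longlonglongrightarrow> l"
      by (simp add: Cauchy_convergent_iff convergent_def)
    then obtain x where x: "\<And>i. (\<lambda>n. \<sigma> n i) \<longlonglongrightarrow> x i"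
      by metis
    have close: "\<exists>N. \<forall>n\<ge>N. \<forall>F. packing F \<longrightarrow> packing_norm F (\<sigma> n - x) \<le> \<epsilon>" if pos: "0 < \<epsilon>" for \<epsilon>
    proof -
      obtain N where N: "\<And>n k. N \<le> n \<Longrightarrow> N \<le> k \<Longrightarrow> nrm (\<sigma> n - \<sigma> k) < \<epsilon>"
        using C[OF pos] by blast
      have "packing_norm F (\<sigma> n - x) \<le> \<epsilon>" if n: "N \<le> n" and F: "packing F" for n F
      proof -
        \<comment> \<open>Only finitely many coordinates matter for \<open>F\<close>, and on them \<open>\<sigma> k\<close> tends to \<open>x\<close>.\<close>
        let ?S = "\<Union>j\<in>{j. F j \<noteq> {}}. F j"
        have S: "finite ?S"
          using packingD(1,3)[OF F] by blast
        have "(\<lambda>k. \<Sum>i\<in>?S. norm (\<sigma> k i - x i)) \<longlonglongrightarrow> (\<Sum>i\<in>?S. norm (x i - x i))"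
          by (intro tendsto_intros x)
        then have "(\<lambda>k. \<epsilon> + (\<Sum>i\<in>?S. norm (\<sigma> k i - x i))) \<longlonglongrightarrow> \<epsilon> + 0"
          by (intro tendsto_add tendsto_const) simp
        moreover have "packing_norm F (\<sigma> n - x) \<le> \<epsilon> + (\<Sum>i\<in>?S. norm (\<sigma> k i - x i))" if k: "N \<le> k" for k
        proof -
          have eq: "\<sigma> n - x = (\<sigma> n - \<sigma> k) + (\<sigma> k - x)"
            by simp
          have "packing_norm F (\<sigma> n - x) \<le> packing_norm F (\<sigma> n - \<sigma> k) + packing_norm F (\<sigma> k - x)"
            unfolding eq by (rule packing_norm_triangle[OF F])
          moreover have "packing_norm F (\<sigma> n - \<sigma> k) \<le> \<epsilon>"
            using packing_norm_le_nrm[OF finitary_bounded[OF finitary_diff[OF fin fin]] F, of n k] N[OF n k]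
            by simp
          moreover have "packing_norm F (\<sigma> k - x) \<le> packing_norm F (restr ?S (\<sigma> k - x))"
            by (intro packing_norm_mono F) (auto simp: restr_def)
          moreover have "packing_norm F (restr ?S (\<sigma> k - x)) \<le> (\<Sum>i\<in>?S. norm (restr ?S (\<sigma> k - x) i))"
            by (rule packing_norm_le_sum[OF F S]) simp
          moreover have "(\<Sum>i\<in>?S. norm (restr ?S (\<sigma> k - x) i)) \<le> (\<Sum>i\<in>?S. norm (\<sigma> k i - x i))"
            by (intro sum_mono) (auto simp: restr_def)
          ultimately show ?thesis
            by linarith
        qed
        ultimately show ?thesis
          using LIMSEQ_le_const[of "\<lambda>k. \<epsilon> + (\<Sum>i\<in>?S. norm (\<sigma> k i - x i))" "\<epsilon> + 0"] by auto
      qed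
      then show ?thesis
        by blast
    qed
    have x_fin: "x \<in> finitary"
    proof -
      show ?thesis
        unfolding finitary_def
      proof (clarify)
        fix \<epsilon> :: real assume "0 < \<epsilon>"
        then have e: "0 < \<epsilon> / 2" by simp
        obtain N where N: "\<And>F. packing F \<Longrightarrow> packing_norm F (\<sigma> N - x) \<le> \<epsilon> / 2"
          using close[OF e] by blast
        obtain m where m: "\<And>F. packing F \<Longrightarrow> packing_norm F (restr {m..} (\<sigma> N)) \<le> \<epsilon> / 2"
          using finitaryD[OF fin e] by blast
        have "packing_norm F (restr {m..} x) \<le> \<epsilon>" if F: "packing F" for F
        proof -
          have eq: "restr {m..} x = restr {m..} (\<sigma> N) + restr {m..} (x - \<sigma> N)"
            by (auto simp: restr_def fun_eq_iff)
          have "packing_norm F (restr {m..} x)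
              \<le> packing_norm F (restr {m..} (\<sigma> N)) + packing_norm F (restr {m..} (x - \<sigma> N))"
            unfolding eq by (rule packing_norm_triangle[OF F])
          moreover have "packing_norm F (restr {m..} (x - \<sigma> N)) \<le> packing_norm F (\<sigma> N - x)"
            by (intro packing_norm_mono F) (auto simp: restr_def norm_minus_commute)
          ultimately show ?thesis
            using m[OF F] N[OF F] by linarith
        qed
        then show "\<exists>m. \<forall>F. packing F \<longrightarrow> packing_norm F (restr {m..} x) \<le> \<epsilon>"
          by blast
      qed
    qed
    have "\<exists>N. \<forall>n\<ge>N. \<sigma> n \<in> vcarrier ?X \<and> vdist ?X (\<sigma> n) x < \<epsilon>" if "0 < \<epsilon>" for \<epsilon>
    proof -
      have e: "0 < \<epsilon> / 2" using that by simp
      obtain N where N: "\<And>n F. N \<le> n \<Longrightarrow> packing F \<Longrightarrow> packing_norm F (\<sigma> n - x) \<le> \<epsilon> / 2"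
        using close[OF e] by blast
      have "vdist ?X (\<sigma> n) x < \<epsilon>" if "N \<le> n" for n
        using nrm_le[OF N[OF that]] e by (simp add: dist fin x_fin)
      then show ?thesis
        using fin by auto
    qed
    then have "limitin M.mtopology \<sigma> x sequentially"
      unfolding M.limit_metric_sequentially using x_fin by simp
    then show ?thesis
      by blast
  qed
  then have "M.mcomplete"
    unfolding M.mcomplete_def by blast
  then show ?thesis
    using normed_packing_space by (auto simp: banach_space_def)
qed

end

section \<open>Upper estimates for disjoint sums\<close>

lemma powr_unbounded:
  assumes "0 < (r :: real)"
  shows "\<exists>n :: nat. 1 \<le> n \<and> c < real n powr r"
proof -
  obtain n :: nat where n: "max 1 ((\<bar>c\<bar> + 1) powr (1 / r)) < real n"
    using reals_Archimedean2 by blast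
  have "((\<bar>c\<bar> + 1) powr (1 / r)) powr r \<le> real n powr r"
    using n assms by (intro powr_mono2) auto
  then have "\<bar>c\<bar> + 1 \<le> real n powr r"
    using assms by (simp add: powr_powr)
  then show ?thesis
    using n by (intro exI[of _ n]) auto
qed

lemma sum_fun_apply: "(\<Sum>j\<in>S. u j) i = (\<Sum>j\<in>S. u j i)" for u :: "'i \<Rightarrow> 'j \<Rightarrow> 'k :: comm_monoid_add"
  by (induction S rule: infinite_finite_induct) auto

lemma supp_norm [simp]: "supp (\<lambda>k. norm (\<alpha> k)) = supp \<alpha>"
  by (simp add: supp_def)

lemma supp_sum_subset:
  fixes u :: "nat \<Rightarrow> nat \<Rightarrow> 'k :: real_normed_field"
  shows "supp (\<lambda>i. \<Sum>k\<in>S. \<alpha> k * u k i) \<subseteq> (\<Union>k\<in>S. supp (u k))"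
proof
  fix i assume "i \<in> supp (\<lambda>i. \<Sum>k\<in>S. \<alpha> k * u k i)"
  then have "(\<Sum>k\<in>S. \<alpha> k * u k i) \<noteq> 0"
    by (simp add: supp_def)
  then obtain k where "k \<in> S" "\<alpha> k * u k i \<noteq> 0"
    by (rule sum.not_neutral_contains_not_neutral)
  then show "i \<in> (\<Union>k\<in>S. supp (u k))"
    by (auto simp: supp_def)
qed

lemma finite_supp_sum:
  fixes u :: "nat \<Rightarrow> nat \<Rightarrow> 'k :: real_normed_field"
  assumes "finite S" "\<And>k. k \<in> S \<Longrightarrow> finite (supp (u k))"
  shows "finite (supp (\<lambda>i. \<Sum>k\<in>S. \<alpha> k * u k i))"
  by (rule finite_subset[OF supp_sum_subset]) (use assms in auto)

context exponent
begin

text \<open>On colors up to \<open>n\<close> a block has at most \<open>n\<close> elements, so its sum is at most \<open>n\<close> times its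
  largest entry. Together with \<open>lp_le_nrm\<close>, this makes the space isomorphic to \<open>\<ell>\<^sub>p\<close> (or \<open>c\<^sub>0\<close>)
  there, with a constant that depends on \<open>n\<close>.\<close>

lemma packing_norm_le_lp:
  assumes F: "packing F" and fin: "finite (supp x)" and col: "\<And>i. i \<in> supp x \<Longrightarrow> color i \<le> n"
  shows "packing_norm F x \<le> real n * lp_norm p x"
proof -
  let ?J = "{j. F j \<noteq> {}}"
  have "\<exists>i\<in>F j. block_sums F x j \<le> real n * norm (x i)" if j: "j \<in> ?J" for j
  proof -
    have Fj: "finite (F j)" "F j \<noteq> {}"
      using packingD(1)[OF F] j by auto
    have "Max ((\<lambda>k. norm (x k)) ` F j) \<in> (\<lambda>k. norm (x k)) ` F j"
      using Fj by (intro Max_in) auto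
    then obtain i where "i \<in> F j" "Max ((\<lambda>k. norm (x k)) ` F j) = norm (x i)"
      by blast
    then have i: "i \<in> F j" "\<And>k. k \<in> F j \<Longrightarrow> norm (x k) \<le> norm (x i)"
      using Max_ge[of "(\<lambda>k. norm (x k)) ` F j"] Fj by auto
    obtain c where c: "card (F j) \<le> c" "\<And>k. k \<in> F j \<Longrightarrow> color k = c"
      using F unfolding packing_def admissible_def by blast
    have "block_sums F x j \<le> real n * norm (x i)"
    proof (cases "c \<le> n")
      case True
      have "block_sums F x j \<le> real (card (F j)) * norm (x i)"
        unfolding block_sums_def using i by (intro sum_bounded_above) auto
      also have "\<dots> \<le> real n * norm (x i)"
        using c True by (intro mult_right_mono) auto
      finally show ?thesis .
    next
      case False
      then have "x k = 0" if "k \<in> F j" for k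
        using col[of k] c(2)[OF that] by (auto simp: supp_def)
      then show ?thesis
        by (simp add: block_sums_def)
    qed
    with i show ?thesis
      by blast
  qed
  then have "\<forall>j\<in>?J. \<exists>i. i \<in> F j \<and> block_sums F x j \<le> real n * norm (x i)"
    by blast
  from bchoice[OF this] obtain g where "\<forall>j\<in>?J. g j \<in> F j \<and> block_sums F x j \<le> real n * norm (x (g j))" ..
  then have g: "\<And>j. j \<in> ?J \<Longrightarrow> g j \<in> F j"
      "\<And>j. j \<in> ?J \<Longrightarrow> block_sums F x j \<le> real n * norm (x (g j))"
    by simp_all
  have "packing_norm F x \<le> lp_norm p (\<lambda>i. real n * norm (x i))"
    unfolding packing_norm_def
  proof (rule lp_norm_inject)
    show "inj_on g ?J"
    proof (rule inj_onI)
      fix j l assume j: "j \<in> ?J" and l: "l \<in> ?J" and eq: "g j = g l"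
      show "j = l"
        using g(1)[OF j] g(1)[OF l] unfolding eq by (rule packingD(2)[OF F])
    qed
    show "finite (supp (\<lambda>i. real n * norm (x i)))"
      using fin by (rule rev_finite_subset) (auto simp: supp_def)
    show "norm (block_sums F x j) \<le> norm (real n * norm (x (g j)))" if "j \<in> ?J" for j
      using g(2)[OF that] by (simp add: abs_mult)
  qed (rule packingD(3)[OF F] supp_block_sums)+
  also have "\<dots> = real n * lp_norm p x"
    using lp_norm_scale[of "\<lambda>i. norm (x i)" "real n"] fin by (simp add: lp_norm_norm)
  finally show ?thesis .
qed

lemma lp_le_nrm:
  assumes "finite (supp x)"
  shows "lp_norm p x \<le> nrm x"
proof -
  let ?F = "\<lambda>j. if j \<in> supp x then {j} else {}"
  have F: "packing ?F"
    using assms by (auto simp: packing_def disjoint_family_on_def)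
  have "block_sums ?F x = (\<lambda>j. norm (x j))"
    by (auto simp: block_sums_def supp_def fun_eq_iff)
  then have "packing_norm ?F x = lp_norm p x"
    by (simp add: packing_norm_def lp_norm_norm)
  then show ?thesis
    using packing_norm_le_nrm[OF bounded_seq_finite[OF assms] F] by simp
qed

lemma nrm_disjoint_sum_le:
  fixes u :: "nat \<Rightarrow> nat \<Rightarrow> 'k :: real_normed_field"
  assumes \<alpha>: "finite (supp \<alpha>)"
    and u: "\<And>k. k \<in> supp \<alpha> \<Longrightarrow> finite (supp (u k))" "\<And>k. k \<in> supp \<alpha> \<Longrightarrow> nrm (u k) \<le> 1"
    and disj: "\<And>k l i. k \<in> supp \<alpha> \<Longrightarrow> l \<in> supp \<alpha> \<Longrightarrow> i \<in> supp (u k) \<Longrightarrow> i \<in> supp (u l) \<Longrightarrow> k = l"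
    and col: "\<And>k i. k \<in> supp \<alpha> \<Longrightarrow> i \<in> supp (u k) \<Longrightarrow> color i \<le> n"
  shows "nrm (\<lambda>i. \<Sum>k\<in>supp \<alpha>. \<alpha> k * u k i) \<le> real n * lp_norm p \<alpha>"
proof (rule nrm_le)
  fix F assume F: "packing F"
  let ?x = "\<lambda>i. \<Sum>k\<in>supp \<alpha>. \<alpha> k * u k i" and ?y = "\<lambda>i. \<Sum>k\<in>supp \<alpha>. norm (\<alpha> k) * norm (u k i)"
  have fin: "finite (supp ?x)"
    by (rule finite_supp_sum[OF \<alpha> u(1)])
  have "packing_norm F ?x \<le> real n * lp_norm p ?x"
  proof (rule packing_norm_le_lp[OF F fin])
    fix i assume "i \<in> supp ?x"
    then have "\<exists>k\<in>supp \<alpha>. i \<in> supp (u k)"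
      using supp_sum_subset by blast
    then show "color i \<le> n"
      using col by blast
  qed
  also have "lp_norm p ?x \<le> lp_norm p ?y"
  proof (rule lp_norm_mono)
    show "finite (supp ?y)"
      using finite_supp_sum[OF \<alpha>, of "\<lambda>k i. norm (u k i)" "\<lambda>k. norm (\<alpha> k)"] u(1) by simp
    show "norm (?x i) \<le> norm (?y i)" for i
      using norm_sum[of "\<lambda>k. \<alpha> k * u k i" "supp \<alpha>"] by (simp add: norm_mult sum_nonneg)
  qed
  also have "lp_norm p ?y \<le> lp_norm p (\<lambda>k. norm (\<alpha> k))"
    using lp_norm_disjoint[of "\<lambda>k. norm (\<alpha> k)" "\<lambda>k i. norm (u k i)"] \<alpha> u disj lp_le_nrm[OF u(1)] order_trans
    by (simp add: lp_norm_norm supp_def[of "u _"]) blast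
  finally show "packing_norm F ?x \<le> real n * lp_norm p \<alpha>"
    by (simp add: lp_norm_norm mult_left_mono)
qed

text \<open>Between different colors no constant is lost: a block is monochromatic and so meets at most
  one of the summands.\<close>

lemma nrm_color_disjoint_sum_le:
  fixes u :: "nat \<Rightarrow> nat \<Rightarrow> 'k :: real_normed_field"
  assumes \<alpha>: "finite (supp \<alpha>)"
    and u: "\<And>k. k \<in> supp \<alpha> \<Longrightarrow> finite (supp (u k))" "\<And>k. k \<in> supp \<alpha> \<Longrightarrow> nrm (u k) \<le> 1"
    and disj: "\<And>k l i j. k \<in> supp \<alpha> \<Longrightarrow> l \<in> supp \<alpha> \<Longrightarrow> i \<in> supp (u k) \<Longrightarrow> j \<in> supp (u l) \<Longrightarrow>
      color i = color j \<Longrightarrow> k = l"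
  shows "nrm (\<lambda>i. \<Sum>k\<in>supp \<alpha>. \<alpha> k * u k i) \<le> lp_norm p \<alpha>"
proof (rule nrm_le)
  fix F assume F: "packing F"
  let ?x = "\<lambda>i. \<Sum>k\<in>supp \<alpha>. \<alpha> k * u k i"
  let ?y = "\<lambda>j. \<Sum>k\<in>supp \<alpha>. norm (\<alpha> k) * block_sums F (u k) j"
  have "packing_norm F ?x \<le> lp_norm p ?y"
    unfolding packing_norm_def
  proof (rule lp_norm_mono)
    show "finite (supp ?y)"
      using finite_supp_sum[OF \<alpha>, of "\<lambda>k. block_sums F (u k)" "\<lambda>k. norm (\<alpha> k)"] F by simp
    fix j
    have "block_sums F ?x j \<le> (\<Sum>i\<in>F j. \<Sum>k\<in>supp \<alpha>. norm (\<alpha> k) * norm (u k i))"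
      unfolding block_sums_def norm_mult[symmetric] by (intro sum_mono norm_sum)
    also have "\<dots> = ?y j"
      unfolding block_sums_def sum_distrib_left by (rule sum.swap)
    finally show "norm (block_sums F ?x j) \<le> norm (?y j)"
      by simp
  qed
  also have "\<dots> \<le> lp_norm p (\<lambda>k. norm (\<alpha> k))"
  proof -
    have "k = l" if kl: "k \<in> supp \<alpha>" "l \<in> supp \<alpha>" "block_sums F (u k) j \<noteq> 0" "block_sums F (u l) j \<noteq> 0" for j k l
    proof -
      have *: "\<exists>i\<in>F j. i \<in> supp (u k)" if "block_sums F (u k) j \<noteq> 0" for k
        using that unfolding block_sums_def supp_def by (metis (mono_tags) mem_Collect_eq norm_zero sum.neutral)
      obtain i i' where i: "i \<in> F j" "i' \<in> F j" "i \<in> supp (u k)" "i' \<in> supp (u l)"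
        using *[OF kl(3)] *[OF kl(4)] by blast
      moreover have "color i = color i'"
        using F i(1,2) unfolding packing_def admissible_def by metis
      ultimately show ?thesis
        using disj kl by blast
    qed
    moreover have "lp_norm p (block_sums F (u k)) \<le> 1" if "k \<in> supp \<alpha>" for k
      using packing_norm_le_nrm[OF bounded_seq_finite[OF u(1)[OF that]] F] u(2)[OF that]
      by (simp add: packing_norm_def)
    ultimately show ?thesis
      using lp_norm_disjoint[of "\<lambda>k. norm (\<alpha> k)" "\<lambda>k. block_sums F (u k)"] \<alpha> F by simp
  qed
  finally show "packing_norm F ?x \<le> lp_norm p \<alpha>"
    by (simp add: lp_norm_norm)
qed

section \<open>Functionals are small on tails\<close>

abbreviation dual :: "((nat \<Rightarrow> 'k :: {real_normed_field, banach}) \<Rightarrow> 'k) set"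
  where "dual \<equiv> operators packing_space scalar_space"

lemma dualD:
  assumes "f \<in> dual"
  shows "x \<in> finitary \<Longrightarrow> y \<in> finitary \<Longrightarrow> f (x + y) = f x + f y"
    and "x \<in> finitary \<Longrightarrow> f (\<lambda>i. c * x i) = c * f x"
    and "\<exists>K\<ge>0. \<forall>x\<in>finitary. norm (f x) \<le> K * nrm x"
proof -
  show "x \<in> finitary \<Longrightarrow> y \<in> finitary \<Longrightarrow> f (x + y) = f x + f y"
    and "x \<in> finitary \<Longrightarrow> f (\<lambda>i. c * x i) = c * f x"
    using assms by (auto simp: operators_def scalar_space_def)
  obtain K where "\<forall>x\<in>finitary. norm (f x) \<le> K * nrm x"
    using assms by (auto simp: operators_def scalar_space_def)
  then have "\<forall>x\<in>finitary. norm (f x) \<le> \<bar>K\<bar> * nrm x"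
    by (meson abs_ge_self mult_right_mono nrm_nonneg finitary_bounded order_trans)
  then show "\<exists>K\<ge>0. \<forall>x\<in>finitary. norm (f x) \<le> K * nrm x"
    by (metis abs_ge_zero)
qed

lemma finitary_sum:
  fixes u :: "'i \<Rightarrow> nat \<Rightarrow> 'k :: {real_normed_field, banach}"
  assumes "finite S" "\<And>j. j \<in> S \<Longrightarrow> u j \<in> finitary"
  shows "(\<Sum>j\<in>S. u j) \<in> finitary"
  using assms by (induction S rule: finite_induct) (auto intro: finitary_add finitary_finite simp: supp_def)

lemma dual_zero: "f \<in> dual \<Longrightarrow> f 0 = 0"
  using dualD(2)[of f 0 0] finitary_finite[of 0] by (simp add: supp_def zero_fun_def)

lemma dual_sum:
  assumes f: "f \<in> dual" and "finite S" "\<And>j. j \<in> S \<Longrightarrow> u j \<in> finitary"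
  shows "f (\<Sum>j\<in>S. u j) = (\<Sum>j\<in>S. f (u j))"
  using assms(2,3)
  by (induction S rule: finite_induct) (auto simp: dual_zero[OF f] dualD(1)[OF f] finitary_sum)

text \<open>If \<open>f\<close> stayed above \<open>\<delta>\<close> on vectors arbitrarily far out, then \<open>f\<close> would be at least \<open>M * \<delta>\<close>
  on the sum of \<open>M\<close> such vectors with separated supports, whose norm grows slower than \<open>M\<close>. What
  \<open>far out\<close> means is left open through \<open>\<rho>\<close>: it is needed once for large colors and once, within
  finitely many colors, for large indices.\<close>

lemma functional_small_of_upper_estimate:
  fixes f :: "(nat \<Rightarrow> 'k :: {real_normed_field, banach}) \<Rightarrow> 'k" and \<rho> :: "nat \<Rightarrow> nat"
  assumes f: "f \<in> dual" and \<delta>: "0 < \<delta>"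
    and upper: "\<And>M (u :: nat \<Rightarrow> nat \<Rightarrow> 'k).
      (\<And>j. j < M \<Longrightarrow> finite (supp (u j)) \<and> supp (u j) \<subseteq> B \<and> nrm (u j) \<le> 1) \<Longrightarrow>
      (\<And>j l i k. j < M \<Longrightarrow> l < M \<Longrightarrow> i \<in> supp (u j) \<Longrightarrow> k \<in> supp (u l) \<Longrightarrow> \<rho> i = \<rho> k \<Longrightarrow> j = l) \<Longrightarrow>
      nrm (\<Sum>j<M. u j) \<le> C * real M powr (1 - rate)"
  shows "\<exists>k. \<forall>y. finite (supp y) \<longrightarrow> supp y \<subseteq> {i\<in>B. k \<le> \<rho> i} \<longrightarrow> norm (f y) \<le> \<delta> * nrm y"
proof (rule ccontr)
  assume "\<not> ?thesis"
  then have bad: "\<exists>y. finite (supp y) \<and> supp y \<subseteq> {i\<in>B. k \<le> \<rho> i} \<and> \<delta> * nrm y < norm (f y)" for k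
    by (meson not_le)
  have "\<exists>y k' t. finite (supp y) \<and> supp y \<subseteq> {i\<in>B. k \<le> \<rho> i \<and> \<rho> i < k'} \<and> nrm y \<le> 1 \<and>
      f y = of_real t \<and> \<delta> \<le> t \<and> k \<le> k'" for k
  proof -
    obtain y where y: "finite (supp y)" "supp y \<subseteq> {i\<in>B. k \<le> \<rho> i}" "\<delta> * nrm y < norm (f y)"
      using bad by blast
    have yf: "y \<in> finitary"
      using y(1) by (rule finitary_finite)
    have fy: "f y \<noteq> 0"
      using y(3) \<delta> nrm_nonneg[OF finitary_bounded[OF yf]] by (auto simp: mult_less_0_iff)
    have "nrm y \<noteq> 0"
      using fy yf dual_zero[OF f] normed_spaceD(7)[OF normed_packing_space, of y] by auto
    then have pos: "0 < nrm y"
      using nrm_nonneg[OF finitary_bounded[OF yf]] by simp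
    \<comment> \<open>Rotate and normalise \<open>y\<close> so that its image becomes a positive real number.\<close>
    let ?c = "of_real (norm (f y) / nrm y) / f y"
    let ?y = "\<lambda>i. ?c * y i"
    have "f ?y = of_real (norm (f y) / nrm y)"
      using dualD(2)[OF f yf, of ?c] fy by simp
    moreover have "norm ?c = inverse (nrm y)"
      using fy pos by (simp add: norm_divide field_simps del: of_real_divide)
    then have "nrm ?y \<le> 1"
      using finitary_scale(2)[OF yf, of ?c] pos by simp
    moreover have "\<delta> \<le> norm (f y) / nrm y"
      using y(3) pos by (simp add: field_simps)
    moreover have "supp ?y \<subseteq> supp y"
      by (auto simp: supp_def)
    moreover have "\<rho> i < Suc (Max (insert k (\<rho> ` supp y)))" if "i \<in> supp y" for i
      using y(1) that by (simp add: less_Suc_eq_le)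
    moreover have "k \<le> Suc (Max (insert k (\<rho> ` supp y)))"
      using y(1) by (simp add: le_SucI)
    ultimately show ?thesis
      using y(1,2) finite_subset[OF \<open>supp ?y \<subseteq> supp y\<close> y(1)]
      by (intro exI[of _ ?y] exI[of _ "Suc (Max (insert k (\<rho> ` supp y)))"] exI[of _ "norm (f y) / nrm y"]) blast
  qed
  then have "\<forall>k. \<exists>y k' t. finite (supp y) \<and> supp y \<subseteq> {i\<in>B. k \<le> \<rho> i \<and> \<rho> i < k'} \<and> nrm y \<le> 1 \<and>
      f y = of_real t \<and> \<delta> \<le> t \<and> k \<le> k'"
    by blast
  then obtain Y K T where YKT: "\<forall>k. finite (supp (Y k)) \<and> supp (Y k) \<subseteq> {i\<in>B. k \<le> \<rho> i \<and> \<rho> i < K k} \<and>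
      nrm (Y k) \<le> 1 \<and> f (Y k) = of_real (T k) \<and> \<delta> \<le> T k \<and> k \<le> K k"
    unfolding choice_iff by auto
  have Y: "\<And>k. finite (supp (Y k))" "\<And>k. nrm (Y k) \<le> 1"
      "\<And>k. supp (Y k) \<subseteq> {i\<in>B. k \<le> \<rho> i \<and> \<rho> i < K k}"
    and T: "\<And>k. f (Y k) = of_real (T k)" "\<And>k. \<delta> \<le> T k" and K: "\<And>k. k \<le> K k"
    using YKT by simp_all
  define \<kappa> where "\<kappa> = rec_nat 0 (\<lambda>_. K)"
  have \<kappa>_Suc: "\<kappa> (Suc j) = K (\<kappa> j)" for j
    by (simp add: \<kappa>_def)
  have \<kappa>_mono: "\<kappa> j \<le> \<kappa> l" if "j \<le> l" for j l
    by (rule lift_Suc_mono_le[OF _ that]) (simp add: \<kappa>_Suc K)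
  let ?u = "\<lambda>j. Y (\<kappa> j)"
  have below: "\<rho> i < \<rho> k" if "i \<in> supp (?u j)" "k \<in> supp (?u l)" "j < l" for i k j l
    using that Y(3)[of "\<kappa> j"] Y(3)[of "\<kappa> l"] \<kappa>_mono[of "Suc j" l] by (force simp: \<kappa>_Suc)
  have upper': "nrm (\<Sum>j<M. ?u j) \<le> C * real M powr (1 - rate)" for M
  proof (rule upper)
    show "j = l" if "i \<in> supp (?u j)" "k \<in> supp (?u l)" "\<rho> i = \<rho> k" for j l i k
      using below[of i j k l] below[of k l i j] that by (cases j l rule: linorder_cases) auto
    show "finite (supp (?u j)) \<and> supp (?u j) \<subseteq> B \<and> nrm (?u j) \<le> 1" for j
      using Y(1,2) Y(3)[of "\<kappa> j"] by blast
  qed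
  obtain L where L: "0 \<le> L" "\<And>x. x \<in> finitary \<Longrightarrow> norm (f x) \<le> L * nrm x"
    using dualD(3)[OF f] by blast
  have "real M * \<delta> \<le> L * (C * real M powr (1 - rate))" for M
  proof -
    have "real M * \<delta> \<le> (\<Sum>j<M. T (\<kappa> j))"
      using sum_bounded_below[of "{..<M}" \<delta> "\<lambda>j. T (\<kappa> j)"] T(2) by simp
    also have "\<dots> \<le> norm (of_real (\<Sum>j<M. T (\<kappa> j)) :: 'k)"
      unfolding norm_of_real by simp
    also have "(of_real (\<Sum>j<M. T (\<kappa> j)) :: 'k) = f (\<Sum>j<M. ?u j)"
      by (simp add: dual_sum[OF f] finitary_finite Y(1) T(1))
    also have "norm \<dots> \<le> L * nrm (\<Sum>j<M. ?u j)"
      by (intro L(2) finitary_sum finitary_finite Y(1)) auto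
    also have "\<dots> \<le> L * (C * real M powr (1 - rate))"
      using upper' L(1) by (intro mult_left_mono)
    finally show ?thesis .
  qed
  moreover obtain M :: nat where M: "1 \<le> M" "L * C / \<delta> < real M powr rate"
    using powr_unbounded[OF rate_pos] by blast
  ultimately have "real M * \<delta> \<le> L * C * real M powr (1 - rate)"
    by (simp add: mult.assoc)
  also have "\<dots> < (real M powr rate * \<delta>) * real M powr (1 - rate)"
    using M \<delta> by (intro mult_strict_right_mono) (auto simp: field_simps)
  also have "\<dots> = real M * \<delta>"
    using M by (simp add: mult.commute mult.left_commute flip: powr_add)
  finally show False
    by simp
qed

lemma lp_norm_indicator_lessThan:
  "lp_norm p (\<lambda>k. if k < M then 1 else 0 :: 'k :: real_normed_field) \<le> real M powr (1 - rate)"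
  using lp_norm_ones[of "{..<M}"] lp_norm_norm[of "\<lambda>k. if k < M then 1 else 0 :: 'k"]
  by (simp add: if_distrib cong: if_cong)

text \<open>The unit vectors form a shrinking basis. First all large colors are disposed of at once, by
  the estimate between different colors; the finitely many colors that are left carry a space
  isomorphic to \<open>\<ell>\<^sub>p\<close> or \<open>c\<^sub>0\<close>.\<close>

theorem functional_small_on_tails:
  fixes f :: "(nat \<Rightarrow> 'k :: {real_normed_field, banach}) \<Rightarrow> 'k"
  assumes f: "f \<in> dual" and \<delta>: "0 < \<delta>"
  shows "\<exists>m. \<forall>y\<in>finitary. norm (f (restr {m..} y)) \<le> \<delta> * nrm y"
proof -
  have \<delta>2: "0 < \<delta> / 2"
    using \<delta> by simp
  have sum_eq: "(\<Sum>j<M. u j) = (\<lambda>i. \<Sum>k\<in>supp (\<lambda>k. if k < M then 1 else 0 :: 'k). (if k < M then 1 else 0) * u k i)"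
    for M :: nat and u :: "nat \<Rightarrow> nat \<Rightarrow> 'k"
    by (auto simp: fun_eq_iff sum_fun_apply supp_def lessThan_def intro!: sum.cong)
  have supp_eq: "supp (\<lambda>k. if k < M then 1 else 0 :: 'k) = {..<M}" for M :: nat
    by (auto simp: supp_def)
  have "\<exists>k. \<forall>y. finite (supp y) \<longrightarrow> supp y \<subseteq> {i\<in>UNIV. k \<le> color i} \<longrightarrow> norm (f y) \<le> \<delta> / 2 * nrm y"
  proof (rule functional_small_of_upper_estimate[OF f \<delta>2, where C = 1])
    fix M and u :: "nat \<Rightarrow> nat \<Rightarrow> 'k"
    assume u: "\<And>j. j < M \<Longrightarrow> finite (supp (u j)) \<and> supp (u j) \<subseteq> UNIV \<and> nrm (u j) \<le> 1"
      "\<And>j l i k. j < M \<Longrightarrow> l < M \<Longrightarrow> i \<in> supp (u j) \<Longrightarrow> k \<in> supp (u l) \<Longrightarrow> color i = color k \<Longrightarrow> j = l"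
    have "nrm (\<Sum>j<M. u j) \<le> lp_norm p (\<lambda>k. if k < M then 1 else 0 :: 'k)"
      unfolding sum_eq using u by (intro nrm_color_disjoint_sum_le) (auto simp: supp_eq)
    then show "nrm (\<Sum>j<M. u j) \<le> 1 * real M powr (1 - rate)"
      using lp_norm_indicator_lessThan[where ?'k = 'k] order_trans by fastforce
  qed
  then obtain k where k: "\<And>y. finite (supp y) \<Longrightarrow> supp y \<subseteq> {i. k \<le> color i} \<Longrightarrow> norm (f y) \<le> \<delta> / 2 * nrm y"
    by auto
  have "\<exists>m. \<forall>y. finite (supp y) \<longrightarrow> supp y \<subseteq> {i\<in>{i. color i < k}. m \<le> i} \<longrightarrow> norm (f y) \<le> \<delta> / 2 * nrm y"
  proof (rule functional_small_of_upper_estimate[OF f \<delta>2, where C = "real k"])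
    fix M and u :: "nat \<Rightarrow> nat \<Rightarrow> 'k"
    assume u: "\<And>j. j < M \<Longrightarrow> finite (supp (u j)) \<and> supp (u j) \<subseteq> {i. color i < k} \<and> nrm (u j) \<le> 1"
      "\<And>j l i k. j < M \<Longrightarrow> l < M \<Longrightarrow> i \<in> supp (u j) \<Longrightarrow> k \<in> supp (u l) \<Longrightarrow> i = k \<Longrightarrow> j = l"
    have "nrm (\<Sum>j<M. u j) \<le> real k * lp_norm p (\<lambda>k. if k < M then 1 else 0 :: 'k)"
      unfolding sum_eq
    proof (rule nrm_disjoint_sum_le)
      show "color i \<le> k" if "j \<in> supp (\<lambda>k. if k < M then 1 else 0 :: 'k)" "i \<in> supp (u j)" for j i
        using u(1)[of j] that by (auto simp: supp_eq)
    qed (use u in \<open>auto simp: supp_eq\<close>)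
    also have "\<dots> \<le> real k * real M powr (1 - rate)"
      by (intro mult_left_mono lp_norm_indicator_lessThan) simp
    finally show "nrm (\<Sum>j<M. u j) \<le> real k * real M powr (1 - rate)" .
  qed
  then obtain m where m: "\<And>y. finite (supp y) \<Longrightarrow> supp y \<subseteq> {i. color i < k \<and> m \<le> i} \<Longrightarrow> norm (f y) \<le> \<delta> / 2 * nrm y"
    by auto
  have finite_tail: "norm (f (restr {m..<l} y)) \<le> \<delta> * nrm y" if y: "y \<in> finitary" for y l
  proof -
    let ?z = "restr {m..<l} y"
    have z: "finite (supp ?z)"
      by simp
    have zf: "?z \<in> finitary"
      using z by (rule finitary_finite)
    have parts: "?z = restr {i. k \<le> color i} ?z + restr {i. color i < k} ?z"
      by (auto simp: fun_eq_iff restr_def)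
    have "f ?z = f (restr {i. k \<le> color i} ?z) + f (restr {i. color i < k} ?z)"
      by (subst parts) (intro dualD(1)[OF f] finitary_restr zf)
    then have "norm (f ?z) \<le> norm (f (restr {i. k \<le> color i} ?z)) + norm (f (restr {i. color i < k} ?z))"
      by (metis norm_triangle_ineq)
    also have "\<dots> \<le> \<delta> / 2 * nrm (restr {i. k \<le> color i} ?z) + \<delta> / 2 * nrm (restr {i. color i < k} ?z)"
      by (intro add_mono k m) auto
    also have "\<dots> \<le> \<delta> / 2 * nrm y + \<delta> / 2 * nrm y"
      using \<delta>2 by (intro add_mono mult_left_mono order_trans[OF finitary_restr(2) finitary_restr(2)] zf y) auto
    finally show ?thesis
      by simp
  qed
  obtain K where K: "0 \<le> K" "\<And>x. x \<in> finitary \<Longrightarrow> norm (f x) \<le> K * nrm x"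
    using dualD(3)[OF f] by blast
  have "norm (f (restr {m..} y)) \<le> \<delta> * nrm y" if y: "y \<in> finitary" for y
  proof (rule LIMSEQ_le_const)
    show "(\<lambda>l. \<delta> * nrm y + K * nrm (restr {l..} y)) \<longlonglongrightarrow> \<delta> * nrm y"
      using tendsto_add[OF tendsto_const[of "\<delta> * nrm y"] tendsto_mult_left[OF tail_tendsto_0[OF y], of K]] by simp
    have "norm (f (restr {m..} y)) \<le> \<delta> * nrm y + K * nrm (restr {l..} y)" if "m \<le> l" for l
    proof -
      have parts: "restr {m..} y = restr {m..<l} y + restr {l..} y"
        using that by (auto simp: fun_eq_iff restr_def)
      have "f (restr {m..} y) = f (restr {m..<l} y) + f (restr {l..} y)"
        unfolding parts by (intro dualD(1)[OF f] finitary_restr y)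
      then show ?thesis
        using finite_tail[OF y, of l] K(2)[OF finitary_restr(1)[OF y], of "{l..}"]
          norm_triangle_ineq[of "f (restr {m..<l} y)" "f (restr {l..} y)"] by simp
    qed
    then show "\<exists>N. \<forall>l\<ge>N. norm (f (restr {m..} y)) \<le> \<delta> * nrm y + K * nrm (restr {l..} y)"
      by blast
  qed
  then show ?thesis
    by blast
qed

end

section \<open>Reflexivity for finite exponents\<close>

lemma operators_zero:
  assumes "normed_space X" "normed_space Y" "T \<in> operators X Y"
  shows "T 0 = 0"
proof -
  have "T (0 + 0) = T 0 + T 0"
    using assms normed_spaceD(2)[OF assms(1)] unfolding operators_def by blast
  then show ?thesis
    by simp
qed

lemma operators_sum:
  assumes X: "normed_space X" and Y: "normed_space Y" and T: "T \<in> operators X Y"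
    and "finite S" "\<And>j. j \<in> S \<Longrightarrow> u j \<in> vcarrier X"
  shows "(\<Sum>j\<in>S. u j) \<in> vcarrier X \<and> T (\<Sum>j\<in>S. u j) = (\<Sum>j\<in>S. T (u j))"
  using assms(4,5)
proof (induction S rule: finite_induct)
  case empty
  then show ?case
    using operators_zero[OF X Y T] normed_spaceD(2)[OF X] by simp
next
  case (insert j S)
  then have "T (u j + (\<Sum>j\<in>S. u j)) = T (u j) + T (\<Sum>j\<in>S. u j)"
    using T unfolding operators_def by blast
  then show ?case
    using insert normed_spaceD(3)[OF X] by simp
qed

lemma normed_dual_space: "normed_space X \<Longrightarrow> normed_space (dual_space X)"
  unfolding dual_space_def by (rule normed_space_operator_space[OF _ normed_space_scalar])

lemma dual_space_simps [simp]:
  "vcarrier (dual_space X) = operators X scalar_space"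
  "vnorm (dual_space X) = operator_norm X scalar_space"
  "vscale (dual_space X) = (\<lambda>c f x. c * f x)"
  by (simp_all add: dual_space_def operator_space_def scalar_space_def)

lemma scalar_space_simps [simp]:
  "vcarrier scalar_space = UNIV" "vnorm scalar_space = norm" "vscale scalar_space = (*)"
  by (simp_all add: scalar_space_def)

lemma operator_norm_le:
  assumes "normed_space X" "\<And>x. x \<in> vcarrier X \<Longrightarrow> vnorm X x \<le> 1 \<Longrightarrow> vnorm Y (T x) \<le> M"
  shows "operator_norm X Y T \<le> M"
  unfolding operator_norm_def
proof (rule cSUP_least)
  show "{x \<in> vcarrier X. vnorm X x \<le> 1} \<noteq> {}"
    using normed_spaceD(2,10)[OF assms(1)] by (metis (mono_tags, lifting) empty_iff mem_Collect_eq zero_le_one)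
qed (use assms in auto)

definition unit_vec :: "nat \<Rightarrow> nat \<Rightarrow> 'k :: zero_neq_one"
  where "unit_vec i = (\<lambda>k. if k = i then 1 else 0)"

lemma unit_vec_apply: "unit_vec i k = (if k = i then 1 else 0)"
  by (simp add: unit_vec_def)

lemma supp_unit_vec [simp]: "supp (unit_vec i) = {i}"
  by (auto simp: supp_def unit_vec_def)

lemma restr_lessThan_eq_sum:
  "restr {..<m} x = (\<Sum>i<m. (\<lambda>k. x i * unit_vec i k))" for x :: "nat \<Rightarrow> 'k :: real_normed_field"
proof
  fix k
  have "(\<Sum>i<m. x i * unit_vec i k) = (\<Sum>i<m. if i = k then x i else 0)"
    by (intro sum.cong) (auto simp: unit_vec_def)
  then show "restr {..<m} x k = (\<Sum>i<m. (\<lambda>k. x i * unit_vec i k)) k"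
    by (simp add: sum_fun_apply restr_def)
qed

context exponent
begin

text \<open>Hoelder's inequality for the functional that norms \<open>s\<close>, whose coefficients are
  \<open>s j powr (q - 1)\<close> up to normalisation.\<close>

lemma holder:
  fixes s t :: "nat \<Rightarrow> real"
  assumes p: "p \<noteq> \<infinity>" and J: "finite J" "supp s \<subseteq> J" "supp t \<subseteq> J"
    and nonneg: "\<And>j. 0 \<le> s j" "\<And>j. 0 \<le> t j"
  shows "(\<Sum>j\<in>J. s j powr (q - 1) * t j) \<le> lp_norm p s powr (q - 1) * lp_norm p t"
proof -
  note q = q_gt_1[OF p]
  let ?A = "lp_norm p s" and ?B = "lp_norm p t"
  have fin: "finite (supp s)" "finite (supp t)"
    using J finite_subset by blast+
  have AB: "0 \<le> ?A" "0 \<le> ?B"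
    using fin by auto
  show ?thesis
  proof (cases "?A = 0 \<or> ?B = 0")
    case True
    then have "(\<forall>j. s j = 0) \<or> (\<forall>j. t j = 0)"
      using lp_norm_coord[OF fin(1)] lp_norm_coord[OF fin(2)] by force
    then have "(\<Sum>j\<in>J. s j powr (q - 1) * t j) = 0"
      by (intro sum.neutral) auto
    then show ?thesis
      using AB by simp
  next
    case False
    then have pos: "0 < ?A" "0 < ?B"
      using AB by auto
    have unit: "(\<Sum>j\<in>J. (s j / ?A) powr q) = 1" "(\<Sum>j\<in>J. (t j / ?B) powr q) = 1"
      using lp_norm_powr[OF p J(1,2)] lp_norm_powr[OF p J(1,3)] pos nonneg
      by (auto simp: powr_divide sum_divide_distrib[symmetric])
    let ?r = "q / (q - 1)"
    have r: "1 < ?r" "1 / ?r + 1 / q = 1"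
      using q by (auto simp: field_simps)
    have "(\<Sum>j\<in>J. (s j / ?A) powr (q - 1) * (t j / ?B)) \<le> (\<Sum>j\<in>J. (s j / ?A) powr q / ?r + (t j / ?B) powr q / q)"
    proof (rule sum_mono)
      fix j
      have "((s j / ?A) powr (q - 1)) powr ?r = (s j / ?A) powr q"
        using q by (simp add: powr_powr)
      then show "(s j / ?A) powr (q - 1) * (t j / ?B) \<le> (s j / ?A) powr q / ?r + (t j / ?B) powr q / q"
        using Youngs_inequality[OF r(1) q r(2), of "(s j / ?A) powr (q - 1)" "t j / ?B"] nonneg pos
        by simp
    qed
    also have "\<dots> = 1"
      unfolding sum.distrib sum_divide_distrib[symmetric] unit by (rule r(2))
    finally have "(\<Sum>j\<in>J. (s j / ?A) powr (q - 1) * (t j / ?B)) \<le> 1" .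
    moreover have "(\<Sum>j\<in>J. (s j / ?A) powr (q - 1) * (t j / ?B))
        = (\<Sum>j\<in>J. s j powr (q - 1) * t j) / (?A powr (q - 1) * ?B)"
      using nonneg pos by (simp add: sum_divide_distrib powr_divide)
    ultimately have "(\<Sum>j\<in>J. s j powr (q - 1) * t j) / (?A powr (q - 1) * ?B) \<le> 1"
      by simp
    then show ?thesis
      using pos by (simp add: divide_le_eq)
  qed
qed

text \<open>The unit vectors form a boundedly complete basis. Blocks beyond \<open>m\<close> can be appended to a
  packing that lives below \<open>m\<close>, and the \<open>p\<close>-th powers add up; so hardly anything is left beyond
  a nearly optimal packing.\<close>

lemma bounded_imp_finitary:
  assumes p: "p \<noteq> \<infinity>" and x: "bounded_seq x"
  shows "x \<in> finitary"
  unfolding finitary_def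
proof clarify
  fix \<epsilon> :: real assume \<epsilon>: "0 < \<epsilon>"
  note q = q_gt_1[OF p]
  let ?s = "\<lambda>F. packing_norm F x powr q"
  define \<sigma> where "\<sigma> = (SUP F\<in>Collect packing. ?s F)"
  have bdd: "bdd_above (?s ` Collect packing)"
    using packing_norm_le_nrm[OF x] q by (intro bdd_aboveI2[of _ _ "nrm x powr q"] powr_mono2) auto
  have ne: "Collect packing \<noteq> {}"
    using packing_one[OF admissible_empty] by blast
  have "\<sigma> - \<epsilon> powr q < \<sigma>"
    using \<epsilon> by simp
  then obtain F where F: "packing F" "\<sigma> - \<epsilon> powr q < ?s F"
    unfolding \<sigma>_def less_cSUP_iff[OF ne bdd] by blast
  obtain l where l: "\<And>j. l \<le> j \<Longrightarrow> F j = {}"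
    using packingD(3)[OF F(1)] unfolding finite_nat_iff_bounded by (metis (mono_tags) lessThan_iff mem_Collect_eq not_le subsetD)
  have "finite (\<Union>j<l. F j)"
    using packingD(1)[OF F(1)] by blast
  then obtain m where m: "(\<Union>j<l. F j) \<subseteq> {..<m}"
    using finite_nat_iff_bounded by blast
  have m: "i < m" if "i \<in> F j" for i j
    using m l[of j] that by (cases "j < l") auto
  have "packing_norm G (restr {m..} x) \<le> \<epsilon>" if G: "packing G" for G
  proof -
    obtain l' where l': "\<And>j. l' \<le> j \<Longrightarrow> G j = {}"
      using packingD(3)[OF G] unfolding finite_nat_iff_bounded by (metis (mono_tags) lessThan_iff mem_Collect_eq not_le subsetD)
    \<comment> \<open>\<open>F\<close> fills the positions below \<open>l\<close>; the part of \<open>G\<close> beyond \<open>m\<close> follows.\<close>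
    define H where "H = (\<lambda>j. if j < l then F j else G (j - l) \<inter> {m..})"
    have H: "packing H"
      unfolding packing_def
    proof (intro conjI allI)
      show "admissible (H j)" for j
        using F(1) G admissible_subset[of "G (j - l)"] by (auto simp: H_def packing_def)
      have "H j \<inter> H k = {}" if "j < k" for j k
      proof (cases "j < l")
        case True
        then show ?thesis
          using that F(1) m[of _ j] packingD(2)[OF F(1), of _ j k]
          by (auto simp: H_def) (metis leD)
      next
        case False
        then have "j - l \<noteq> k - l"
          using that by simp
        then show ?thesis
          using that False packingD(2)[OF G, of _ "j - l" "k - l"] by (auto simp: H_def)
      qed
      then show "disjoint_family H"
        unfolding disjoint_family_on_def by (metis Int_commute linorder_neqE_nat)
      have "H j = {}" if "l + l' \<le> j" for j
        using that l'[of "j - l"] by (simp add: H_def)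
      then have "{j. H j \<noteq> {}} \<subseteq> {..<l + l'}"
        using not_less by blast
      then show "finite {j. H j \<noteq> {}}"
        by (rule finite_subset) simp
    qed
    have sF: "?s F = (\<Sum>j<l. block_sums F x j powr q)"
    proof -
      have "supp (block_sums F x) \<subseteq> {..<l}"
        using l by (force simp: supp_def block_sums_def not_less[symmetric])
      then show ?thesis
        unfolding packing_norm_def by (subst lp_norm_powr[OF p]) auto
    qed
    have sG: "packing_norm G (restr {m..} x) powr q = (\<Sum>j<l'. block_sums G (restr {m..} x) j powr q)"
    proof -
      have "supp (block_sums G (restr {m..} x)) \<subseteq> {..<l'}"
        using l' by (force simp: supp_def block_sums_def not_less[symmetric])
      then show ?thesis
        unfolding packing_norm_def by (subst lp_norm_powr[OF p]) auto
    qed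
    have HF: "block_sums H x j = block_sums F x j" if "j < l" for j
      using that by (simp add: block_sums_def H_def)
    have HG: "block_sums H x (j + l) = block_sums G (restr {m..} x) j" for j
      using packingD(1)[OF G] unfolding block_sums_def H_def
      by (simp add: restr_def if_distrib sum.If_cases Int_def conj_commute cong: if_cong)
    have sH: "?s H = (\<Sum>j<l + l'. block_sums H x j powr q)"
    proof -
      have "block_sums H x j = 0" if "l + l' \<le> j" for j
        using that HG[of "j - l"] l'[of "j - l"] by (simp add: block_sums_def)
      then have "supp (block_sums H x) \<subseteq> {..<l + l'}"
        by (force simp: supp_def not_less[symmetric])
      then show ?thesis
        unfolding packing_norm_def by (subst lp_norm_powr[OF p]) auto
    qed
    have "(\<Sum>j<l + l'. block_sums H x j powr q) =
        (\<Sum>j<l. block_sums H x j powr q) + (\<Sum>j=0 + l..<l' + l. block_sums H x j powr q)"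
      using sum.atLeastLessThan_concat[of 0 l "l + l'" "\<lambda>j. block_sums H x j powr q"]
      by (simp add: lessThan_atLeast0 add.commute)
    also have "\<dots> = ?s F + packing_norm G (restr {m..} x) powr q"
      unfolding sF sG sum.shift_bounds_nat_ivl HG by (simp add: HF lessThan_atLeast0)
    finally have "?s F + packing_norm G (restr {m..} x) powr q = ?s H"
      by (simp add: sH)
    also have "\<dots> \<le> \<sigma>"
      unfolding \<sigma>_def using H by (intro cSUP_upper bdd) simp
    finally have "packing_norm G (restr {m..} x) powr q < \<epsilon> powr q"
      using F(2) by simp
    then show ?thesis
      using powr_less_cancel2[of q "packing_norm G (restr {m..} x)" \<epsilon>] powr_mono2[of q \<epsilon> "packing_norm G (restr {m..} x)"] q \<epsilon>
      by linarith
  qed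
  then show "\<exists>m. \<forall>F. packing F \<longrightarrow> packing_norm F (restr {m..} x) \<le> \<epsilon>"
    by blast
qed

definition coord :: "nat \<Rightarrow> (nat \<Rightarrow> 'k :: {real_normed_field, banach}) \<Rightarrow> 'k"
  where "coord i y = (if y \<in> finitary then y i else 0)"

lemma dualI:
  assumes "\<And>x. x \<notin> finitary \<Longrightarrow> f x = 0"
    and "\<And>x y. x \<in> finitary \<Longrightarrow> y \<in> finitary \<Longrightarrow> f (x + y) = f x + f y"
    and "\<And>c x. x \<in> finitary \<Longrightarrow> f (\<lambda>i. c * x i) = c * f x"
    and "\<And>x. x \<in> finitary \<Longrightarrow> norm (f x) \<le> K * nrm x"
  shows "f \<in> dual"
  using assms by (auto simp: operators_def intro!: exI[of _ K])

lemma coord_dual: "coord i \<in> dual"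
  using coord_le_nrm[OF finitary_bounded]
  by (intro dualI[where K = 1]) (auto simp: coord_def finitary_add finitary_scale)

lemma dual_scale: "f \<in> dual \<Longrightarrow> (\<lambda>y. c * f y) \<in> dual"
  using normed_spaceD(5)[OF normed_dual_space[OF normed_packing_space], of f c] by simp

context
  fixes \<phi> :: "((nat \<Rightarrow> 'k :: {real_normed_field, banach}) \<Rightarrow> 'k) \<Rightarrow> 'k" and K :: real
  assumes \<phi>: "\<phi> \<in> operators (dual_space packing_space) scalar_space"
    and K: "0 \<le> K" "\<And>f. f \<in> dual \<Longrightarrow> norm (\<phi> f) \<le> K * operator_norm packing_space scalar_space f"
begin

lemma bidual_scale: "f \<in> dual \<Longrightarrow> \<phi> (\<lambda>y. c * f y) = c * \<phi> f"
  using \<phi> by (auto simp: operators_def)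

lemma bidual_add: "f \<in> dual \<Longrightarrow> g \<in> dual \<Longrightarrow> \<phi> (f + g) = \<phi> f + \<phi> g"
  using \<phi> unfolding operators_def[of "dual_space packing_space"] by simp

lemma bidual_sum:
  assumes "finite S" "\<And>j. j \<in> S \<Longrightarrow> u j \<in> dual"
  shows "(\<Sum>j\<in>S. u j) \<in> dual" "\<phi> (\<Sum>j\<in>S. u j) = (\<Sum>j\<in>S. \<phi> (u j))"
  using operators_sum[OF normed_dual_space[OF normed_packing_space] normed_space_scalar \<phi> assms(1), of u] assms(2)
  by simp_all

text \<open>The functional \<open>g\<close> of the proof norms, as far as \<open>F\<close> can see, the sequence of the
  \<open>\<phi> (coord i)\<close>: its value at that sequence, which is \<open>\<phi> g\<close>, is the \<open>p\<close>-th power of the packing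
  norm, while \<open>holder\<close> bounds the norm of \<open>g\<close> by the \<open>(p-1)\<close>-st power.\<close>

lemma packing_norm_bidual_le:
  assumes p: "p \<noteq> \<infinity>" and F: "packing F"
  shows "packing_norm F (\<lambda>i. \<phi> (coord i)) \<le> K"
proof -
  note q = q_gt_1[OF p]
  let ?x = "\<lambda>i. \<phi> (coord i)"
  let ?S = "packing_norm F ?x"
  let ?J = "{j. F j \<noteq> {}}"
  let ?s = "block_sums F ?x"
  define \<sigma> where "\<sigma> = (\<lambda>i. of_real (norm (?x i)) / ?x i)"
  have \<sigma>: "\<sigma> i * ?x i = of_real (norm (?x i))" "norm (\<sigma> i) \<le> 1" for i
    by (auto simp: \<sigma>_def norm_divide)
  define a where "a = (\<lambda>j i. of_real (?s j powr (q - 1)) * \<sigma> i)"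
  define g where "g = (\<Sum>j\<in>?J. \<Sum>i\<in>F j. (\<lambda>y. a j i * coord i y))"
  have J: "finite ?J"
    by (rule packingD(3)[OF F])
  have in_dual: "(\<lambda>y. a j i * coord i y) \<in> dual" for j i
    by (intro dual_scale coord_dual)
  have inner: "(\<Sum>i\<in>F j. (\<lambda>y. a j i * coord i y)) \<in> dual"
    "\<phi> (\<Sum>i\<in>F j. (\<lambda>y. a j i * coord i y)) = (\<Sum>i\<in>F j. a j i * ?x i)" for j
    using bidual_sum[OF packingD(1)[OF F], of j "\<lambda>i y. a j i * coord i y", OF in_dual]
    by (simp_all add: bidual_scale[OF coord_dual])
  have g: "g \<in> dual"
    unfolding g_def by (rule bidual_sum(1)[OF J inner(1)])
  have "\<phi> g = (\<Sum>j\<in>?J. \<Sum>i\<in>F j. a j i * ?x i)"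
    unfolding g_def by (subst bidual_sum(2)[OF J inner(1)]) (simp add: inner(2))
  also have "\<dots> = (\<Sum>j\<in>?J. of_real (?s j powr q))"
  proof (rule sum.cong)
    fix j
    have "(\<Sum>i\<in>F j. a j i * ?x i) = (\<Sum>i\<in>F j. of_real (?s j powr (q - 1)) * of_real (norm (?x i)))"
      by (intro sum.cong) (simp_all add: a_def mult.assoc \<sigma>(1))
    also have "\<dots> = of_real (?s j powr (q - 1) * ?s j)"
      by (simp add: block_sums_def sum_distrib_left)
    also have "?s j powr (q - 1) * ?s j = ?s j powr q"
      by (cases "?s j = 0") (simp_all add: powr_mult_base[symmetric] mult.commute powr_diff)
    finally show "(\<Sum>i\<in>F j. a j i * ?x i) = of_real (?s j powr q)" .
  qed simp
  also have "\<dots> = of_real (?S powr q)"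
    unfolding packing_norm_def
    using lp_norm_powr[OF p J, of ?s] supp_block_sums[of F ?x] by simp
  finally have \<phi>g: "\<phi> g = of_real (?S powr q)" .
  have g_le: "norm (g y) \<le> ?S powr (q - 1) * nrm y" if y: "y \<in> finitary" for y :: "nat \<Rightarrow> 'k"
  proof -
    have "g y = (\<Sum>j\<in>?J. \<Sum>i\<in>F j. a j i * y i)"
      unfolding g_def sum_fun_apply coord_def using y by simp
    also have "norm \<dots> \<le> (\<Sum>j\<in>?J. \<Sum>i\<in>F j. norm (a j i * y i))"
      by (intro order_trans[OF norm_sum] sum_mono norm_sum)
    also have "\<dots> \<le> (\<Sum>j\<in>?J. \<Sum>i\<in>F j. ?s j powr (q - 1) * norm (y i))"
    proof (intro sum_mono)
      fix j i
      have "norm (a j i * y i) = ?s j powr (q - 1) * norm (y i) * norm (\<sigma> i)"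
        by (simp add: a_def norm_mult)
      also have "\<dots> \<le> ?s j powr (q - 1) * norm (y i) * 1"
        by (intro mult_left_mono \<sigma>) simp
      finally show "norm (a j i * y i) \<le> ?s j powr (q - 1) * norm (y i)"
        by simp
    qed
    also have "\<dots> = (\<Sum>j\<in>?J. ?s j powr (q - 1) * block_sums F y j)"
      by (simp add: block_sums_def sum_distrib_left)
    also have "\<dots> \<le> ?S powr (q - 1) * packing_norm F y"
      unfolding packing_norm_def
      by (rule holder[OF p J supp_block_sums supp_block_sums]) simp_all
    also have "\<dots> \<le> ?S powr (q - 1) * nrm y"
      by (intro mult_left_mono packing_norm_le_nrm[OF finitary_bounded[OF y] F]) simp
    finally show ?thesis .
  qed
  have "?S powr q \<le> K * operator_norm packing_space scalar_space g"
    using K(2)[OF g] by (simp add: \<phi>g)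
  also have "\<dots> \<le> K * ?S powr (q - 1)"
  proof (intro mult_left_mono K operator_norm_le[OF normed_packing_space])
    fix y :: "nat \<Rightarrow> 'k" assume "y \<in> vcarrier packing_space" "vnorm packing_space y \<le> 1"
    then have y: "y \<in> finitary" "nrm y \<le> 1"
      by auto
    have "?S powr (q - 1) * nrm y \<le> ?S powr (q - 1) * 1"
      using y by (intro mult_left_mono) auto
    then show "vnorm scalar_space (g y) \<le> ?S powr (q - 1)"
      using g_le[OF y(1)] by simp
  qed
  finally have le: "?S powr q \<le> K * ?S powr (q - 1)" .
  show ?thesis
  proof (cases "?S = 0")
    case True
    then show ?thesis
      using K by simp
  next
    case False
    then have pos: "0 < ?S"
      using packing_norm_nonneg[OF F, of ?x] by simp
    then have "?S powr q = ?S * ?S powr (q - 1)"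
      by (simp add: powr_mult_base)
    then show ?thesis
      using le pos by simp
  qed
qed

text \<open>Both sides agree on the span of the coordinate functionals, and this span is norm dense in the
  dual because functionals are small on tails.\<close>

lemma bidual_eq_evaluation:
  assumes x: "(\<lambda>i. \<phi> (coord i)) \<in> finitary" and f: "f \<in> dual"
  shows "\<phi> f = f (\<lambda>i. \<phi> (coord i))"
proof -
  let ?x = "\<lambda>i. \<phi> (coord i)"
  have "norm (\<phi> f - f ?x) \<le> \<delta>" if \<delta>: "0 < \<delta>" for \<delta>
  proof -
    define \<eta> where "\<eta> = \<delta> / (K + nrm ?x + 1)"
    have den: "0 < K + nrm ?x + 1"
      using K(1) nrm_nonneg[OF finitary_bounded[OF x]] by simp
    then have "0 < \<eta>"
      using \<delta> by (simp add: \<eta>_def)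
    then obtain m where m: "\<And>y. y \<in> finitary \<Longrightarrow> norm (f (restr {m..} y)) \<le> \<eta> * nrm y"
      using functional_small_on_tails[OF f] by blast
    \<comment> \<open>The composition of \<open>f\<close> with the restriction to the first \<open>m\<close> coordinates.\<close>
    let ?h = "\<Sum>i<m. (\<lambda>y. f (unit_vec i) * coord i y)"
    have h: "?h \<in> dual" "\<phi> ?h = (\<Sum>i<m. f (unit_vec i) * ?x i)"
      using bidual_sum[of "{..<m}" "\<lambda>i y. f (unit_vec i) * coord i y"]
      by (simp_all add: dual_scale coord_dual bidual_scale[OF coord_dual])
    have f_head: "f (restr {..<m} y) = (\<Sum>i<m. f (unit_vec i) * y i)" for y
    proof -
      have u: "unit_vec i \<in> finitary" for i
        by (simp add: finitary_finite)
      have "f (restr {..<m} y) = (\<Sum>i<m. f (\<lambda>k. y i * unit_vec i k))"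
        unfolding restr_lessThan_eq_sum by (intro dual_sum[OF f] finitary_scale(1) u) simp
      then show ?thesis
        by (simp add: dualD(2)[OF f u] mult.commute)
    qed
    have split: "f y = f (restr {..<m} y) + f (restr {m..} y)" if "y \<in> finitary" for y
    proof -
      have "restr {..<m} y + restr {m..} y = y"
        by (auto simp: fun_eq_iff restr_def)
      then show ?thesis
        using dualD(1)[OF f finitary_restr(1)[OF that] finitary_restr(1)[OF that], of "{..<m}" "{m..}"] by simp
    qed
    have h_eq: "?h y = f (restr {..<m} y)" if "y \<in> finitary" for y
      using that by (simp add: sum_fun_apply f_head coord_def)
    have diff: "f - ?h \<in> dual"
      using normed_spaceD(4)[OF normed_dual_space[OF normed_packing_space], of f ?h] f h(1) by simp
    have "\<phi> ((f - ?h) + ?h) = \<phi> (f - ?h) + \<phi> ?h"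
      by (rule bidual_add[OF diff h(1)])
    then have "\<phi> f = \<phi> (f - ?h) + f (restr {..<m} ?x)"
      by (simp add: h(2) f_head)
    then have "norm (\<phi> f - f ?x) = norm (\<phi> (f - ?h) - f (restr {m..} ?x))"
      using split[OF x] by simp
    also have "\<dots> \<le> norm (\<phi> (f - ?h)) + norm (f (restr {m..} ?x))"
      by (rule norm_triangle_ineq4)
    also have "norm (\<phi> (f - ?h)) \<le> K * \<eta>"
    proof (rule order_trans[OF K(2)[OF diff]], intro mult_left_mono K operator_norm_le[OF normed_packing_space])
      fix y :: "nat \<Rightarrow> 'k" assume "y \<in> vcarrier packing_space" "vnorm packing_space y \<le> 1"
      then have y: "y \<in> finitary" "nrm y \<le> 1"
        by auto
      have "(f - ?h) y = f (restr {m..} y)"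
        using split[OF y(1)] h_eq[OF y(1)] by simp
      moreover have "\<eta> * nrm y \<le> \<eta> * 1"
        using y \<open>0 < \<eta>\<close> by (intro mult_left_mono) auto
      ultimately show "vnorm scalar_space ((f - ?h) y) \<le> \<eta>"
        using m[OF y(1)] by simp
    qed
    also have "norm (f (restr {m..} ?x)) \<le> \<eta> * nrm ?x"
      by (rule m[OF x])
    also have "K * \<eta> + \<eta> * nrm ?x \<le> \<eta> * (K + nrm ?x + 1)"
      using \<open>0 < \<eta>\<close> by (simp add: distrib_left mult.commute)
    also have "\<dots> = \<delta>"
      using den by (simp add: \<eta>_def)
    finally show ?thesis
      by simp
  qed
  then have "norm (\<phi> f - f ?x) \<le> 0"
    by (rule field_le_epsilon) simp
  then show ?thesis
    by simp
qed

end

theorem reflexive_packing_space: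
  assumes p: "p \<noteq> \<infinity>"
  shows "reflexive_space (packing_space :: ('k :: {real_normed_field, banach}, _) nspace)"
proof -
  let ?X = "packing_space :: ('k, _) nspace"
  note dual_normed = normed_dual_space[OF normed_packing_space]
  have "canonical_embedding ?X x \<in> operators (dual_space ?X) scalar_space" if x: "x \<in> finitary" for x
  proof -
    have "norm (f x) \<le> nrm x * operator_norm ?X scalar_space f" if "f \<in> dual" for f
      using operator_norm_bound(2)[OF normed_packing_space normed_space_scalar that, of x] x
      by (simp add: mult.commute)
    moreover have "f + g \<in> dual" if "f \<in> dual" "g \<in> dual" for f g :: "(nat \<Rightarrow> 'k) \<Rightarrow> 'k"
      using normed_spaceD(3)[OF dual_normed, of f g] that by simp
    ultimately show ?thesis
      unfolding operators_def[of "dual_space ?X"]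
      by (auto simp: canonical_embedding_def dual_scale intro!: exI[of _ "nrm x"])
  qed
  moreover have "\<phi> \<in> canonical_embedding ?X ` finitary"
    if \<phi>: "\<phi> \<in> operators (dual_space ?X) scalar_space" for \<phi>
  proof -
    obtain K0 where "\<forall>f\<in>dual. norm (\<phi> f) \<le> K0 * operator_norm ?X scalar_space f"
      using \<phi> by (auto simp: operators_def[of "dual_space ?X"])
    then have K: "norm (\<phi> f) \<le> \<bar>K0\<bar> * operator_norm ?X scalar_space f" if "f \<in> dual" for f
      using normed_spaceD(6)[OF dual_normed, of f] that
      by (simp, meson abs_ge_self mult_right_mono order_trans)
    let ?x = "\<lambda>i. \<phi> (coord i)"
    have "bounded_seq ?x"
      unfolding bounded_seq_def using packing_norm_bidual_le[OF \<phi> abs_ge_zero K p] by blast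
    then have x: "?x \<in> finitary"
      by (rule bounded_imp_finitary[OF p])
    have "\<phi> f = canonical_embedding ?X ?x f" for f
    proof (cases "f \<in> dual")
      case True
      then show ?thesis
        using bidual_eq_evaluation[OF \<phi> abs_ge_zero K x True] by (simp add: canonical_embedding_def)
    next
      case False
      then show ?thesis
        using \<phi> by (auto simp: canonical_embedding_def operators_def[of "dual_space ?X"])
    qed
    then have "\<phi> = canonical_embedding ?X ?x"
      by (rule ext)
    then show ?thesis
      using x by blast
  qed
  ultimately show ?thesis
    unfolding reflexive_space_def by auto
qed

end

section \<open>Intervals in the Schreier families\<close>

text \<open>At a limit stage a set enters through a member \<open>z \<zeta> n\<close> of the fundamental sequence only if it
  lies above \<open>n\<close>. As \<open>z \<zeta> 1\<close> may be \<open>0\<close>, the first index that can be relied on is \<open>n = 2\<close>.\<close>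

lemma schreier_one_subset:
  assumes z: "fundamental_sequences z" and F: "F \<in> schreier_one" "\<forall>m\<in>F. 2 \<le> m"
  shows "1 \<le> \<zeta> \<Longrightarrow> in_schreier z \<zeta> F"
proof (induction \<zeta> rule: less_induct)
  case (less \<zeta>)
  show ?case
  proof (cases "\<zeta> = 1")
    case True
    then show ?thesis
      using F(1) by (simp add: in_schreier.one)
  next
    case not_one: False
    have "\<zeta> \<noteq> 0"
      using less.prems by (simp add: countable_ordinal_one_le_iff)
    then consider "limit_ordinal \<zeta>" | \<eta> where "\<zeta> = ord_succ \<eta>"
      unfolding limit_ordinal_def by blast
    then show ?thesis
    proof cases
      case 1
      have mono: "strict_mono_on {1..} (z \<zeta>)" and "z \<zeta> 3 \<le> \<zeta>"
        using z 1 unfolding fundamental_sequences_def by auto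
      have "z \<zeta> 1 < z \<zeta> 2" "z \<zeta> 2 < z \<zeta> 3"
        using strict_mono_onD[OF mono] by simp_all
      then have "1 \<le> z \<zeta> 2" "z \<zeta> 2 < \<zeta>"
        using \<open>z \<zeta> 3 \<le> \<zeta>\<close> countable_ordinal_zero_le[of "z \<zeta> 1"]
        by (auto simp: countable_ordinal_one_le_iff simp del: countable_ordinal_zero_le)
      then have "in_schreier z (z \<zeta> 2) F"
        by (intro less.IH)
      then show ?thesis
        using F(2) by (intro in_schreier.limit[OF 1, of 2]) auto
    next
      case 2
      have "\<eta> \<noteq> 0"
        using not_one 2 by (auto simp: one_countable_ordinal_def)
      then have \<eta>: "1 \<le> \<eta>" "\<eta> < \<zeta>"
        using 2 by (simp_all only: countable_ordinal_one_le_iff less_ord_succ not_False_eq_True)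
      then have IH: "in_schreier z \<eta> F"
        by (intro less.IH)
      show ?thesis
      proof (cases "F = {}")
        case True
        then show ?thesis
          using in_schreier.succ_empty[OF \<eta>(1)] 2 by simp
      next
        case False
        have "finite F"
          using F(1) by (auto simp: schreier_one_def)
        then have "2 \<le> Min F"
          using F(2) False by simp
        then have "{Min F} \<in> schreier_one"
          by (simp add: schreier_one_def)
        then show ?thesis
          using in_schreier.succ_union[OF \<eta>(1), of 1 "\<lambda>_. F" z] IH False 2 by simp
      qed
    qed
  qed
qed

lemma schreier_interval:
  assumes z: "fundamental_sequences z" and "1 \<le> \<xi>" "2 \<le> n"
  shows "{n..<2 * n} \<in> schreier z \<xi>"
proof (cases \<xi>)
  case (Ctbl \<zeta>)
  have "{n..<2 * n} \<in> schreier_one"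
    using assms(3) Min_eqI[of "{n..<2 * n}" n] by (auto simp: schreier_one_def)
  moreover have "1 \<le> \<zeta>"
    using assms(2) Ctbl by (simp add: one_ordinal_upto_omega1_def)
  ultimately show ?thesis
    using schreier_one_subset[OF z, of "{n..<2 * n}" \<zeta>] assms(3) by (simp add: schreier_def Ctbl)
next
  case Omega1
  then show ?thesis
    using assms(3) by (simp add: schreier_def)
qed

section \<open>Diagonal operators\<close>

context exponent
begin

definition diag :: "(nat \<Rightarrow> real) \<Rightarrow> (nat \<Rightarrow> 'k :: {real_normed_field, banach}) \<Rightarrow> nat \<Rightarrow> 'k"
  where "diag d x = (if x \<in> finitary then (\<lambda>i. of_real (d i) * x i) else 0)"

lemma diag_finitary:
  assumes "\<And>i. \<bar>d i\<bar> \<le> A" "x \<in> finitary"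
  shows "diag d x \<in> finitary" "nrm (diag d x) \<le> A * nrm x"
  using finitary_dominated[OF assms(2), of "diag d x" A] assms
  by (auto simp: diag_def norm_mult mult_right_mono)

lemma diag_operator:
  assumes "\<And>i. \<bar>d i\<bar> \<le> A"
  shows "diag d \<in> operators packing_space packing_space"
proof -
  have "diag d (x + y) = diag d x + diag d y" if "x \<in> finitary" "y \<in> finitary" for x y
    using that finitary_add(1)[OF that] by (simp add: diag_def fun_eq_iff algebra_simps)
  moreover have "diag d (\<lambda>i. c * x i) = (\<lambda>i. c * diag d x i)" if "x \<in> finitary" for c x
    using that finitary_scale(1)[OF that] by (simp add: diag_def fun_eq_iff algebra_simps)
  moreover have "diag d x = 0" if "x \<notin> finitary" for x
    using that by (simp add: diag_def)
  ultimately show ?thesis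
    using diag_finitary[of d A, OF assms] by (auto simp: operators_def intro!: exI[of _ A])
qed

lemma diag_dist:
  assumes "\<And>i. \<bar>d i - e i\<bar> \<le> B" "0 \<le> B"
  shows "operator_norm packing_space packing_space
    (diag d - diag e :: (nat \<Rightarrow> 'k :: {real_normed_field, banach}) \<Rightarrow> _) \<le> B"
proof (rule operator_norm_le[OF normed_packing_space])
  fix x :: "nat \<Rightarrow> 'k" assume "x \<in> vcarrier packing_space" "vnorm packing_space x \<le> 1"
  then have x: "x \<in> finitary" "nrm x \<le> 1"
    by auto
  have "(diag d - diag e) x = diag (\<lambda>i. d i - e i) x"
    using x by (simp add: diag_def fun_eq_iff left_diff_distrib)
  then have "nrm ((diag d - diag e) x) \<le> B * nrm x"
    using diag_finitary(2)[of "\<lambda>i. d i - e i" B, OF assms(1) x(1)] by simp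
  also have "\<dots> \<le> B * 1"
    using x assms(2) by (intro mult_left_mono)
  finally show "vnorm packing_space ((diag d - diag e) x) \<le> B"
    by simp
qed

lemma nrm_sum_le:
  fixes u :: "'i \<Rightarrow> nat \<Rightarrow> 'k :: {real_normed_field, banach}"
  assumes "finite S" "\<And>j. j \<in> S \<Longrightarrow> u j \<in> finitary"
  shows "nrm (\<Sum>j\<in>S. u j) \<le> (\<Sum>j\<in>S. nrm (u j))"
  using assms
proof (induction S rule: finite_induct)
  case empty
  show ?case
    by (simp only: sum.empty nrm_zero order_refl)
next
  case (insert j S)
  have "nrm (u j + (\<Sum>j\<in>S. u j)) \<le> nrm (u j) + nrm (\<Sum>j\<in>S. u j)"
    by (intro finitary_add(2) finitary_sum insert) simp_all
  also have "nrm (\<Sum>j\<in>S. u j) \<le> (\<Sum>j\<in>S. nrm (u j))"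
    by (intro insert) simp_all
  finally show ?case
    by (simp only: sum.insert[OF insert(1,2)])
qed

lemma head_tendsto_0:
  assumes "\<And>i. (\<lambda>n. x n i) \<longlonglongrightarrow> 0"
  shows "(\<lambda>n. nrm (restr {..<m} (x n))) \<longlonglongrightarrow> 0"
proof (rule tendsto_sandwich[OF _ _ tendsto_const])
  show "(\<lambda>n. \<Sum>i<m. norm (x n i)) \<longlonglongrightarrow> 0"
    using tendsto_sum[of "{..<m}" "\<lambda>i n. norm (x n i)" "\<lambda>_. 0"] assms by (simp add: tendsto_norm_zero)
  have "nrm (restr {..<m} (x n)) \<le> (\<Sum>i<m. norm (x n i))" for n
  proof (rule nrm_le)
    fix F assume "packing F"
    then have "packing_norm F (restr {..<m} (x n)) \<le> (\<Sum>i<m. norm (restr {..<m} (x n) i))"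
      by (rule packing_norm_le_sum) auto
    then show "packing_norm F (restr {..<m} (x n)) \<le> (\<Sum>i<m. norm (x n i))"
      by (simp add: restr_def)
  qed
  then show "\<forall>\<^sub>F n in sequentially. nrm (restr {..<m} (x n)) \<le> (\<Sum>i<m. norm (x n i))"
    by simp
  show "\<forall>\<^sub>F n in sequentially. 0 \<le> nrm (restr {..<m} (x n))"
    by (simp add: nrm_nonneg bounded_seq_finite)
qed

text \<open>Each vector of the subsequence is, up to a summable error, supported in an interval of its
  own: the head is small because the coordinates tend to \<open>0\<close>, the tail because the vector is in
  the closed span of the unit vectors.\<close>

lemma gliding_hump:
  fixes x :: "nat \<Rightarrow> nat \<Rightarrow> 'k :: {real_normed_field, banach}"
  assumes x: "\<And>n. 1 \<le> n \<Longrightarrow> x n \<in> finitary" and coord: "\<And>i. (\<lambda>n. x n i) \<longlonglongrightarrow> 0"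
  obtains r m :: "nat \<Rightarrow> nat" where "strict_mono r" "mono m" "\<And>k. 1 \<le> r k"
    "\<And>k. nrm (restr (- {m k..<m (Suc k)}) (x (r k))) \<le> (1/2) ^ k"
proof -
  let ?Q = "\<lambda>k s s'. fst s < fst s' \<and> snd s \<le> snd s' \<and>
    nrm (restr (- {snd s..<snd s'}) (x (fst s'))) \<le> (1/2 :: real) ^ k"
  have step: "\<exists>s'. True \<and> ?Q k s s'" for k and s :: "nat \<times> nat"
  proof -
    have e: "0 < (1/2 :: real) ^ k / 2"
      by simp
    have "\<forall>\<^sub>F n in sequentially. nrm (restr {..<snd s} (x n)) < (1/2) ^ k / 2"
      using order_tendstoD(2)[OF head_tendsto_0[OF coord] e] .
    then have "\<forall>\<^sub>F n in sequentially. nrm (restr {..<snd s} (x n)) < (1/2) ^ k / 2 \<and> fst s < n"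
      by (intro eventually_conj eventually_gt_at_top)
    then obtain n where n: "nrm (restr {..<snd s} (x n)) < (1/2) ^ k / 2" "fst s < n"
      unfolding eventually_sequentially by blast
    have xn: "x n \<in> finitary"
      using n(2) by (intro x) simp
    have "\<forall>\<^sub>F l in sequentially. nrm (restr {l..} (x n)) < (1/2) ^ k / 2 \<and> snd s \<le> l"
      by (intro eventually_conj eventually_ge_at_top order_tendstoD(2)[OF tail_tendsto_0[OF xn] e])
    then obtain l where l: "nrm (restr {l..} (x n)) < (1/2) ^ k / 2" "snd s \<le> l"
      unfolding eventually_sequentially by blast
    have "restr (- {snd s..<l}) (x n) = restr {..<snd s} (x n) + restr {l..} (x n)"
      using l(2) by (auto simp: restr_def fun_eq_iff)
    then have "nrm (restr (- {snd s..<l}) (x n)) \<le> nrm (restr {..<snd s} (x n)) + nrm (restr {l..} (x n))"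
      by (simp add: finitary_add(2) finitary_restr(1) xn)
    also have "\<dots> \<le> (1/2) ^ k"
      using n(1) l(1) by simp
    finally show ?thesis
      using n(2) l(2) by (intro exI[of _ "(n, l)"]) simp
  qed
  obtain s where s: "\<And>k. ?Q k (s k) (s (Suc k))"
    using dependent_nat_choice[of "\<lambda>_ _. True" ?Q] step by blast
  show ?thesis
  proof
    show "strict_mono (\<lambda>k. fst (s (Suc k)))"
      using s by (simp add: strict_mono_Suc_iff)
    show "mono (\<lambda>k. snd (s k))"
      using s by (simp add: mono_iff_le_Suc)
    show "1 \<le> fst (s (Suc k))" for k
      using s[of k] by simp
    show "nrm (restr (- {snd (s k)..<snd (s (Suc k))}) (x (fst (s (Suc k))))) \<le> (1/2) ^ k" for k
      using s[of k] by simp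
  qed
qed

text \<open>The range of the operator lies in finitely many colors. There the disjoint parts found by the
  gliding hump satisfy an upper \<open>p\<close>-estimate with constant \<open>N\<close>, and the errors add \<open>2\<close>, a
  geometric sum. The bound holds for all finitely supported coefficients, hence for every \<open>\<xi>\<close>.\<close>

lemma truncated_diag_WD:
  fixes d :: "nat \<Rightarrow> real"
  assumes d: "\<And>i. \<bar>d i\<bar> \<le> 1" "\<And>i. N < color i \<Longrightarrow> d i = 0"
  shows "(diag d :: (nat \<Rightarrow> 'k :: {real_normed_field, banach}) \<Rightarrow> _)
    \<in> WD_infinity z p \<xi> packing_space packing_space"
proof -
  let ?T = "diag d :: (nat \<Rightarrow> 'k) \<Rightarrow> _"
  have T: "?T \<in> operators packing_space packing_space"
    using d(1) by (rule diag_operator)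
  have "?T \<in> WD z p (real N + 2) \<xi> packing_space packing_space"
    unfolding WD_def
  proof (intro CollectI conjI T allI impI)
    fix \<epsilon> :: real and x :: "nat \<Rightarrow> nat \<Rightarrow> 'k"
    assume \<epsilon>: "0 < \<epsilon>" and "normalized packing_space x \<and> weakly_null packing_space x"
    then have x: "\<And>n. 1 \<le> n \<Longrightarrow> x n \<in> finitary" "\<And>n. 1 \<le> n \<Longrightarrow> nrm (x n) = 1"
      and wn: "\<And>f. f \<in> dual \<Longrightarrow> (\<lambda>n. f (x n)) \<longlonglongrightarrow> 0"
      by (auto simp: normalized_def weakly_null_def)
    have "(\<lambda>n. x n i) \<longlonglongrightarrow> 0" for i
    proof (rule Lim_transform_eventually[OF wn[OF coord_dual[of i]]])
      show "\<forall>\<^sub>F n in sequentially. coord i (x n) = x n i"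
        using x(1) unfolding eventually_sequentially by (intro exI[of _ 1]) (simp add: coord_def)
    qed
    then obtain r m :: "nat \<Rightarrow> nat" where r: "strict_mono r" "\<And>k. 1 \<le> r k" and m: "mono m"
      and small: "\<And>k. nrm (restr (- {m k..<m (Suc k)}) (x (r k))) \<le> (1/2) ^ k"
      using gliding_hump[of x] x(1) by metis
    have "nrm (\<Sum>k\<in>supp \<alpha>. (\<lambda>i. \<alpha> k * ?T (x (r k)) i)) \<le> (real N + 2) * lp_norm p \<alpha>"
      if \<alpha>: "finite (supp \<alpha>)" for \<alpha>
    proof -
      let ?I = "\<lambda>k. {m k..<m (Suc k)}"
      let ?y = "\<lambda>k. ?T (x (r k))"
      let ?u = "\<lambda>k. restr (?I k) (?y k)" and ?v = "\<lambda>k. restr (- ?I k) (?y k)"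
      have y: "?y k \<in> finitary" for k
        using diag_finitary(1)[of d 1, OF d(1) x(1)[OF r(2)]] .
      have "(\<Sum>k\<in>supp \<alpha>. (\<lambda>i. \<alpha> k * ?y k i)) =
          (\<lambda>i. \<Sum>k\<in>supp \<alpha>. \<alpha> k * ?u k i) + (\<Sum>k\<in>supp \<alpha>. (\<lambda>i. \<alpha> k * ?v k i))"
      proof
        fix i
        have "\<alpha> k * ?y k i = \<alpha> k * ?u k i + \<alpha> k * ?v k i" for k
          by (simp add: restr_def)
        then show "(\<Sum>k\<in>supp \<alpha>. (\<lambda>i. \<alpha> k * ?y k i)) i =
            ((\<lambda>i. \<Sum>k\<in>supp \<alpha>. \<alpha> k * ?u k i) + (\<Sum>k\<in>supp \<alpha>. (\<lambda>i. \<alpha> k * ?v k i))) i"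
          by (simp only: sum_fun_apply plus_fun_apply sum.distrib)
      qed
      moreover have "(\<lambda>i. \<Sum>k\<in>supp \<alpha>. \<alpha> k * ?u k i) \<in> finitary"
        by (intro finitary_finite finite_supp_sum \<alpha>) simp
      moreover have v: "(\<lambda>i. \<alpha> k * ?v k i) \<in> finitary" for k
        by (intro finitary_scale(1) finitary_restr(1) y)
      ultimately have "nrm (\<Sum>k\<in>supp \<alpha>. (\<lambda>i. \<alpha> k * ?y k i)) \<le>
          nrm (\<lambda>i. \<Sum>k\<in>supp \<alpha>. \<alpha> k * ?u k i) + nrm (\<Sum>k\<in>supp \<alpha>. (\<lambda>i. \<alpha> k * ?v k i))"
        using finitary_add(2) finitary_sum[OF \<alpha>, of "\<lambda>k i. \<alpha> k * ?v k i"] by simp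
      also have "nrm (\<lambda>i. \<Sum>k\<in>supp \<alpha>. \<alpha> k * ?u k i) \<le> real N * lp_norm p \<alpha>"
      proof (rule nrm_disjoint_sum_le[OF \<alpha>])
        fix k
        show "finite (supp (?u k))"
          by simp
        have "nrm (?u k) \<le> nrm (?y k)"
          by (rule finitary_restr(2)[OF y])
        then show "nrm (?u k) \<le> 1"
          using diag_finitary(2)[of d 1, OF d(1) x(1)[OF r(2)], of k] x(2)[OF r(2), of k] by simp
        show "color i \<le> N" if "i \<in> supp (?u k)" for i
        proof (rule ccontr)
          assume "\<not> color i \<le> N"
          then have "?y k i = 0"
            using d(2)[of i] x(1)[OF r(2), of k] by (simp add: diag_def)
          then show False
            using that by (simp add: supp_def restr_def split: if_splits)
        qed
      next
        fix k l i assume "i \<in> supp (?u k)" "i \<in> supp (?u l)"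
        then have i: "i \<in> ?I k" "i \<in> ?I l"
          by auto
        show "k = l"
        proof (rule ccontr)
          assume "k \<noteq> l"
          then have "m (Suc k) \<le> m l \<or> m (Suc l) \<le> m k"
            using monoD[OF m] by (metis Suc_leI linorder_neqE_nat)
          then show False
            using i by auto
        qed
      qed
      also have "nrm (\<Sum>k\<in>supp \<alpha>. (\<lambda>i. \<alpha> k * ?v k i)) \<le> (\<Sum>k\<in>supp \<alpha>. nrm (\<lambda>i. \<alpha> k * ?v k i))"
        by (rule nrm_sum_le[OF \<alpha> v])
      also have "\<dots> \<le> (\<Sum>k\<in>supp \<alpha>. lp_norm p \<alpha> * (1/2) ^ k)"
      proof (rule sum_mono)
        fix k
        have "nrm (?v k) \<le> 1 * nrm (restr (- ?I k) (x (r k)))"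
          using x(1)[OF r(2), of k] d(1)
          by (intro finitary_dominated(2) finitary_restr(1))
            (auto simp: restr_def diag_def norm_mult intro: mult_left_le_one_le)
        then have "nrm (?v k) \<le> (1/2) ^ k"
          using small[of k] by simp
        then show "nrm (\<lambda>i. \<alpha> k * ?v k i) \<le> lp_norm p \<alpha> * (1/2) ^ k"
          unfolding finitary_scale(2)[OF finitary_restr(1)[OF y]]
          using lp_norm_coord[OF \<alpha>, of k] nrm_nonneg[OF finitary_bounded[OF finitary_restr(1)[OF y]]] \<alpha>
          by (intro mult_mono) auto
      qed
      also have "\<dots> \<le> lp_norm p \<alpha> * 2"
        unfolding sum_distrib_left[symmetric]
      proof (rule mult_left_mono)
        have "(\<Sum>k\<in>supp \<alpha>. (1/2 :: real) ^ k) \<le> (\<Sum>k. (1/2) ^ k)"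
          by (intro sum_le_suminf summable_geometric \<alpha>) auto
        then show "(\<Sum>k\<in>supp \<alpha>. (1/2 :: real) ^ k) \<le> 2"
          by (simp add: suminf_geometric)
      qed (use \<alpha> in simp)
      finally show ?thesis
        by (simp add: algebra_simps)
    qed
    moreover have "(real N + 2) * lp_norm p \<alpha> \<le> (real N + 2 + \<epsilon>) * lp_norm p \<alpha>"
      if "finite (supp \<alpha>)" for \<alpha> :: "nat \<Rightarrow> 'k"
      using \<epsilon> that by (intro mult_right_mono) auto
    ultimately have "\<forall>\<alpha>\<in>schreier_coeffs z \<xi>.
        nrm (\<Sum>k\<in>supp \<alpha>. (\<lambda>i. \<alpha> k * ?T (x (r k)) i)) \<le> (real N + 2 + \<epsilon>) * lp_norm p \<alpha>"
      unfolding schreier_coeffs_def using order_trans by blast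
    moreover have "strict_mono_on {1..} r" "r ` {1..} \<subseteq> {1..}"
      using r by (auto simp: strict_mono_on_def strict_mono_def)
    ultimately show "\<exists>r. strict_mono_on {1..} r \<and> r ` {1..} \<subseteq> {1..} \<and>
        (\<forall>\<alpha>\<in>schreier_coeffs z \<xi>. vnorm packing_space
          (\<Sum>k\<in>supp \<alpha>. vscale packing_space (\<alpha> k) (?T (x (r k)))) \<le> (real N + 2 + \<epsilon>) * lp_norm p \<alpha>)"
      by (intro exI[of _ r]) simp
  qed
  then show ?thesis
    unfolding WD_infinity_def by (intro UN_I[of "real N + 2"]) auto
qed

lemma nrm_unit_vec: "nrm (unit_vec i :: nat \<Rightarrow> 'k :: {real_normed_field, banach}) = 1"
proof (rule antisym)
  have one: "norm (unit_vec i i :: 'k) = 1"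
    by (simp add: unit_vec_def)
  show "nrm (unit_vec i :: nat \<Rightarrow> 'k) \<le> 1"
  proof (rule nrm_le)
    fix F assume "packing F"
    then show "packing_norm F (unit_vec i :: nat \<Rightarrow> 'k) \<le> 1"
      using packing_norm_single[of F "unit_vec i :: nat \<Rightarrow> 'k" i] one by simp
  qed
  show "1 \<le> nrm (unit_vec i :: nat \<Rightarrow> 'k)"
    using coord_le_nrm[OF bounded_seq_finite, of "unit_vec i :: nat \<Rightarrow> 'k" i] one by simp
qed

lemma unit_vec_weakly_null:
  assumes "\<And>n. n \<le> e n"
  shows "weakly_null packing_space (\<lambda>n. unit_vec (e n) :: nat \<Rightarrow> 'k :: {real_normed_field, banach})"
proof -
  have "(\<lambda>n. f (unit_vec (e n))) \<longlonglongrightarrow> 0" if f: "f \<in> dual" for f :: "(nat \<Rightarrow> 'k) \<Rightarrow> 'k"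
  proof (rule LIMSEQ_I)
    fix \<delta> :: real assume "0 < \<delta>"
    then obtain m where m: "\<And>y. y \<in> finitary \<Longrightarrow> norm (f (restr {m..} y)) \<le> \<delta> / 2 * nrm y"
      using functional_small_on_tails[OF f, of "\<delta> / 2"] by auto
    have "norm (f (unit_vec (e n))) < \<delta>" if "m \<le> n" for n
    proof -
      have "restr {m..} (unit_vec (e n)) = (unit_vec (e n) :: nat \<Rightarrow> 'k)"
        using that assms[of n] by (intro restr_id) simp
      then show ?thesis
        using m[of "unit_vec (e n)"] \<open>0 < \<delta>\<close> by (simp add: finitary_finite nrm_unit_vec)
    qed
    then show "\<exists>m. \<forall>n\<ge>m. norm (f (unit_vec (e n)) - 0) < \<delta>"
      by auto
  qed
  then show ?thesis
    by (simp add: weakly_null_def finitary_finite)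
qed

text \<open>The exponent is negative, so that the weights tend to \<open>0\<close> as the color grows, but only half
  as large as needed to compensate the growth \<open>n powr rate\<close> of the constants.\<close>

definition weight :: "nat \<Rightarrow> real"
  where "weight i = real (color i) powr - (rate / 2)"

lemma weight_bounds: "\<bar>weight i\<bar> \<le> 1" "1 \<le> n \<Longrightarrow> n < color i \<Longrightarrow> \<bar>weight i\<bar> \<le> real n powr - (rate / 2)"
proof -
  have "1 \<le> color i"
    using color_pos[of i] by simp
  then show "\<bar>weight i\<bar> \<le> 1"
    using powr_mono2'[of "- (rate / 2)" 1 "real (color i)"] rate_pos by (simp add: weight_def)
  show "1 \<le> n \<Longrightarrow> n < color i \<Longrightarrow> \<bar>weight i\<bar> \<le> real n powr - (rate / 2)"
    unfolding weight_def using rate_pos by (simp add: powr_mono2')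
qed

text \<open>Among the unit vectors of color \<open>n\<close>, which form a weakly null sequence, any \<open>n\<close> make up an
  admissible set. The Schreier set \<open>{n..<2 * n}\<close> picks \<open>n\<close> of them from any subsequence; the
  norm of the image of their sum is at least \<open>n * n powr - (rate / 2)\<close>, whereas the \<open>\<ell>\<^sub>p\<close> norm
  of the coefficients is at most \<open>n powr (1 - rate)\<close>.\<close>

lemma diag_weight_not_WD:
  fixes z \<xi>
  assumes z: "fundamental_sequences z" and \<xi>: "1 \<le> \<xi>"
  shows "(diag weight :: (nat \<Rightarrow> 'k :: {real_normed_field, banach}) \<Rightarrow> _)
    \<notin> WD_infinity z p \<xi> packing_space packing_space"
proof
  let ?T = "diag weight :: (nat \<Rightarrow> 'k) \<Rightarrow> _"
  assume "?T \<in> WD_infinity z p \<xi> packing_space packing_space"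
  then obtain C where C: "0 \<le> C" "?T \<in> WD z p C \<xi> packing_space packing_space"
    by (auto simp: WD_infinity_def)
  obtain n0 :: nat where n0: "1 \<le> n0" "C + 1 < real n0 powr (rate / 2)"
    using powr_unbounded[of "rate / 2" "C + 1"] rate_pos by auto
  define n where "n = Suc n0"
  have n: "2 \<le> n" "C + 1 < real n powr (rate / 2)"
    using n0 powr_mono2[of "rate / 2" "real n0" "real n"] rate_pos by (auto simp: n_def)
  define e where "e = (\<lambda>k. prod_encode (n0, k))"
  have e: "inj e" "color (e k) = n" "k \<le> e k" for k
    by (auto simp: e_def n_def inj_on_def le_prod_encode_2)
  let ?x = "\<lambda>k. unit_vec (e k) :: nat \<Rightarrow> 'k"
  have "normalized packing_space ?x" "weakly_null packing_space ?x"
    using unit_vec_weakly_null[of e] e(3) by (auto simp: normalized_def finitary_finite nrm_unit_vec)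
  then obtain r where r: "strict_mono_on {1..} r"
    and bound: "\<And>\<alpha> :: nat \<Rightarrow> 'k. \<alpha> \<in> schreier_coeffs z \<xi> \<Longrightarrow>
      nrm (\<Sum>k\<in>supp \<alpha>. (\<lambda>i. \<alpha> k * ?T (?x (r k)) i)) \<le> (C + 1) * lp_norm p \<alpha>"
    using C(2) unfolding WD_def by (force simp: zero_less_one dest!: spec[where x = "1::real"])
  define S where "S = {n..<2 * n}"
  define \<alpha> :: "nat \<Rightarrow> 'k" where "\<alpha> = (\<lambda>k. if k \<in> S then 1 else 0)"
  have supp: "supp \<alpha> = S"
    by (auto simp: supp_def \<alpha>_def)
  let ?y = "\<Sum>k\<in>S. (\<lambda>i. \<alpha> k * ?T (?x (r k)) i)"
  let ?w = "real n powr - (rate / 2)"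
  have "\<alpha> \<in> schreier_coeffs z \<xi>"
    using schreier_interval[OF z \<xi> n(1)] by (simp add: schreier_coeffs_def supp S_def)
  then have "nrm ?y \<le> (C + 1) * lp_norm p \<alpha>"
    using bound[of \<alpha>] by (simp add: supp)
  also have "lp_norm p \<alpha> \<le> real n powr (1 - rate)"
    using lp_norm_ones[of S] lp_norm_norm[of \<alpha>] by (simp add: S_def \<alpha>_def if_distrib cong: if_cong)
  also have "real n * ?w \<le> nrm ?y"
  proof -
    have inj: "inj_on (\<lambda>k. e (r k)) S"
      using e(1) strict_mono_on_imp_inj_on[OF r] n(1) by (auto simp: inj_on_def S_def)
    let ?A = "(\<lambda>k. e (r k)) ` S"
    have A: "admissible ?A"
      unfolding admissible_def using card_image[OF inj] e(2) by (auto simp: S_def intro!: exI[of _ n])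
    have "finite (supp ?y)"
    proof (rule finite_subset)
      have "?y i = 0" if "i \<notin> ?A" for i
        unfolding sum_fun_apply using that
        by (intro sum.neutral) (auto simp: diag_def unit_vec_def)
      then show "supp ?y \<subseteq> ?A"
        by (force simp: supp_def)
    qed (simp add: S_def)
    then have "(\<Sum>i\<in>?A. norm (?y i)) \<le> nrm ?y"
      by (intro admissible_sum_le_nrm bounded_seq_finite A)
    moreover have "norm (?y (e (r l))) = ?w" if l: "l \<in> S" for l
    proof -
      have "?y (e (r l)) = (\<Sum>k\<in>S. if k = l then of_real (weight (e (r l))) else 0)"
        unfolding sum_fun_apply
        using inj_onD[OF inj] l
        by (intro sum.cong) (auto simp: \<alpha>_def diag_def finitary_finite unit_vec_apply)
      then show ?thesis
        using l by (simp add: weight_def e(2) S_def)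
    qed
    ultimately show ?thesis
      by (simp add: sum.reindex[OF inj]) (simp add: S_def)
  qed
  finally have "real n * ?w \<le> (C + 1) * real n powr (1 - rate)"
    using C(1) by (simp add: mult_left_mono)
  also have "\<dots> < real n powr (rate / 2) * real n powr (1 - rate)"
    using n by (intro mult_strict_right_mono) auto
  also have "\<dots> = real n * ?w"
    using n(1) by (simp add: powr_mult_base flip: powr_add)
  finally show False
    by simp
qed

lemma WD_infinity_not_closed:
  assumes z: "fundamental_sequences z" and \<xi>: "1 \<le> \<xi>"
  defines "X \<equiv> packing_space :: ('k :: {real_normed_field, banach}, _) nspace"
  shows "\<not> closedin (norm_topology (operator_space X X)) (WD_infinity z p \<xi> X X)"
proof
  assume closed: "closedin (norm_topology (operator_space X X)) (WD_infinity z p \<xi> X X)"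
  have X: "normed_space X"
    unfolding X_def by (rule normed_packing_space)
  interpret M: Metric_space "vcarrier (operator_space X X)" "vdist (operator_space X X)"
    by (rule Metric_space_vdist[OF normed_space_operator_space[OF X X]])
  let ?T = "diag weight :: (nat \<Rightarrow> 'k) \<Rightarrow> _"
  let ?trunc = "\<lambda>N i. if color i \<le> N then weight i else 0"
  let ?TN = "\<lambda>N. diag (?trunc N) :: (nat \<Rightarrow> 'k) \<Rightarrow> _"
  have carrier: "vcarrier (operator_space X X) = operators X X"
    by (simp add: operator_space_def)
  have T: "?T \<in> operators X X" "?TN N \<in> operators X X" for N
    unfolding X_def using weight_bounds(1) by (auto intro!: diag_operator[where A = 1])
  have "?T \<notin> WD_infinity z p \<xi> X X"
    unfolding X_def by (rule diag_weight_not_WD[OF z \<xi>])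
  then have outside: "?T \<in> vcarrier (operator_space X X) - WD_infinity z p \<xi> X X"
    using T(1) carrier by simp
  have "\<forall>S. S \<in> vcarrier (operator_space X X) - WD_infinity z p \<xi> X X \<longrightarrow>
      (\<exists>r>0. disjnt (WD_infinity z p \<xi> X X) (M.mball S r))"
    using closed unfolding norm_topology_def M.closedin_metric by (rule conjunct2)
  from this[rule_format, OF outside]
  obtain \<delta> where \<delta>: "0 < \<delta>" "disjnt (WD_infinity z p \<xi> X X) (M.mball ?T \<delta>)"
    by (elim exE conjE)
  obtain N :: nat where N: "1 \<le> N" "1 / \<delta> < real N powr (rate / 2)"
    using powr_unbounded[of "rate / 2" "1 / \<delta>"] rate_pos by auto
  have "?TN N \<in> WD_infinity z p \<xi> X X"
    unfolding X_def using weight_bounds(1) by (intro truncated_diag_WD[where N = N]) auto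
  moreover have "?TN N \<in> M.mball ?T \<delta>"
  proof -
    have "operator_norm X X (?T - ?TN N) \<le> real N powr - (rate / 2)"
      unfolding X_def using weight_bounds(2)[OF N(1)] by (intro diag_dist) auto
    also have "\<dots> < \<delta>"
      using N(2) \<delta>(1) less_imp_inverse_less[OF N(2)] by (simp add: powr_minus)
    finally have "vdist (operator_space X X) ?T (?TN N) < \<delta>"
      using T by (simp add: vdist_def operator_space_def)
    then show ?thesis
      using T unfolding M.in_mball unfolding carrier by blast
  qed
  ultimately show False
    using \<delta>(2) by (auto simp: disjnt_iff)
qed

end

theorem mainTheorem3:
  fixes p :: ereal and \<xi> :: ordinal_upto_omega1
    and z :: "countable_ordinal \<Rightarrow> nat \<Rightarrow> countable_ordinal"
  assumes "fundamental_sequences z"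
    and "1 < p" and "p \<le> \<infinity>"
    and "1 \<le> \<xi>" and "\<xi> \<le> Omega1"
  shows "(\<exists>X :: ('k :: {real_normed_field, banach}, nat \<Rightarrow> 'k) nspace.
      banach_space X \<and>
      \<not> closedin (norm_topology (operator_space X X)) (WD_infinity z p \<xi> X X)) \<and>
    (p \<noteq> \<infinity> \<longrightarrow> (\<exists>X :: ('k, nat \<Rightarrow> 'k) nspace.
      banach_space X \<and> reflexive_space X \<and>
      \<not> closedin (norm_topology (operator_space X X)) (WD_infinity z p \<xi> X X)))"
proof -
  interpret exponent p
    using assms(2) by unfold_locales
  show ?thesis
    using banach_packing_space reflexive_packing_space WD_infinity_not_closed[OF assms(1,4)] by blast
qed

end
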